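(* Let $\alpha, \beta \in \mathbb{R}$ and let $S \subset \mathbb{R}$. Suppose that the indicator function of $S$ can be expressed as a linear combination of indicator functions of intervals $I_1, \dots, I_N \subset \mathbb{R}$ whose lengths belong to $\mathbb{Z}\alpha + \mathbb{Z}\beta$; that is, there are scalars $c_1, \dots, c_N$ such that $$\mathbf{1}_S(x) = \sum_{j=1}^{N} c_j \, \mathbf{1}_{I_j}(x) \quad (x \in \mathbb{R}), \qquad |I_j| \in \mathbb{Z}\alpha + \mathbb{Z}\beta \quad (1 \le j \le N).$$ Then there is a set $\Lambda \subset \mathbb{R}$ such that the exponential system $E(\Lambda)$ is a Riesz basis in $L^2(S)$.
   Context: $\mathbb{Z}\alpha + \mathbb{Z}\beta$ denotes the set of real numbers of the form $n\alpha + m\beta$ with $n, m \in \mathbb{Z}$; $|I|$ is the length of an interval $I$ (so the intervals $I_j$ are bounded; they need not be disjoint); $\mathbf{1}_A$ is the indicator function of $A$. For $\Lambda \subset \mathbb{R}$, $E(\Lambda) = \{ x \mapsto e^{2\pi i \lambda x} : \lambda \in \Lambda \}$, regarded as a system of functions (indexed by $\Lambda$) in the space $L^2(S)$ of complex-valued square-integrable functions on $S$ with respect to Lebesgue measure. A Riesz basis of a Hilbert space has its usual meaning: the image of an orthonormal basis under a bounded invertible linear operator; equivalently, a complete system $\{e_\lambda\}$ for which there are constants $A, B > 0$ with $A \sum |c_\lambda|^2 \le \| \sum c_\lambda e_\lambda \|^2 \le B \sum |c_\lambda|^2$ for all finitely supported scalar sequences $(c_\lambda)$. The scalars $c_j$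 in the linear combination may be taken real or complex (the two readings are equivalent, by taking real parts). *)

theory Defs
  imports "HOL-Analysis.Analysis"
begin

text \<open>
  The space \<open>L\<^sup>2(M)\<close> is handled through its representatives: functions that are measurable with
  square-integrable modulus, two of them being identified when the norm below of their
  difference is zero.
\<close>

definition square_integrable :: "'a measure \<Rightarrow> ('a \<Rightarrow> complex) \<Rightarrow> bool" where
  "square_integrable M f \<longleftrightarrow>
     f \<in> borel_measurable M \<and> integrable M (\<lambda>x. (norm (f x))\<^sup>2)"

text \<open>Only meaningful for square-integrable functions: other integrals default to 0.\<close>

definition L2_norm :: "'a measure \<Rightarrow> ('a \<Rightarrow> complex) \<Rightarrow> real" where
  "L2_norm M f = sqrt (\<integral>x. (norm (f x))\<^sup>2 \<partial>M)"

text \<open>Completeness: the finite linear combinations of the system are dense in \<open>L\<^sup>2(M)\<close>.\<close>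

definition complete_system :: "'a measure \<Rightarrow> ('i \<Rightarrow> 'a \<Rightarrow> complex) \<Rightarrow> 'i set \<Rightarrow> bool" where
  "complete_system M e J \<longleftrightarrow>
     (\<forall>f. square_integrable M f \<longrightarrow>
        (\<forall>\<epsilon>>0. \<exists>F a. finite F \<and> F \<subseteq> J \<and>
           L2_norm M (\<lambda>x. f x - (\<Sum>i\<in>F. a i * e i x)) < \<epsilon>))"

definition riesz_bounds :: "'a measure \<Rightarrow> ('i \<Rightarrow> 'a \<Rightarrow> complex) \<Rightarrow> 'i set \<Rightarrow> bool" where
  "riesz_bounds M e J \<longleftrightarrow>
     (\<exists>A>0. \<exists>B>0. \<forall>F (a :: 'i \<Rightarrow> complex). finite F \<and> F \<subseteq> J \<longrightarrow>
        A * (\<Sum>i\<in>F. (norm (a i))\<^sup>2) \<le> (L2_norm M (\<lambda>x. \<Sum>i\<in>F. a i * e i x))\<^sup>2 \<and>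
        (L2_norm M (\<lambda>x. \<Sum>i\<in>F. a i * e i x))\<^sup>2 \<le> B * (\<Sum>i\<in>F. (norm (a i))\<^sup>2))"

definition riesz_basis :: "'a measure \<Rightarrow> ('i \<Rightarrow> 'a \<Rightarrow> complex) \<Rightarrow> 'i set \<Rightarrow> bool" where
  "riesz_basis M e J \<longleftrightarrow>
     (\<forall>i\<in>J. square_integrable M (e i)) \<and> complete_system M e J \<and> riesz_bounds M e J"

definition exponential :: "real \<Rightarrow> real \<Rightarrow> complex" where
  "exponential l x = exp (2 * complex_of_real pi * \<i> * complex_of_real l * complex_of_real x)"

definition int_combinations :: "real \<Rightarrow> real \<Rightarrow> real set" where
  "int_combinations \<alpha> \<beta> = {of_int n * \<alpha> + of_int m * \<beta> | n m :: int. True}"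

end

theory Submission
  imports Defs "HOL-Computational_Algebra.Polynomial"
begin

text \<open>
  The argument follows Kozma and Nitzan. After rescaling, \<open>S \<subseteq> [0,1)\<close> is a finite union of intervals and the frequencies are sought among the integers. For \<open>N \<ge> 1\<close> let \<open>B\<^sub>n\<close> be the set of
  \<open>y \<in> [0,1)\<close> for which at least \<open>n\<close> of the points \<open>(y + l) / N\<close>, \<open>l < N\<close>, lie in \<open>S\<close>. If each \<open>B\<^sub>n\<close> has a
  Riesz basis with integer frequencies \<open>\<Lambda>\<^sub>n\<close>, then \<open>S\<close> has one with frequencies \<open>\<Union>\<^sub>n (N \<Lambda>\<^sub>n + n - 1)\<close>: on each
  fibre this is a Vandermonde system. The function counting the points of \<open>S\<close> in the fibre over \<open>y\<close> is a
  step function with at most as many up-jumps as \<open>S\<close>, and unless it takes only two consecutive values all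
  its level sets have fewer up-jumps than \<open>S\<close>, so that induction applies. With at least two up-jumps some \<open>N\<close>
  escapes the two-valued case: otherwise the exponential sum \<open>D(N)\<close> of the jumps would satisfy
  \<open>|D(N)| \<le> 2\<close> for all \<open>N \<noteq> 0\<close> while the mean of \<open>|D|\<^sup>2\<close> is at least 4, which forces the almost periodic
  function \<open>4 - |D|\<^sup>2 \<ge> 0\<close> to vanish identically although \<open>D(0) = 0\<close>. A single arc is folded to a very
  short or very long one, where the frequencies \<open>\<lfloor>n / a\<rfloor>\<close> are a small perturbation of \<open>n / a\<close>.
\<close>

text \<open>The construction never proves completeness on \<open>S\<close> directly. It is encoded
  as a lower Riesz bound on the complement, so the property is symmetric under exchanging
  \<open>S\<close> and \<open>\<Lambda>\<close> with their complements, and one lower-bound estimate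
  for folds, applied on both sides, carries the whole basis property. Upper bounds are free because
  integer exponentials are orthonormal on \<open>{0..<1}\<close>. The obstacle is to make the
  induction decrease. Folding merges discontinuities and can only cancel jumps, so the number of
  up-jumps never grows, but it need not drop: a count with two consecutive values has a single
  non-trivial level, which may carry every jump. The threshold 2 that excludes this is the fall of a
  cosine over half a period; the mean square is the sum of the squared jumps, at least twice the
  number of up-jumps. A single arc cannot be simplified this way. Dirichlet's theorem makes
  \<open>N * (t - s)\<close> nearly an integer instead, and on a short window rounding the
  frequencies to integers is a small perturbation because the rounding error is multiplied by
  \<open>x\<close>.\<close>

lemma exponential_cis: "exponential l x = cis (2 * pi * l * x)"
  by (simp add: exponential_def cis_conv_exp mult_ac)

lemma exponential_add: "exponential (l + m) x = exponential l x * exponential m x"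
  by (simp add: exponential_cis cis_mult algebra_simps)

lemma exponential_add_right: "exponential l (x + y) = exponential l x * exponential l y"
  by (simp add: exponential_cis cis_mult algebra_simps)

lemma norm_exponential [simp]: "cmod (exponential l x) = 1"
  by (simp add: exponential_cis)

lemma exponential_0 [simp]: "exponential 0 x = 1" "exponential l 0 = 1"
  by (simp_all add: exponential_def)

lemma exponential_neq_0 [simp]: "exponential l x \<noteq> 0"
  by (metis norm_exponential norm_zero zero_neq_one)

lemma cnj_exponential: "cnj (exponential l x) = exponential (- l) x"
  by (simp add: exponential_cis flip: cis_cnj)

lemma exponential_int_eq_1 [simp]: "exponential (of_int k) (of_int m) = 1"
  using cis_multiple_2pi[of "of_int (k * m)"] by (simp add: exponential_cis mult_ac)

lemma exponential_eq_1_iff: "exponential 1 x = 1 \<longleftrightarrow> x \<in> \<int>"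
proof -
  have "exponential 1 x = 1 \<longleftrightarrow> (\<exists>n::int. 2 * pi * x = of_int n * (2 * pi))"
    by (simp add: exponential_def exp_eq_1 mult_ac)
  also have "\<dots> \<longleftrightarrow> x \<in> \<int>"
    by (auto simp: Ints_def)
  finally show ?thesis .
qed

lemma continuous_on_exponential [continuous_intros]:
  assumes "continuous_on A f"
  shows "continuous_on A (\<lambda>x. exponential l (f x))"
  unfolding exponential_def by (intro continuous_intros assms)

section \<open>Trigonometric polynomials with integer frequencies\<close>

definition trig_poly :: "int set \<Rightarrow> (int \<Rightarrow> complex) \<Rightarrow> real \<Rightarrow> complex" where
  "trig_poly F a x = (\<Sum>k\<in>F. a k * exponential (of_int k) x)"

lemma continuous_on_trig_poly [continuous_intros]:
  assumes "continuous_on A f"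
  shows "continuous_on A (\<lambda>x. trig_poly F a (f x))"
  unfolding trig_poly_def by (intro continuous_intros assms)

lemma trig_poly_translate:
  "trig_poly F a (x + y) = trig_poly F (\<lambda>k. a k * exponential (of_int k) y) x"
  by (simp add: trig_poly_def exponential_add_right mult_ac)

lemma trig_poly_plus_int [simp]: "trig_poly F a (x + of_int m) = trig_poly F a x"
  by (simp add: trig_poly_translate)

section \<open>Squared norms on subsets of the line\<close>

definition energy :: "real set \<Rightarrow> (real \<Rightarrow> complex) \<Rightarrow> real" where
  "energy S f = (LINT x:S|lborel. (cmod (f x))\<^sup>2)"

lemma set_integrable_continuous_bounded:
  fixes g :: "real \<Rightarrow> 'a::euclidean_space"
  assumes "continuous_on UNIV g" "S \<in> sets borel" "bounded S"
  shows "set_integrable lborel S g"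
proof -
  obtain r where "S \<subseteq> {-r..r}"
    using assms(3) bounded_subset_box_symmetric[of S] bounded_iff[of S]
    by (metis abs_le_iff atLeastAtMost_iff minus_le_iff real_norm_def subsetI)
  moreover have "set_integrable lborel {-r..r} g"
    by (rule borel_integrable_atLeastAtMost') (rule continuous_on_subset[OF assms(1)], simp)
  ultimately show ?thesis
    using assms(2) set_integrable_subset by (metis sets_lborel)
qed

lemma set_integrable_energy:
  fixes f :: "real \<Rightarrow> complex"
  assumes "continuous_on UNIV f" "S \<in> sets borel" "bounded S"
  shows "set_integrable lborel S (\<lambda>x. (cmod (f x))\<^sup>2)"
  using assms by (intro set_integrable_continuous_bounded continuous_intros)

lemma energy_nonneg [simp]: "0 \<le> energy S f"
  unfolding energy_def set_lebesgue_integral_def by (intro integral_nonneg_AE) auto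

lemma energy_cong: "(\<And>x. x \<in> S \<Longrightarrow> cmod (f x) = cmod (g x)) \<Longrightarrow> energy S f = energy S g"
  unfolding energy_def set_lebesgue_integral_def
  by (intro Bochner_Integration.integral_cong) (auto simp: indicator_def)

lemma energy_subset:
  assumes "continuous_on UNIV f" "S \<in> sets borel" "T \<in> sets borel" "bounded T" "S \<subseteq> T"
  shows "energy S f \<le> energy T f"
proof -
  have "bounded S" using assms bounded_subset by blast
  then show ?thesis
    unfolding energy_def set_lebesgue_integral_def
    using set_integrable_energy[OF assms(1,2)] set_integrable_energy[OF assms(1,3,4)] assms(5)
    by (intro integral_mono) (auto simp: set_integrable_def indicator_def)
qed

lemma energy_Un:
  assumes "continuous_on UNIV f" "S \<in> sets borel" "T \<in> sets borel" "bounded S" "bounded T"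
    and "S \<inter> T = {}"
  shows "energy (S \<union> T) f = energy S f + energy T f"
  unfolding energy_def
  by (intro set_integral_Un assms set_integrable_energy)

lemma energy_le_sum:
  assumes "finite I" "continuous_on UNIV f" "\<And>i. i \<in> I \<Longrightarrow> continuous_on UNIV (g i)"
    and "S \<in> sets borel" "bounded S"
    and "\<And>x. x \<in> S \<Longrightarrow> (cmod (f x))\<^sup>2 \<le> (\<Sum>i\<in>I. c i * (cmod (g i x))\<^sup>2)"
  shows "energy S f \<le> (\<Sum>i\<in>I. c i * energy S (g i))"
proof -
  have *: "set_integrable lborel S (\<lambda>x. c i * (cmod (g i x))\<^sup>2)" if "i \<in> I" for i
    by (intro set_integrable_continuous_bounded continuous_intros assms that)
  have "energy S f \<le> (LINT x:S|lborel. (\<Sum>i\<in>I. c i * (cmod (g i x))\<^sup>2))"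
    unfolding energy_def
    by (intro set_integral_mono set_integrable_energy assms
         set_integrable_continuous_bounded continuous_intros) auto
  also have "\<dots> = (\<Sum>i\<in>I. LINT x:S|lborel. c i * (cmod (g i x))\<^sup>2)"
    using * unfolding set_lebesgue_integral_def set_integrable_def scaleR_sum_right
    by (intro Bochner_Integration.integral_sum)
  also have "\<dots> = (\<Sum>i\<in>I. c i * energy S (g i))"
    by (simp add: energy_def)
  finally show ?thesis .
qed

lemma energy_le_two:
  assumes "continuous_on UNIV f" "continuous_on UNIV g" "continuous_on UNIV h"
    and "S \<in> sets borel" "bounded S"
    and "\<And>x. x \<in> S \<Longrightarrow> (cmod (f x))\<^sup>2 \<le> c * (cmod (g x))\<^sup>2 + d * (cmod (h x))\<^sup>2"
  shows "energy S f \<le> c * energy S g + d * energy S h"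
  using energy_le_sum[of "UNIV :: bool set" f "\<lambda>b. if b then g else h" S "\<lambda>b. if b then c else d"]
    assms by (simp add: UNIV_bool add.commute)

text \<open>Young's inequality with a free weight: the main term keeps a factor close to 1 while the
  large factor falls on a term known to be small.\<close>

lemma norm_add_square_le:
  assumes "K > 0"
  shows "(cmod (x + y))\<^sup>2 \<le> (1 + K) * (cmod x)\<^sup>2 + (1 + 1 / K) * (cmod y)\<^sup>2"
proof -
  have "0 \<le> (K * cmod x - cmod y)\<^sup>2 / K" using assms by simp
  also have "\<dots> = K * (cmod x)\<^sup>2 - 2 * cmod x * cmod y + (cmod y)\<^sup>2 / K"
    using assms by (simp add: power2_eq_square field_simps)
  finally have "2 * cmod x * cmod y \<le> K * (cmod x)\<^sup>2 + (cmod y)\<^sup>2 / K" by simp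
  moreover have "(cmod (x + y))\<^sup>2 \<le> (cmod x + cmod y)\<^sup>2"
    by (intro power_mono norm_triangle_ineq) auto
  ultimately show ?thesis by (simp add: power2_sum algebra_simps)
qed

lemma energy_affine:
  assumes "c \<noteq> 0"
  shows "energy S f = \<bar>c\<bar> * energy {x. t + c * x \<in> S} (\<lambda>x. f (t + c * x))"
  unfolding energy_def set_lebesgue_integral_def
  by (subst lborel_integral_real_affine[OF assms, of _ t]) (simp add: indicator_def)

lemma energy_translate:
  "energy {u + s..<v + s} f = energy {u..<v} (\<lambda>x. f (x + s))"
proof -
  have "{x. s + 1 * x \<in> {u + s..<v + s}} = {u..<v}" by auto
  then show ?thesis using energy_affine[of 1 "{u + s..<v + s}" f s] by (simp add: add.commute)
qed

lemma set_integral_exponential_int: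
  "(LINT x:{0..<1}|lborel. exponential (of_int k) x) = (if k = 0 then 1 else 0)"
proof -
  have "(LINT x:{0..<1}|lborel. exponential (of_int k) x)
      = (LINT x:{0..1}|lborel. exponential (of_int k) x)"
  proof -
    have "AE x in lborel. x \<noteq> (1::real)"
      by (rule AE_lborel_singleton)
    then show ?thesis
      unfolding set_lebesgue_integral_def
      by (intro integral_cong_AE)
         (auto simp: exponential_def indicator_def elim!: eventually_mono)
  qed
  also have "\<dots> = (if k = 0 then 1 else 0)"
  proof (cases "k = 0")
    case True
    then show ?thesis by (simp add: set_lebesgue_integral_def)
  next
    case False
    define F where "F = (\<lambda>x::real. exponential (of_int k) x / (2 * pi * \<i> * of_int k))"
    have "(F has_vector_derivative exponential (of_int k) x) (at x within {0..1})" for x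
      unfolding F_def exponential_def using False
      by (auto intro!: derivative_eq_intros has_vector_derivative_real_field simp: field_simps)
    then have "(\<integral>x. indicator {0..1} x *\<^sub>R exponential (of_int k) x \<partial>lborel) = F 1 - F 0"
      by (intro integral_FTC_atLeastAtMost continuous_intros) auto
    also have "\<dots> = 0"
      using exponential_int_eq_1[of k 1] by (simp add: F_def)
    finally show ?thesis using False by (simp add: set_lebesgue_integral_def)
  qed
  finally show ?thesis .
qed

lemma parseval:
  assumes "finite F"
  shows "energy {0..<1} (trig_poly F a) = (\<Sum>k\<in>F. (cmod (a k))\<^sup>2)"
proof -
  have sq: "complex_of_real ((cmod (trig_poly F a x))\<^sup>2)
      = (\<Sum>k\<in>F. \<Sum>l\<in>F. a k * cnj (a l) * exponential (of_int (k - l)) x)" for x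
    unfolding complex_norm_square trig_poly_def cnj_sum sum_product
    by (intro sum.cong refl) (simp add: cnj_exponential exponential_add diff_conv_add_uminus del: add_uminus_conv_diff)
  have int: "integrable lborel (\<lambda>x. indicator {0..<1} x *\<^sub>R exponential (of_int k) x)" for k
    using set_integrable_continuous_bounded[of "\<lambda>x. exponential (of_int k) x" "{0..<1}"]
    by (simp add: set_integrable_def continuous_on_exponential)
  have "complex_of_real (energy {0..<1} (trig_poly F a))
      = (LINT x:{0..<1}|lborel. complex_of_real ((cmod (trig_poly F a x))\<^sup>2))"
    unfolding energy_def by (simp add: set_integral_complex_of_real del: of_real_power)
  also have "\<dots> = (\<integral>x. (\<Sum>k\<in>F. \<Sum>l\<in>F. (a k * cnj (a l)) *
       (indicator {0..<1} x *\<^sub>R exponential (of_int (k - l)) x)) \<partial>lborel)"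
    unfolding set_lebesgue_integral_def sq
    by (intro Bochner_Integration.integral_cong) (auto simp: scaleR_sum_right)
  also have "\<dots> = (\<Sum>k\<in>F. \<Sum>l\<in>F. (a k * cnj (a l)) *
       (LINT x:{0..<1}|lborel. exponential (of_int (k - l)) x))"
    unfolding set_lebesgue_integral_def
    by (simp add: int Bochner_Integration.integral_sum Bochner_Integration.integrable_sum
        del: mult_scaleR_right of_int_diff)
  also have "\<dots> = (\<Sum>k\<in>F. \<Sum>l\<in>F. if l = k then a k * cnj (a l) else 0)"
    unfolding set_integral_exponential_int by (intro sum.cong refl) auto
  also have "\<dots> = complex_of_real (\<Sum>k\<in>F. (cmod (a k))\<^sup>2)"
    using assms by (simp add: complex_norm_square del: of_real_power)
  finally show ?thesis using of_real_eq_iff by blast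
qed

section \<open>Lower Riesz bounds and duality\<close>

text \<open>Only the lower half of the Riesz bounds is recorded: inside \<open>{0..<1}\<close> the
  upper half holds with constant 1 by \<open>parseval\<close>.\<close>

definition riesz_lower :: "real set \<Rightarrow> int set \<Rightarrow> bool" where
  "riesz_lower S \<Lambda> \<longleftrightarrow> (\<exists>c>0. \<forall>F a. finite F \<longrightarrow> F \<subseteq> \<Lambda> \<longrightarrow>
     c * (\<Sum>k\<in>F. (cmod (a k))\<^sup>2) \<le> energy S (trig_poly F a))"

text \<open>
  For \<open>\<Lambda> \<subseteq> \<int>\<close> and \<open>S \<subseteq> [0,1)\<close> completeness of \<open>E(\<Lambda>)\<close> in \<open>L\<^sup>2(S)\<close> is dual to the lower Riesz bound
  for the complementary frequencies on the complementary set.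
\<close>

definition has_integer_basis :: "real set \<Rightarrow> bool" where
  "has_integer_basis S \<longleftrightarrow> (\<exists>\<Lambda>. riesz_lower S \<Lambda> \<and> riesz_lower ({0..<1} - S) (- \<Lambda>))"

text \<open>Conjugation negates frequencies and multiplication by \<open>exponential c\<close>
  shifts them; neither changes the modulus of a function.\<close>

lemma riesz_lower_reflect:
  assumes "riesz_lower S \<Lambda>"
  shows "riesz_lower S {k. c - k \<in> \<Lambda>}"
proof -
  obtain d where d: "d > 0" "\<And>F a. finite F \<Longrightarrow> F \<subseteq> \<Lambda> \<Longrightarrow>
     d * (\<Sum>k\<in>F. (cmod (a k))\<^sup>2) \<le> energy S (trig_poly F a)"
    using assms unfolding riesz_lower_def by blast
  have "d * (\<Sum>k\<in>F. (cmod (a k))\<^sup>2) \<le> energy S (trig_poly F a)"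
    if F: "finite F" "F \<subseteq> {k. c - k \<in> \<Lambda>}" for F and a :: "int \<Rightarrow> complex"
  proof -
    define F' a' where "F' = (\<lambda>k. c - k) ` F" and "a' = (\<lambda>k. cnj (a (c - k)))"
    have inj: "inj_on (\<lambda>k. c - k) F" by (auto simp: inj_on_def)
    have *: "exponential (of_int c) x * cnj (exponential (of_int (c - k)) x)
        = exponential (of_int k) x" for k x
      by (simp add: cnj_exponential flip: exponential_add)
    have "trig_poly F a x = exponential (of_int c) x * cnj (trig_poly F' a' x)" for x
      unfolding trig_poly_def F'_def a'_def sum.reindex[OF inj] cnj_sum sum_distrib_left
      by (intro sum.cong refl) (simp add: mult.left_commute * flip: of_int_diff)
    then have "energy S (trig_poly F a) = energy S (trig_poly F' a')"
      by (intro energy_cong) (simp add: norm_mult)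
    moreover have "(\<Sum>k\<in>F. (cmod (a k))\<^sup>2) = (\<Sum>k\<in>F'. (cmod (a' k))\<^sup>2)"
      unfolding F'_def a'_def sum.reindex[OF inj] by simp
    ultimately show ?thesis using d(2)[of F' a'] F by (auto simp: F'_def)
  qed
  then show ?thesis using d(1) unfolding riesz_lower_def by blast
qed

lemma riesz_lower_mono:
  assumes "riesz_lower S \<Lambda>" "\<Lambda>' \<subseteq> \<Lambda>"
  shows "riesz_lower S \<Lambda>'"
  using assms unfolding riesz_lower_def by (meson subset_trans)

lemma riesz_lower_empty [simp]: "riesz_lower S {}"
  unfolding riesz_lower_def by (intro exI[of _ 1]) auto

lemma riesz_lower_unit_interval: "riesz_lower {0..<1} \<Lambda>"
  unfolding riesz_lower_def by (intro exI[of _ 1]) (auto simp: parseval)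

lemma has_integer_basis_Compl:
  assumes "has_integer_basis S" "S \<subseteq> {0..<1}"
  shows "has_integer_basis ({0..<1} - S)"
  using assms unfolding has_integer_basis_def
  by (metis double_complement double_diff order_refl)

lemma has_integer_basis_unit_interval [simp]: "has_integer_basis {0..<1}"
  unfolding has_integer_basis_def
  by (intro exI[of _ UNIV]) (simp add: riesz_lower_unit_interval)

lemma has_integer_basis_empty [simp]: "has_integer_basis {}"
  using has_integer_basis_Compl[OF has_integer_basis_unit_interval] by simp

subsection \<open>Folding the circle\<close>

text \<open>Newton's divided difference. The induction applies the functional for \<open>Z\<close>
  to the quotient of \<open>p - p(z0)\<close> by \<open>X - z0\<close>, which divides each weight by
  \<open>z - z0\<close> and gives \<open>z0\<close> minus the sum of these new weights.\<close>

lemma top_coeff_functional: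
  fixes Z :: "'a::field set"
  assumes "finite Z" "Z \<noteq> {}"
  shows "\<exists>w. \<forall>p. degree p < card Z \<longrightarrow> coeff p (card Z - 1) = (\<Sum>z\<in>Z. w z * poly p z)"
  using assms
proof (induction rule: finite_ne_induct)
  case (singleton z)
  show ?case
    by (intro exI[of _ "\<lambda>_. 1"]) (auto elim!: degree_eq_zeroE)
next
  case (insert z0 Z)
  obtain w where w: "\<And>p. degree p < card Z \<Longrightarrow> coeff p (card Z - 1) = (\<Sum>z\<in>Z. w z * poly p z)"
    using insert.IH by blast
  define w' where "w' = (\<lambda>z. if z = z0 then - (\<Sum>z\<in>Z. w z / (z - z0)) else w z / (z - z0))"
  have card: "card Z > 0" "card (insert z0 Z) = Suc (card Z)"
    using insert.hyps by (simp_all add: card_gt_0_iff)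
  have "coeff p (card Z) = (\<Sum>z\<in>insert z0 Z. w' z * poly p z)" if p: "degree p < Suc (card Z)" for p
  proof -
    define q where "q = synthetic_div p z0"
    have pq: "p = pCons (poly p z0) q - smult z0 q"
      using synthetic_div_correct[of p z0] by (simp add: q_def algebra_simps)
    have deg: "degree q < card Z"
      using p card by (simp add: q_def degree_synthetic_div)
    have "coeff p (card Z) = coeff q (card Z - 1) - z0 * coeff q (card Z)"
      using card by (subst pq) (simp add: coeff_pCons split: nat.split)
    also have "coeff q (card Z) = 0" using deg by (rule coeff_eq_0)
    also have "coeff q (card Z - 1) = (\<Sum>z\<in>Z. w z * poly q z)" using w[OF deg] .
    also have "\<dots> = (\<Sum>z\<in>Z. w z / (z - z0) * (poly p z - poly p z0))"
    proof (intro sum.cong refl)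
      fix z assume "z \<in> Z"
      then have "z \<noteq> z0" using insert.hyps by auto
      moreover have "poly p z = poly p z0 + z * poly q z - z0 * poly q z"
        by (subst pq) simp
      then have "poly p z - poly p z0 = (z - z0) * poly q z"
        by (simp add: algebra_simps)
      ultimately show "w z * poly q z = w z / (z - z0) * (poly p z - poly p z0)" by simp
    qed
    also have "\<dots> = (\<Sum>z\<in>insert z0 Z. w' z * poly p z)"
    proof -
      have "(\<Sum>z\<in>Z. w' z * poly p z) = (\<Sum>z\<in>Z. w z / (z - z0) * poly p z)"
        using insert.hyps by (intro sum.cong) (auto simp: w'_def)
      then show ?thesis
        using insert.hyps by (simp add: w'_def sum_subtractf sum_distrib_right right_diff_distrib)
    qed
    finally show ?thesis by simp
  qed
  then show ?case unfolding card(2) by (intro exI[of _ w']) simp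
qed

lemma top_coeff_bound:
  fixes Z :: "complex set"
  assumes "finite Z" "card Z = Suc n"
  shows "\<exists>C\<ge>0. \<forall>b. (cmod (b n))\<^sup>2 \<le> C * (\<Sum>z\<in>Z. (cmod (\<Sum>i\<le>n. b i * z ^ i))\<^sup>2)"
proof -
  obtain w where w: "\<And>p. degree p < card Z \<Longrightarrow> coeff p (card Z - 1) = (\<Sum>z\<in>Z. w z * poly p z)"
    using top_coeff_functional[of Z] assms by (metis card.empty nat.distinct(1))
  have "(cmod (b n))\<^sup>2 \<le> (\<Sum>z\<in>Z. (cmod (w z))\<^sup>2) * (\<Sum>z\<in>Z. (cmod (\<Sum>i\<le>n. b i * z ^ i))\<^sup>2)" for b
  proof -
    define p where "p = (\<Sum>i\<le>n. monom (b i) i)"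
    have p: "poly p z = (\<Sum>i\<le>n. b i * z ^ i)" for z
      by (simp add: p_def poly_sum poly_monom)
    have "degree p \<le> n" unfolding p_def
      by (intro degree_sum_le) (auto intro: order_trans[OF degree_monom_le])
    moreover have "coeff p n = b n" by (simp add: p_def coeff_sum)
    ultimately have "b n = (\<Sum>z\<in>Z. w z * poly p z)" using w[of p] assms by simp
    then have "cmod (b n) \<le> (\<Sum>z\<in>Z. cmod (w z) * cmod (poly p z))"
      using norm_sum[of "\<lambda>z. w z * poly p z" Z] by (simp add: norm_mult)
    then have "(cmod (b n))\<^sup>2 \<le> (\<Sum>z\<in>Z. cmod (w z) * cmod (poly p z))\<^sup>2"
      by (intro power_mono) auto
    also have "\<dots> \<le> (\<Sum>z\<in>Z. (cmod (w z))\<^sup>2) * (\<Sum>z\<in>Z. (cmod (poly p z))\<^sup>2)"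
      by (rule Cauchy_Schwarz_ineq_sum)
    finally show ?thesis by (simp add: p)
  qed
  moreover have "0 \<le> (\<Sum>z\<in>Z. (cmod (w z))\<^sup>2)" by (simp add: sum_nonneg)
  ultimately show ?thesis by blast
qed

lemma energy_le_sum_sets:
  assumes "finite I" "continuous_on UNIV f" "\<And>i. i \<in> I \<Longrightarrow> continuous_on UNIV (g i)"
    and "S \<in> sets borel" "bounded S"
    and T: "\<And>i. i \<in> I \<Longrightarrow> T i \<in> sets borel" "\<And>i. i \<in> I \<Longrightarrow> bounded (T i)"
    and c: "\<And>i. i \<in> I \<Longrightarrow> c i \<ge> 0"
    and le: "\<And>x. x \<in> S \<Longrightarrow> (cmod (f x))\<^sup>2 \<le> (\<Sum>i\<in>I. c i * (indicator (T i) x * (cmod (g i x))\<^sup>2))"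
  shows "energy S f \<le> (\<Sum>i\<in>I. c i * energy (T i) (g i))"
proof -
  have *: "integrable lborel (\<lambda>x. c i * (indicator (T i) x * (cmod (g i x))\<^sup>2))" if "i \<in> I" for i
    using set_integrable_energy[OF assms(3) T] that by (simp add: set_integrable_def)
  have "energy S f \<le> (\<integral>x. (\<Sum>i\<in>I. c i * (indicator (T i) x * (cmod (g i x))\<^sup>2)) \<partial>lborel)"
    unfolding energy_def set_lebesgue_integral_def
  proof (intro integral_mono)
    show "integrable lborel (\<lambda>x. indicat_real S x *\<^sub>R (cmod (f x))\<^sup>2)"
      using set_integrable_energy[OF assms(2,4,5)] by (simp add: set_integrable_def)
    show "integrable lborel (\<lambda>x. \<Sum>i\<in>I. c i * (indicator (T i) x * (cmod (g i x))\<^sup>2))"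
      using * by (intro Bochner_Integration.integrable_sum)
    show "indicat_real S x *\<^sub>R (cmod (f x))\<^sup>2
      \<le> (\<Sum>i\<in>I. c i * (indicator (T i) x * (cmod (g i x))\<^sup>2))" for x
      using le[of x] c by (cases "x \<in> S") (auto intro!: sum_nonneg mult_nonneg_nonneg)
  qed
  also have "\<dots> = (\<Sum>i\<in>I. \<integral>x. c i * (indicator (T i) x * (cmod (g i x))\<^sup>2) \<partial>lborel)"
    using * by (intro Bochner_Integration.integral_sum)
  finally show ?thesis by (simp add: energy_def set_lebesgue_integral_def)
qed

section \<open>Fibres of multiplication by \<open>N\<close> and their level sets\<close>

definition fold_count :: "nat \<Rightarrow> real set \<Rightarrow> real \<Rightarrow> nat" where
  "fold_count N S y = card {l. l < N \<and> (y + real l) / real N \<in> S}"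

definition fold_level :: "nat \<Rightarrow> real set \<Rightarrow> nat \<Rightarrow> real set" where
  "fold_level N S n = {y\<in>{0..<1}. n \<le> fold_count N S y}"

definition fold_piece :: "nat \<Rightarrow> real set \<Rightarrow> nat \<Rightarrow> real set" where
  "fold_piece N S l = {y\<in>{0..<1}. (y + real l) / real N \<in> S}"

lemma fold_piece_borel [measurable]:
  assumes [measurable]: "S \<in> sets borel"
  shows "fold_piece N S l \<in> sets borel"
  unfolding fold_piece_def by measurable

lemma bounded_subset_unit_interval: "S \<subseteq> {0..<1::real} \<Longrightarrow> bounded S"
  using bounded_subset[of "{0..<1::real}" S] by simp

lemma energy_fold:
  assumes "continuous_on UNIV f" "S \<in> sets borel" "S \<subseteq> {0..<1}" "N > 0"
  shows "(\<Sum>l<N. energy (fold_piece N S l) (\<lambda>y. f ((y + real l) / real N))) = real N * energy S f"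
proof -
  have bdd: "bounded S" using assms(3) by (rule bounded_subset_unit_interval)
  have piece: "energy (S \<inter> {real l / N..<real (Suc l) / N}) f
      = energy (fold_piece N S l) (\<lambda>y. f ((y + real l) / real N)) / N" for l
  proof -
    have set: "{x. real l / N + (1 / N) * x \<in> S \<inter> {real l / N..<real (Suc l) / N}} = fold_piece N S l"
      using assms(4) by (auto simp: fold_piece_def field_simps)
    have fn: "real l / N + (1 / N) * x = (x + real l) / N" for x
      by (simp add: add_divide_distrib add.commute)
    show ?thesis
      using energy_affine[of "1 / N" "S \<inter> {real l / N..<real (Suc l) / N}" f "real l / N"] assms(4)
      unfolding set unfolding fn by simp
  qed
  have "energy (S \<inter> {0..<real m / N}) f = (\<Sum>l<m. energy (S \<inter> {real l / N..<real (Suc l) / N}) f)" for m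
  proof (induction m)
    case 0
    then show ?case by (simp add: energy_def set_lebesgue_integral_def)
  next
    case (Suc m)
    have split: "S \<inter> {0..<real (Suc m) / N}
       = (S \<inter> {0..<real m / N}) \<union> (S \<inter> {real m / N..<real (Suc m) / N})"
    proof -
      have "{0..<real (Suc m) / N} = {0..<real m / N} \<union> {real m / N..<real (Suc m) / N}"
        by (intro ivl_disj_un_two(3)[symmetric] divide_right_mono divide_nonneg_nonneg) auto
      then show ?thesis by blast
    qed
    have "energy (S \<inter> {0..<real (Suc m) / N}) f
        = energy (S \<inter> {0..<real m / N}) f + energy (S \<inter> {real m / N..<real (Suc m) / N}) f"
      unfolding split using assms bdd by (intro energy_Un) (auto intro: bounded_subset[OF bdd])
    then show ?case using Suc by simp
  qed
  from this[of N] have "energy S f = (\<Sum>l<N. energy (S \<inter> {real l / N..<real (Suc l) / N}) f)"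
    using assms(3,4) by (simp add: Int_absorb2)
  then show ?thesis using assms(4) by (simp add: piece del: of_nat_Suc flip: sum_divide_distrib)
qed

lemma norm_sum_square_le:
  "(cmod (\<Sum>i\<in>I. f i))\<^sup>2 \<le> real (card I) * (\<Sum>i\<in>I. (cmod (f i))\<^sup>2)"
proof -
  have "(cmod (\<Sum>i\<in>I. f i))\<^sup>2 \<le> (\<Sum>i\<in>I. cmod (f i))\<^sup>2"
    by (intro power_mono norm_sum) auto
  also have "\<dots> \<le> (\<Sum>i\<in>I. (cmod (f i))\<^sup>2) * real (card I)"
    by (rule sum_squared_le_sum_of_squares)
  finally show ?thesis by (simp add: mult.commute)
qed

lemma inj_on_roots_of_unity:
  "inj_on (\<lambda>l. exponential 1 (real l / real N)) {..<N}"
proof (rule inj_onI)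
  fix l m assume lm: "l \<in> {..<N}" "m \<in> {..<N}"
    and eq: "exponential 1 (real l / real N) = exponential 1 (real m / real N)"
  have "exponential 1 (real l / real N)
      = exponential 1 (real l / real N - real m / real N) * exponential 1 (real m / real N)"
    by (simp flip: exponential_add_right)
  then have "exponential 1 (real l / real N - real m / real N) = 1"
    using eq by simp
  then obtain k :: int where k: "real l / real N - real m / real N = of_int k"
    unfolding exponential_eq_1_iff by (auto elim: Ints_cases)
  have N: "real N > 0" using lm by simp
  have "real l - real m = of_int k * real N"
    using k N by (simp add: field_simps)
  then have kN: "int l - int m = k * int N"
    by (metis of_int_diff of_int_eq_iff of_int_mult of_int_of_nat_eq)
  moreover have "\<bar>int l - int m\<bar> < int N" using lm by auto
  ultimately have "\<bar>k\<bar> * int N < 1 * int N" by (simp add: abs_mult)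
  then have "k = 0" using N by (simp add: mult_less_cancel_right)
  then show "l = m" using kN by simp
qed

text \<open>The set \<open>L\<close> of fibre points that lie in \<open>S\<close> varies with the
  fibre, but there are only finitely many candidates, so one constant serves all fibres.\<close>

lemma top_coeff_bound_roots_of_unity:
  obtains C where "C \<ge> 0"
    "\<And>L r b. L \<subseteq> {..<N} \<Longrightarrow> card L = Suc r \<Longrightarrow>
       (cmod (b r))\<^sup>2 \<le> C * (\<Sum>l\<in>L. (cmod (\<Sum>i\<le>r. b i * exponential 1 (real l / real N) ^ i))\<^sup>2)"
proof -
  let ?z = "\<lambda>l::nat. exponential 1 (real l / real N)"
  have "\<exists>C\<ge>0. \<forall>r b. card L = Suc r \<longrightarrow>
     (cmod (b r))\<^sup>2 \<le> C * (\<Sum>l\<in>L. (cmod (\<Sum>i\<le>r. b i * ?z l ^ i))\<^sup>2)" if "L \<subseteq> {..<N}" for L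
  proof (cases "card L")
    case (Suc r)
    have inj: "inj_on ?z L" using inj_on_roots_of_unity that by (rule inj_on_subset)
    have "finite (?z ` L)" "card (?z ` L) = Suc r"
      using Suc that finite_subset[OF that] card_image[OF inj] by auto
    from top_coeff_bound[OF this] obtain C where "C \<ge> 0"
      "\<forall>b. (cmod (b r))\<^sup>2 \<le> C * (\<Sum>z\<in>?z ` L. (cmod (\<Sum>i\<le>r. b i * z ^ i))\<^sup>2)" by blast
    then show ?thesis using Suc by (auto simp: sum.reindex[OF inj])
  qed auto
  then have "\<forall>L\<in>Pow {..<N}. \<exists>C\<ge>0. \<forall>r b. card L = Suc r \<longrightarrow>
     (cmod (b r))\<^sup>2 \<le> C * (\<Sum>l\<in>L. (cmod (\<Sum>i\<le>r. b i * ?z l ^ i))\<^sup>2)" by blast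
  then obtain C where C: "\<And>L. L \<subseteq> {..<N} \<Longrightarrow> C L \<ge> 0"
    "\<And>L r b. L \<subseteq> {..<N} \<Longrightarrow> card L = Suc r \<Longrightarrow>
     (cmod (b r))\<^sup>2 \<le> C L * (\<Sum>l\<in>L. (cmod (\<Sum>i\<le>r. b i * ?z l ^ i))\<^sup>2)"
    unfolding bchoice_iff by blast
  show ?thesis
  proof (rule that)
    show "0 \<le> (\<Sum>L\<in>Pow {..<N}. C L)" using C(1) by (intro sum_nonneg) auto
    fix L r and b :: "nat \<Rightarrow> complex" assume L: "L \<subseteq> {..<N}" "card L = Suc r"
    have "C L \<le> (\<Sum>L\<in>Pow {..<N}. C L)" using C(1) L by (intro member_le_sum) auto
    then show "(cmod (b r))\<^sup>2 \<le> (\<Sum>L\<in>Pow {..<N}. C L) *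
        (\<Sum>l\<in>L. (cmod (\<Sum>i\<le>r. b i * ?z l ^ i))\<^sup>2)"
      by (intro order_trans[OF C(2)[OF L]] mult_right_mono sum_nonneg) auto
  qed
qed

text \<open>On a fibre all frequencies with residue \<open>r\<close> share the factor
  \<open>z ^ r\<close> for an \<open>N\<close>-th root of unity \<open>z\<close>, because the
  quotient part has period 1. The fibre values are thus those of a polynomial whose coefficients are
  indexed by residues.\<close>

lemma exponential_residue_split:
  assumes "N > 0"
  shows "exponential (of_int (int N * m + int r)) ((y + real l) / real N)
       = exponential (of_int m) y * (exponential (real r) (y / N) * exponential 1 (real l / real N) ^ r)"
proof -
  have *: "2 * pi * of_int (int N * m + int r) * ((y + real l) / real N)
     = 2 * pi * (of_int m * y) + 2 * pi * (real r * (y / N))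
       + real r * (2 * pi * (real l / real N)) + 2 * pi * of_int (m * int l)"
    using assms by (simp add: field_simps)
  have "cis (2 * pi * of_int (m * int l)) = 1"
    using cis_multiple_2pi[of "of_int (m * int l)"] by simp
  then show ?thesis
    unfolding exponential_cis * Complex.DeMoivre
    by (simp only: cis_mult[symmetric] mult.assoc mult_1_right)
qed

text \<open>Once the residues above \<open>r\<close> are moved to the other side, a polynomial of
  degree at most \<open>r\<close> is left, and \<open>Suc r\<close> fibre points in \<open>S\<close>
  determine its top coefficient. Lower residues need no estimate: the divided difference eliminates
  them.\<close>

lemma fold_pointwise_bound:
  assumes C: "C \<ge> 0" "\<And>L r b. L \<subseteq> {..<N} \<Longrightarrow> card L = Suc r \<Longrightarrow>
       (cmod (b r))\<^sup>2 \<le> C * (\<Sum>l\<in>L. (cmod (\<Sum>i\<le>r. b i * exponential 1 (real l / real N) ^ i))\<^sup>2)"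
    and f: "\<And>y l. f ((y + real l) / real N)
      = (\<Sum>i<N. exponential (real i) (y / N) * exponential 1 (real l / real N) ^ i * h i y)"
    and r: "r < N" and y: "y \<in> fold_level N S (Suc r)"
  shows "(cmod (h r y))\<^sup>2 \<le>
      (\<Sum>l<N. 2 * C * (indicator (fold_piece N S l) y * (cmod (f ((y + real l) / real N)))\<^sup>2))
    + (\<Sum>i\<in>{r<..<N}. 2 * C * (real N)\<^sup>2 * (cmod (h i y))\<^sup>2)"
proof -
  let ?z = "\<lambda>l::nat. exponential 1 (real l / real N)"
  define b where "b = (\<lambda>i. exponential (real i) (y / N) * h i y)"
  have norm_b: "cmod (b i) = cmod (h i y)" for i by (simp add: b_def norm_mult)
  have y01: "y \<in> {0..<1}" and le: "Suc r \<le> card {l. l < N \<and> (y + real l) / real N \<in> S}"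
    using y by (auto simp: fold_level_def fold_count_def)
  from le obtain L where L: "L \<subseteq> {l. l < N \<and> (y + real l) / real N \<in> S}" "card L = Suc r" and fin: "finite L"
    by (rule obtain_subset_with_card_n)
  then have LN: "L \<subseteq> {..<N}" by auto
  define T where "T = (\<Sum>i\<in>{r<..<N}. (cmod (h i y))\<^sup>2)"
  have T0: "T \<ge> 0" by (simp add: T_def sum_nonneg)
  have bd: "(cmod (\<Sum>i\<le>r. b i * ?z l ^ i))\<^sup>2
      \<le> 2 * (cmod (f ((y + real l) / real N)))\<^sup>2 + 2 * (real N * T)" for l
  proof -
    have un: "{..<N} = {..r} \<union> {r<..<N}" using r by auto
    have "f ((y + real l) / real N)
        = (\<Sum>i\<le>r. b i * ?z l ^ i) + (\<Sum>i\<in>{r<..<N}. b i * ?z l ^ i)"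
      unfolding f un by (subst sum.union_disjoint) (auto simp: b_def mult_ac)
    then have "(\<Sum>i\<le>r. b i * ?z l ^ i)
        = f ((y + real l) / real N) + - (\<Sum>i\<in>{r<..<N}. b i * ?z l ^ i)" by simp
    then have "(cmod (\<Sum>i\<le>r. b i * ?z l ^ i))\<^sup>2 \<le> 2 * (cmod (f ((y + real l) / real N)))\<^sup>2
        + 2 * (cmod (\<Sum>i\<in>{r<..<N}. b i * ?z l ^ i))\<^sup>2"
      using norm_add_square_le[of 1 "f ((y + real l) / real N)" "- (\<Sum>i\<in>{r<..<N}. b i * ?z l ^ i)"]
      by simp
    moreover have "(cmod (\<Sum>i\<in>{r<..<N}. b i * ?z l ^ i))\<^sup>2 \<le> real (card {r<..<N}) * T"
      using norm_sum_square_le[of "\<lambda>i. b i * ?z l ^ i" "{r<..<N}"]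
      by (simp add: T_def norm_mult norm_power norm_b)
    moreover have "real (card {r<..<N}) * T \<le> real N * T"
      using T0 by (intro mult_right_mono) auto
    ultimately show ?thesis by linarith
  qed
  have "(cmod (h r y))\<^sup>2 \<le> C * (\<Sum>l\<in>L. (cmod (\<Sum>i\<le>r. b i * ?z l ^ i))\<^sup>2)"
    using C(2)[OF LN L(2), of b] by (simp add: norm_b)
  also have "\<dots> \<le> C * (\<Sum>l\<in>L. 2 * (indicator (fold_piece N S l) y * (cmod (f ((y + real l) / real N)))\<^sup>2)
       + 2 * (real N * T))"
    using C(1) bd L(1) y01
    by (intro mult_left_mono sum_mono) (auto simp: fold_piece_def indicator_def)
  also have "\<dots> \<le> C * (\<Sum>l<N. 2 * (indicator (fold_piece N S l) y * (cmod (f ((y + real l) / real N)))\<^sup>2)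
       + 2 * (real N * T))"
    using C(1) LN T0 by (intro mult_left_mono sum_mono2) auto
  also have "\<dots> = (\<Sum>l<N. 2 * C * (indicator (fold_piece N S l) y * (cmod (f ((y + real l) / real N)))\<^sup>2))
      + 2 * C * (real N)\<^sup>2 * T"
    by (simp add: sum.distrib sum_distrib_left algebra_simps power2_eq_square)
  finally show ?thesis by (simp add: T_def sum_distrib_left)
qed

lemma fold_level_borel [measurable]:
  assumes [measurable]: "S \<in> sets borel"
  shows "fold_level N S n \<in> sets borel"
proof -
  have "real (fold_count N S y) = (\<Sum>l<N. indicator S ((y + real l) / real N))" for y
    by (simp add: fold_count_def indicator_def sum.If_cases Int_def)
  then have "fold_level N S n = {y\<in>{0..<1}. real n \<le> (\<Sum>l<N. indicat_real S ((y + real l) / real N))}"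
    unfolding fold_level_def by (metis (no_types, lifting) of_nat_le_iff)
  also have "\<dots> \<in> sets borel" by measurable
  finally show ?thesis .
qed

text \<open>Residues are recovered from the largest down. The pointwise bound controls residue
  \<open>r\<close> on its level set, the Riesz bound there passes to its coefficients, and Parseval
  returns control on all of \<open>{0..<1}\<close>, as needed on the larger level sets of the
  smaller residues.\<close>

theorem riesz_lower_fold:
  assumes S: "S \<in> sets borel" "S \<subseteq> {0..<1}" and N: "N > 0"
    and \<Lambda>: "\<And>r. r < N \<Longrightarrow> riesz_lower (fold_level N S (Suc r)) (\<Lambda> r)"
  shows "riesz_lower S {k. k div int N \<in> \<Lambda> (nat (k mod int N))}"
proof -
  obtain C where C: "C \<ge> 0" "\<And>L r b. L \<subseteq> {..<N} \<Longrightarrow> card L = Suc r \<Longrightarrow>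
       (cmod (b r))\<^sup>2 \<le> C * (\<Sum>l\<in>L. (cmod (\<Sum>i\<le>r. b i * exponential 1 (real l / real N) ^ i))\<^sup>2)"
    using top_coeff_bound_roots_of_unity by blast
  have "\<forall>r\<in>{..<N}. \<exists>c>0. \<forall>F a. finite F \<longrightarrow> F \<subseteq> \<Lambda> r \<longrightarrow>
     c * (\<Sum>k\<in>F. (cmod (a k))\<^sup>2) \<le> energy (fold_level N S (Suc r)) (trig_poly F a)"
    using \<Lambda> by (auto simp: riesz_lower_def)
  from bchoice[OF this] obtain c where c': "\<forall>r\<in>{..<N}. c r > 0 \<and> (\<forall>F a. finite F \<longrightarrow> F \<subseteq> \<Lambda> r \<longrightarrow>
     c r * (\<Sum>k\<in>F. (cmod (a k))\<^sup>2) \<le> energy (fold_level N S (Suc r)) (trig_poly F a))"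
    by (rule exE)
  have c: "\<And>r. r < N \<Longrightarrow> c r > 0"
    "\<And>r F a. r < N \<Longrightarrow> finite F \<Longrightarrow> F \<subseteq> \<Lambda> r \<Longrightarrow>
     c r * (\<Sum>k\<in>F. (cmod (a k))\<^sup>2) \<le> energy (fold_level N S (Suc r)) (trig_poly F a)"
    using c' by simp_all
  define D where "D = 2 * C * (real N)\<^sup>2"
  have D0: "D \<ge> 0" using C by (simp add: D_def)
  \<comment> \<open>A sum in place of a maximum: it dominates every \<open>D / c r\<close>, so all
    residues share one constant.\<close>
  define K where "K = (\<Sum>r<N. D / c r)"
  have DK: "D / c r \<le> K" if "r < N" for r
    unfolding K_def using that D0 c(1) by (intro member_le_sum) (auto intro: divide_nonneg_pos)
  have K0: "K \<ge> 0" unfolding K_def using D0 c(1) by (intro sum_nonneg) (auto intro: divide_nonneg_pos)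
  have "(\<Sum>k\<in>F. (cmod (a k))\<^sup>2) \<le> (1 + K) ^ N * energy S (trig_poly F a)"
    if F: "finite F" "F \<subseteq> {k. k div int N \<in> \<Lambda> (nat (k mod int N))}" for F and a :: "int \<Rightarrow> complex"
  proof -
    define X where "X = energy S (trig_poly F a)"
    define Fr where "Fr = (\<lambda>r. {k\<in>F. nat (k mod int N) = r})"
    define G where "G = (\<lambda>r. (\<lambda>k. k div int N) ` Fr r)"
    define ar where "ar = (\<lambda>r m. a (int N * m + int r))"
    define x where "x = (\<lambda>r. \<Sum>k\<in>Fr r. (cmod (a k))\<^sup>2)"
    have modN: "k mod int N = int r" if "k \<in> Fr r" for k r
      using that N by (auto simp: Fr_def)
    have div_mod: "int N * (k div int N) + int r = k" if "k \<in> Fr r" for k r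
      using modN[OF that] by (metis mult_div_mod_eq)
    have inj: "inj_on (\<lambda>k. k div int N) (Fr r)" for r
      by (rule inj_onI) (metis div_mod)
    have group: "(\<Sum>k\<in>F. g k) = (\<Sum>r<N. \<Sum>k\<in>Fr r. g k)" for g :: "int \<Rightarrow> 'b::comm_monoid_add"
      unfolding Fr_def using F(1) N
      by (intro sum.group[symmetric]) (auto simp: nat_less_iff)
    have xG: "x r = (\<Sum>m\<in>G r. (cmod (ar r m))\<^sup>2)" for r
      unfolding x_def G_def ar_def sum.reindex[OF inj] using div_mod by (intro sum.cong) auto
    have G: "finite (G r)" "G r \<subseteq> \<Lambda> r" if "r < N" for r
      using F by (auto simp: G_def Fr_def)
    have f: "trig_poly F a ((y + real l) / real N) = (\<Sum>i<N. exponential (real i) (y / N)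
        * exponential 1 (real l / real N) ^ i * trig_poly (G i) (ar i) y)" for y l
    proof -
      have "(\<Sum>k\<in>Fr i. a k * exponential (of_int k) ((y + real l) / real N))
         = exponential (real i) (y / N) * exponential 1 (real l / real N) ^ i * trig_poly (G i) (ar i) y" for i
        unfolding trig_poly_def G_def sum.reindex[OF inj] sum_distrib_left
      proof (intro sum.cong refl)
        fix k assume "k \<in> Fr i"
        then show "a k * exponential (of_int k) ((y + real l) / real N)
          = exponential (real i) (y / real N) * exponential 1 (real l / real N) ^ i
            * ((\<lambda>k. ar i k * exponential (of_int k) y) \<circ> (\<lambda>k. k div int N)) k"
          using exponential_residue_split[OF N, of "k div int N" i y l] div_mod[of k i]
          by (simp add: ar_def mult_ac del: of_int_add of_int_mult)
      qed
      then show ?thesis by (simp add: trig_poly_def group)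
    qed
    have x0: "x r \<ge> 0" for r by (simp add: x_def sum_nonneg)
    have step: "x r \<le> K * (X + (\<Sum>i\<in>{r<..<N}. x i))" if r: "r < N" for r
    proof -
      \<comment> \<open>The two kinds of terms, sheets of the fold and higher residues, are put into
        one disjoint index set so that a single integrated estimate covers both.\<close>
      let ?I = "{..<N} <+> {r<..<N}"
      let ?g = "case_sum (\<lambda>l y. trig_poly F a ((y + real l) / real N)) (\<lambda>i. trig_poly (G i) (ar i))"
      let ?T = "case_sum (fold_piece N S) (\<lambda>_. {0..<1::real})"
      let ?c = "case_sum (\<lambda>_. 2 * C) (\<lambda>_. D)"
      have "energy (fold_level N S (Suc r)) (trig_poly (G r) (ar r)) \<le> (\<Sum>i\<in>?I. ?c i * energy (?T i) (?g i))"
      proof (rule energy_le_sum_sets)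
        show "bounded (fold_level N S (Suc r))"
          by (rule bounded_subset_unit_interval) (auto simp: fold_level_def)
        show "bounded (?T i)" if "i \<in> ?I" for i
          using that by (intro bounded_subset_unit_interval) (auto simp: fold_piece_def)
        fix y assume y: "y \<in> fold_level N S (Suc r)"
        then have "y \<in> {0..<1}" by (simp add: fold_level_def)
        then show "(cmod (trig_poly (G r) (ar r) y))\<^sup>2
            \<le> (\<Sum>i\<in>?I. ?c i * (indicator (?T i) y * (cmod (?g i y))\<^sup>2))"
          using fold_pointwise_bound[OF C f r y] by (simp add: sum.Plus D_def)
      qed (use S C D0 in \<open>auto intro!: continuous_intros\<close>)
      also have "\<dots> = 2 * C * (\<Sum>l<N. energy (fold_piece N S l) (\<lambda>y. trig_poly F a ((y + real l) / real N)))
          + D * (\<Sum>i\<in>{r<..<N}. x i)"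
        using G by (simp add: sum.Plus sum_distrib_left parseval xG)
      also have "\<dots> = 2 * C * real N * X + D * (\<Sum>i\<in>{r<..<N}. x i)"
        using S N by (subst energy_fold) (auto intro!: continuous_intros simp: X_def)
      also have "2 * C * real N * X \<le> D * X"
        unfolding D_def using C N by (intro mult_right_mono mult_left_mono) (auto simp: X_def power2_eq_square)
      finally have "c r * x r \<le> D * (X + (\<Sum>i\<in>{r<..<N}. x i))"
        using c(2)[OF r G[OF r], of "ar r"] by (simp add: xG algebra_simps)
      then have "x r \<le> D / c r * (X + (\<Sum>i\<in>{r<..<N}. x i))"
        using c(1)[OF r] by (simp add: field_simps)
      also have "\<dots> \<le> K * (X + (\<Sum>i\<in>{r<..<N}. x i))"
        using DK[OF r] by (intro mult_right_mono) (auto simp: X_def intro!: add_nonneg_nonneg sum_nonneg x0)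
      finally show ?thesis .
    qed
    \<comment> \<open>Each further residue, taken from the top, costs one factor
      \<open>1 + K\<close>.\<close>
    have "X + (\<Sum>i\<in>{N - j..<N}. x i) \<le> (1 + K) ^ j * X" if "j \<le> N" for j
      using that
    proof (induction j)
      case (Suc j)
      define r where "r = N - Suc j"
      have r: "r < N" "{N - Suc j..<N} = insert r {r<..<N}" "{N - j..<N} = {r<..<N}"
        using Suc.prems by (auto simp: r_def)
      have "X + (\<Sum>i\<in>{N - Suc j..<N}. x i) = x r + (X + (\<Sum>i\<in>{r<..<N}. x i))"
        unfolding r(2) by simp
      also have "\<dots> \<le> (1 + K) * (X + (\<Sum>i\<in>{r<..<N}. x i))"
        using step[OF r(1)] by (simp add: algebra_simps)
      also have "\<dots> \<le> (1 + K) * ((1 + K) ^ j * X)"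
        using Suc K0 r(3) by (intro mult_left_mono) auto
      finally show ?case by simp
    qed simp
    from this[of N] have "X + (\<Sum>i<N. x i) \<le> (1 + K) ^ N * X"
      by (simp add: lessThan_atLeast0)
    then show ?thesis
      using group[of "\<lambda>k. (cmod (a k))\<^sup>2"] energy_nonneg[of S "trig_poly F a"]
      unfolding X_def x_def by linarith
  qed
  then show ?thesis
    unfolding riesz_lower_def using K0
    by (intro exI[of _ "1 / (1 + K) ^ N"]) (auto simp: field_simps)
qed

lemma fold_count_Compl:
  assumes "y \<in> {0..<1}"
  shows "fold_count N ({0..<1} - S) y + fold_count N S y = N"
proof -
  have "(y + real l) / real N \<in> {0..<1}" if "l < N" for l
  proof -
    have "real l + 1 \<le> real N" using that by linarith
    then show ?thesis using assms that by (auto simp: field_simps)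
  qed
  then have "{l. l < N \<and> (y + real l) / real N \<in> {0..<1} - S} \<union> {l. l < N \<and> (y + real l) / real N \<in> S} = {..<N}"
    by blast
  then show ?thesis
    unfolding fold_count_def
    by (subst card_Un_disjoint[symmetric]) (auto intro: finite_subset[of _ "{..<N}"])
qed

text \<open>A fibre has \<open>N\<close> points, so the level sets of the complement are the
  complements of those of \<open>S\<close> in reversed order. The same lower-bound theorem then
  gives the dual bound, after a reflection of the frequencies that reverses the residues
  too.\<close>

theorem has_integer_basis_fold:
  assumes S: "S \<in> sets borel" "S \<subseteq> {0..<1}" and N: "N > 0"
    and levels: "\<And>r. r < N \<Longrightarrow> has_integer_basis (fold_level N S (Suc r))"
  shows "has_integer_basis S"
proof -
  obtain \<Lambda> where \<Lambda>: "\<And>r. r < N \<Longrightarrow> riesz_lower (fold_level N S (Suc r)) (\<Lambda> r)"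
    "\<And>r. r < N \<Longrightarrow> riesz_lower ({0..<1} - fold_level N S (Suc r)) (- \<Lambda> r)"
    using levels unfolding has_integer_basis_def by metis
  define M where "M = {k. k div int N \<in> \<Lambda> (nat (k mod int N))}"
  have "riesz_lower S M"
    unfolding M_def by (intro riesz_lower_fold S N \<Lambda>)
  moreover have "riesz_lower ({0..<1} - S) (- M)"
  proof -
    \<comment> \<open>The reflection by -1 sends \<open>N * m + r\<close> to
      \<open>N * (- 1 - m) + (N - 1 - r)\<close>: quotients are reflected by the same rule and
      residues are reversed.\<close>
    define \<Lambda>' where "\<Lambda>' = (\<lambda>r. {k. - 1 - k \<in> - \<Lambda> (N - Suc r)})"
    have "riesz_lower (fold_level N ({0..<1} - S) (Suc r)) (\<Lambda>' r)" if "r < N" for r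
    proof -
      have "fold_level N ({0..<1} - S) (Suc r) = {0..<1} - fold_level N S (Suc (N - Suc r))"
      proof (intro set_eqI iffI)
        fix y
        show "y \<in> {0..<1} - fold_level N S (Suc (N - Suc r))"
          if "y \<in> fold_level N ({0..<1} - S) (Suc r)"
          using that fold_count_Compl[of y N S] \<open>r < N\<close> by (auto simp: fold_level_def)
        show "y \<in> fold_level N ({0..<1} - S) (Suc r)"
          if "y \<in> {0..<1} - fold_level N S (Suc (N - Suc r))"
          using that fold_count_Compl[of y N S] \<open>r < N\<close> by (auto simp: fold_level_def)
      qed
      then show ?thesis
        unfolding \<Lambda>'_def using riesz_lower_reflect[OF \<Lambda>(2)[of "N - Suc r"], of "- 1"] that
        by simp
    qed
    then have "riesz_lower ({0..<1} - S) {k. k div int N \<in> \<Lambda>' (nat (k mod int N))}"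
      using S N by (intro riesz_lower_fold) auto
    from riesz_lower_reflect[OF this, of "- 1"] show ?thesis
    proof (rule riesz_lower_mono, intro subsetI)
      fix k assume k: "k \<in> - M"
      define m r where "m = k div int N" and "r = k mod int N"
      have r: "0 \<le> r" "r < int N" "k = int N * m + r"
        using N by (auto simp: m_def r_def)
      have "-1 - k = int N * (-1 - m) + (int N - 1 - r)" using r by (simp add: algebra_simps)
      then have "(-1 - k) div int N = -1 - m" "(-1 - k) mod int N = int N - 1 - r"
        using r int_div_pos_eq[of "-1 - k" "int N" "-1 - m" "int N - 1 - r"]
          int_mod_pos_eq[of "-1 - k" "int N" "-1 - m" "int N - 1 - r"] by auto
      moreover have "N - Suc (nat (int N - 1 - r)) = nat r" using r by linarith
      ultimately show "k \<in> {k. - 1 - k \<in> {k. k div int N \<in> \<Lambda>' (nat (k mod int N))}}"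
        using k by (simp add: \<Lambda>'_def M_def m_def r_def)
    qed
  qed
  ultimately show ?thesis unfolding has_integer_basis_def by blast
qed

subsection \<open>Step functions on the circle\<close>

text \<open>
  The right-continuous step function on \<open>[0,1)\<close> with jump \<open>J p\<close> at each \<open>p \<in> P\<close> and with value \<open>C\<close>
  to the left of 1; it is a function on the circle when the jumps add up to 0.
\<close>

definition step_fun :: "'a::ab_group_add \<Rightarrow> real set \<Rightarrow> (real \<Rightarrow> 'a) \<Rightarrow> real \<Rightarrow> 'a" where
  "step_fun C P J x = C - (\<Sum>q\<in>{q\<in>P. x < q}. J q)"

definition left_lim :: "'a::ab_group_add \<Rightarrow> real set \<Rightarrow> (real \<Rightarrow> 'a) \<Rightarrow> real \<Rightarrow> 'a" where
  "left_lim C P J x = C - (\<Sum>q\<in>{q\<in>P. x \<le> q}. J q)"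

definition compose_jump ::
    "('a::ab_group_add \<Rightarrow> 'b::ab_group_add) \<Rightarrow> 'a \<Rightarrow> real set \<Rightarrow> (real \<Rightarrow> 'a) \<Rightarrow> real \<Rightarrow> 'b" where
  "compose_jump h C P J p = h (step_fun C P J p) - h (left_lim C P J p)"

lemma step_fun_minus_left_lim:
  assumes "finite P" "p \<in> P"
  shows "step_fun C P J p - left_lim C P J p = J p"
proof -
  have "{q\<in>P. p \<le> q} = insert p {q\<in>P. p < q}" using assms by auto
  then show ?thesis using assms by (simp add: step_fun_def left_lim_def)
qed

lemma sum_compose_jump:
  assumes "finite P"
  shows "(\<Sum>p\<in>P. compose_jump h C P J p) = h C - h (C - (\<Sum>p\<in>P. J p))"
  using assms
\<comment> \<open>Points are added from right to left: \<open>step_fun\<close> is anchored at 1 and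
  sums the jumps to the right of its argument, so a new leftmost point leaves the values at all
  others unchanged.\<close>
proof (induction P rule: finite_linorder_min_induct)
  case (insert b A)
  have A: "{q\<in>insert b A. b < q} = A" "{q\<in>insert b A. b \<le> q} = insert b A" "b \<notin> A"
    using insert.hyps by auto
  have "compose_jump h C (insert b A) J p = compose_jump h C A J p" if "p \<in> A" for p
  proof -
    have "b < p" using that insert.hyps by auto
    then have "{q\<in>insert b A. p < q} = {q\<in>A. p < q}" "{q\<in>insert b A. p \<le> q} = {q\<in>A. p \<le> q}" by auto
    then show ?thesis by (simp add: compose_jump_def step_fun_def left_lim_def)
  qed
  then have "(\<Sum>p\<in>A. compose_jump h C (insert b A) J p) = h C - h (C - (\<Sum>p\<in>A. J p))"
    using insert.IH by simp
  then show ?case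
    using insert.hyps A by (simp add: compose_jump_def step_fun_def left_lim_def)
qed simp

lemma step_fun_compose:
  assumes "finite P"
  shows "h (step_fun C P J x) = step_fun (h C) P (compose_jump h C P J) x"
proof -
  let ?Q = "{q\<in>P. x < q}"
  have "compose_jump h C P J p = compose_jump h C ?Q J p" if "p \<in> ?Q" for p
  proof -
    have "{q\<in>?Q. p < q} = {q\<in>P. p < q}" "{q\<in>?Q. p \<le> q} = {q\<in>P. p \<le> q}" using that by auto
    then show ?thesis by (simp add: compose_jump_def step_fun_def left_lim_def)
  qed
  then have "(\<Sum>p\<in>?Q. compose_jump h C P J p) = h C - h (C - (\<Sum>p\<in>?Q. J p))"
    using sum_compose_jump[of ?Q h C J] assms by simp
  then show ?thesis by (simp add: step_fun_def)
qed

lemma sum_compose_jump_zero: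
  assumes "finite P" "(\<Sum>p\<in>P. J p) = 0"
  shows "(\<Sum>p\<in>P. compose_jump h C P J p) = 0"
  using assms by (simp add: sum_compose_jump)

text \<open>For the indicator of a union of separated arcs, not the whole circle, this is the number
  of arcs. It is the measure of the induction.\<close>

definition up_variation :: "real set \<Rightarrow> (real \<Rightarrow> int) \<Rightarrow> int" where
  "up_variation P J = (\<Sum>p\<in>P. max 0 (J p))"

lemma up_variation_nonneg: "0 \<le> up_variation P J"
  by (simp add: up_variation_def sum_nonneg)

lemma up_variation_eq_0:
  assumes "finite P" "(\<Sum>p\<in>P. J p) = 0" "up_variation P J \<le> 0"
  shows "step_fun C P J x = C"
proof -
  have "up_variation P J = 0" using assms(3) up_variation_nonneg[of P J] by simp
  then have "\<forall>p\<in>P. max 0 (J p) = 0"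
    using assms(1) unfolding up_variation_def by (subst (asm) sum_nonneg_eq_0_iff) auto
  then have "\<forall>p\<in>P. - J p \<ge> 0" by (auto simp: max_def split: if_splits)
  moreover from this have "(\<Sum>p\<in>P. - J p) = 0 \<longleftrightarrow> (\<forall>p\<in>P. - J p = 0)"
    using assms(1) by (intro sum_nonneg_eq_0_iff) auto
  ultimately have "\<forall>p\<in>P. J p = 0" using assms(2) by (simp add: sum_negf)
  then show ?thesis by (simp add: step_fun_def)
qed

definition level_ind :: "int \<Rightarrow> int \<Rightarrow> int" where
  "level_ind n v = (if n \<le> v then 1 else 0)"

lemma up_variation_level:
  assumes "finite P"
  shows "up_variation P (compose_jump (level_ind n) C P J) \<le> up_variation P J"
proof -
  have "max 0 (compose_jump (level_ind n) C P J p) \<le> max 0 (J p)" if "p \<in> P" for p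
    using step_fun_minus_left_lim[OF assms that, of C J]
    by (auto simp: compose_jump_def level_ind_def)
  then show ?thesis unfolding up_variation_def by (intro sum_mono) auto
qed

text \<open>An upward jump between integers that crosses two different levels has height at least 2,
  so it can pay for both.\<close>

lemma up_variation_two_levels:
  assumes "finite P" "n \<noteq> m"
  shows "up_variation P (compose_jump (level_ind n) C P J)
       + up_variation P (compose_jump (level_ind m) C P J) \<le> up_variation P J"
proof -
  have "max 0 (compose_jump (level_ind n) C P J p) + max 0 (compose_jump (level_ind m) C P J p)
      \<le> max 0 (J p)" if "p \<in> P" for p
    using step_fun_minus_left_lim[OF assms(1) that, of C J] assms(2)
    by (auto simp: compose_jump_def level_ind_def)
  then show ?thesis unfolding up_variation_def
    by (subst sum.distrib[symmetric]) (intro sum_mono, auto)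
qed

text \<open>Two different levels are crossed, so the up-jumps cannot all belong to level \<open>n\<close>.\<close>

lemma up_variation_level_less:
  assumes "finite P" "(\<Sum>p\<in>P. J p) = 0"
    and xy: "step_fun C P J x + 2 \<le> step_fun C P J y"
  shows "up_variation P (compose_jump (level_ind n) C P J) < up_variation P J"
proof -
  define v where "v = step_fun C P J x"
  have pos: "up_variation P (compose_jump (level_ind m) C P J) > 0" if "m = v + 1 \<or> m = v + 2" for m
  proof (rule ccontr)
    assume "\<not> ?thesis"
    then have "step_fun (level_ind m C) P (compose_jump (level_ind m) C P J) z = level_ind m C" for z
      using assms(1,2) by (intro up_variation_eq_0 sum_compose_jump_zero) auto
    then have "level_ind m (step_fun C P J z) = level_ind m C" for z
      using assms(1) by (simp add: step_fun_compose[symmetric])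
    then have "level_ind m (step_fun C P J x) = level_ind m (step_fun C P J y)" by metis
    then show False using that xy by (auto simp: level_ind_def v_def)
  qed
  define m where "m = (if n = v + 1 then v + 2 else v + 1)"
  have m: "m = v + 1 \<or> m = v + 2" "n \<noteq> m" by (auto simp: m_def)
  show ?thesis using up_variation_two_levels[OF assms(1) m(2), of C J] pos[OF m(1)] by linarith
qed

subsection \<open>Folding step functions\<close>

lemma hermite_identity:
  assumes "N > 0"
  shows "(\<Sum>l<N. \<lfloor>z + real l / real N\<rfloor>) = \<lfloor>real N * z\<rfloor>"
proof -
  define m where "m = \<lfloor>real N * z\<rfloor>"
  have "\<lfloor>z + real l / real N\<rfloor> = (m + int l) div int N" for l
  proof -
    have "z + real l / real N = (real N * z + real l) / real N" using assms by (simp add: field_simps)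
    also have "\<lfloor>\<dots>\<rfloor> = \<lfloor>real N * z + real l\<rfloor> div int N"
      using floor_divide_real_eq_div[of "int N" "real N * z + real l"] by simp
    also have "\<lfloor>real N * z + real l\<rfloor> = m + int l" unfolding m_def by linarith
    finally show ?thesis .
  qed
  moreover have "(\<Sum>l<N. (m + int l) div int N) = m"
  proof -
    \<comment> \<open>Raising \<open>m\<close> by 1 drops the first summand and appends
      \<open>(m + N) div N\<close>, which is larger than it by exactly 1.\<close>
    define g where "g = (\<lambda>m. \<Sum>l<N. (m + int l) div int N)"
    have shift: "g (k + 1) = g k + 1" for k
    proof -
      have "g (k + 1) = (\<Sum>l<N. (k + int (Suc l)) div int N)" by (simp add: g_def algebra_simps)
      then have "g (k + 1) + (k + int 0) div int N = (\<Sum>l<Suc N. (k + int l) div int N)"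
        by (subst sum.lessThan_Suc_shift) simp
      also have "\<dots> = g k + (k + int N) div int N" by (simp add: g_def)
      also have "(k + int N) div int N = k div int N + 1" using assms by simp
      finally show ?thesis by simp
    qed
    have "g m = m"
    proof (induction m rule: int_induct[of _ 0])
      case base then show ?case by (simp add: g_def)
    next
      case (step1 i) then show ?case by (simp add: shift)
    next
      case (step2 i) then show ?case using shift[of "i - 1"] by simp
    qed
    then show ?thesis by (simp add: g_def)
  qed
  ultimately show ?thesis by (simp add: m_def)
qed

text \<open>The floor form is what Hermite's identity can sum over a fibre. It is confined to
  \<open>{0..<1}\<close>, where \<open>x - p\<close> lies strictly between -1 and 1.\<close>

lemma step_fun_floor:
  fixes J :: "real \<Rightarrow> int"
  assumes "finite P" "P \<subseteq> {0..<1}" "x \<in> {0..<1}"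
  shows "step_fun C P J x = C + (\<Sum>p\<in>P. J p * \<lfloor>x - p\<rfloor>)"
proof -
  have "J p * \<lfloor>x - p\<rfloor> = - (if x < p then J p else 0)" if "p \<in> P" for p
  proof -
    have p: "0 \<le> p" "p < 1" "0 \<le> x" "x < 1" using that assms by auto
    then have "\<lfloor>x - p\<rfloor> = (if x < p then - 1 else 0)"
      by (auto simp: floor_eq_iff)
    then show ?thesis by simp
  qed
  then have "(\<Sum>p\<in>P. J p * \<lfloor>x - p\<rfloor>) = - (\<Sum>p\<in>P. if x < p then J p else 0)"
    by (simp add: sum_negf)
  also have "(\<Sum>p\<in>P. if x < p then J p else 0) = (\<Sum>q\<in>{q\<in>P. x < q}. J q)"
    using assms(1) by (simp add: sum.inter_filter)
  finally show ?thesis by (simp add: step_fun_def)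
qed

definition fold_points :: "nat \<Rightarrow> real set \<Rightarrow> real set" where
  "fold_points N P = (\<lambda>p. frac (real N * p)) ` P"

definition fold_jump :: "nat \<Rightarrow> real set \<Rightarrow> (real \<Rightarrow> int) \<Rightarrow> real \<Rightarrow> int" where
  "fold_jump N P J r = (\<Sum>p\<in>{p\<in>P. frac (real N * p) = r}. J p)"

text \<open>The correction collects the integer parts lost when the points \<open>N * p\<close> are
  reduced modulo 1.\<close>

definition fold_const :: "nat \<Rightarrow> int \<Rightarrow> real set \<Rightarrow> (real \<Rightarrow> int) \<Rightarrow> int" where
  "fold_const N C P J = int N * C - (\<Sum>p\<in>P. J p * \<lfloor>real N * p\<rfloor>)"

lemma fold_points_props:
  assumes "finite P"
  shows "finite (fold_points N P)" "fold_points N P \<subseteq> {0..<1}"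
  using assms by (auto simp: fold_points_def frac_ge_0 frac_lt_1)

lemma sum_fold_jump:
  fixes g :: "real \<Rightarrow> 'a::comm_ring_1"
  assumes "finite P"
  shows "(\<Sum>r\<in>fold_points N P. of_int (fold_jump N P J r) * g r)
       = (\<Sum>p\<in>P. of_int (J p) * g (frac (real N * p)))"
proof -
  have "(\<Sum>p\<in>P. of_int (J p) * g (frac (real N * p)))
      = (\<Sum>r\<in>fold_points N P. \<Sum>p\<in>{p\<in>P. frac (real N * p) = r}. of_int (J p) * g (frac (real N * p)))"
    unfolding fold_points_def by (rule sum.image_gen[OF assms])
  also have "\<dots> = (\<Sum>r\<in>fold_points N P. of_int (fold_jump N P J r) * g r)"
    by (intro sum.cong refl) (simp add: fold_jump_def sum_distrib_right)
  finally show ?thesis by simp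
qed

lemma sum_fold_jump_zero:
  assumes "finite P" "(\<Sum>p\<in>P. J p) = 0"
  shows "(\<Sum>r\<in>fold_points N P. fold_jump N P J r) = 0"
  using sum_fold_jump[OF assms(1), of N J "\<lambda>_. 1 :: int"] assms(2) by simp

text \<open>Points that collide modulo 1 have their jumps added, and opposite signs cancel.\<close>

lemma up_variation_fold:
  assumes "finite P"
  shows "up_variation (fold_points N P) (fold_jump N P J) \<le> up_variation P J"
proof -
  have "max 0 (fold_jump N P J r) \<le> (\<Sum>p\<in>{p\<in>P. frac (real N * p) = r}. max 0 (J p))" for r
    by (auto simp: fold_jump_def intro: sum_mono sum_nonneg)
  then have "up_variation (fold_points N P) (fold_jump N P J)
     \<le> (\<Sum>r\<in>fold_points N P. \<Sum>p\<in>{p\<in>P. frac (real N * p) = r}. max 0 (J p))"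
    unfolding up_variation_def by (intro sum_mono) auto
  also have "\<dots> = up_variation P J"
    unfolding fold_points_def up_variation_def by (rule sum.image_gen[OF assms, symmetric])
  finally show ?thesis .
qed

text \<open>Zero jumps are allowed, so passing to a level set can keep the same point set.\<close>

definition is_step_set :: "int \<Rightarrow> real set \<Rightarrow> (real \<Rightarrow> int) \<Rightarrow> real set \<Rightarrow> bool" where
  "is_step_set C P J S \<longleftrightarrow> finite P \<and> P \<subseteq> {0..<1} \<and> (\<Sum>p\<in>P. J p) = 0 \<and> S \<subseteq> {0..<1} \<and>
     (\<forall>x\<in>{0..<1}. step_fun C P J x = (if x \<in> S then 1 else 0))"

lemma fold_count_step_set:
  assumes S: "is_step_set C P J S" and N: "N > 0" and y: "y \<in> {0..<1}"
  shows "int (fold_count N S y)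
       = step_fun (fold_const N C P J) (fold_points N P) (fold_jump N P J) y"
proof -
  have P: "finite P" "P \<subseteq> {0..<1}" using S by (auto simp: is_step_set_def)
  have in01: "(y + real l) / real N \<in> {0..<1}" if "l < N" for l
  proof -
    have "real l + 1 \<le> real N" using that by linarith
    then show ?thesis using y that by (auto simp: field_simps)
  qed
  have "int (fold_count N S y) = (\<Sum>l<N. if (y + real l) / real N \<in> S then 1 else 0)"
    by (simp add: fold_count_def sum.If_cases Int_def)
  also have "\<dots> = (\<Sum>l<N. C + (\<Sum>p\<in>P. J p * \<lfloor>(y / real N - p) + real l / real N\<rfloor>))"
  proof (intro sum.cong refl)
    fix l assume "l \<in> {..<N}"
    then have l: "(y + real l) / real N \<in> {0..<1}" using in01 by simp
    have eq: "(y / real N - p) + real l / real N = (y + real l) / real N - p" for p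
      by (simp add: add_divide_distrib)
    show "(if (y + real l) / real N \<in> S then 1 else 0)
       = C + (\<Sum>p\<in>P. J p * \<lfloor>(y / real N - p) + real l / real N\<rfloor>)"
      unfolding eq using S l step_fun_floor[OF P l, of C J] by (simp add: is_step_set_def)
  qed
  also have "\<dots> = int N * C + (\<Sum>p\<in>P. J p * (\<Sum>l<N. \<lfloor>(y / real N - p) + real l / real N\<rfloor>))"
    by (subst sum.distrib, subst sum.swap) (simp add: sum_distrib_left)
  also have "\<dots> = int N * C + (\<Sum>p\<in>P. J p * (\<lfloor>y - frac (real N * p)\<rfloor> - \<lfloor>real N * p\<rfloor>))"
  proof -
    have "(\<Sum>l<N. \<lfloor>(y / real N - p) + real l / real N\<rfloor>) = \<lfloor>y - frac (real N * p)\<rfloor> - \<lfloor>real N * p\<rfloor>" for p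
    proof -
      \<comment> \<open>Splitting \<open>N * p\<close> into fraction and integer part yields the new
        point and its share of \<open>fold_const\<close>.\<close>
      have "real N * (y / real N - p) = y - frac (real N * p) - of_int \<lfloor>real N * p\<rfloor>"
        using N by (simp add: frac_def field_simps)
      then show ?thesis by (simp only: hermite_identity[OF N] floor_diff_of_int)
    qed
    then show ?thesis by simp
  qed
  also have "\<dots> = fold_const N C P J + (\<Sum>p\<in>P. J p * \<lfloor>y - frac (real N * p)\<rfloor>)"
    by (simp add: fold_const_def right_diff_distrib sum_subtractf)
  also have "(\<Sum>p\<in>P. J p * \<lfloor>y - frac (real N * p)\<rfloor>)
       = (\<Sum>r\<in>fold_points N P. fold_jump N P J r * \<lfloor>y - r\<rfloor>)"
    using sum_fold_jump[OF P(1), of N J "\<lambda>r. \<lfloor>y - r\<rfloor>"] by simp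
  finally show ?thesis
    by (simp only: step_fun_floor[OF fold_points_props[OF P(1)] y])
qed

lemma is_step_set_fold_level:
  assumes S: "is_step_set C P J S" and N: "N > 0"
  shows "is_step_set (level_ind (int n) (fold_const N C P J)) (fold_points N P)
    (compose_jump (level_ind (int n)) (fold_const N C P J) (fold_points N P) (fold_jump N P J))
    (fold_level N S n)"
proof -
  have P: "finite P" "(\<Sum>p\<in>P. J p) = 0" using S by (auto simp: is_step_set_def)
  note props = fold_points_props[OF P(1), of N]
  show ?thesis
    unfolding is_step_set_def
  proof (intro conjI ballI)
    show "fold_level N S n \<subseteq> {0..<1}" by (auto simp: fold_level_def)
    fix x :: real assume x: "x \<in> {0..<1}"
    show "step_fun (level_ind (int n) (fold_const N C P J)) (fold_points N P)
        (compose_jump (level_ind (int n)) (fold_const N C P J) (fold_points N P) (fold_jump N P J)) x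
      = (if x \<in> fold_level N S n then 1 else 0)"
      unfolding step_fun_compose[OF props(1), symmetric] fold_count_step_set[OF S N x, symmetric]
      using x by (simp add: level_ind_def fold_level_def)
  qed (use P props in \<open>auto intro!: sum_compose_jump_zero sum_fold_jump_zero\<close>)
qed

lemma is_step_set_borel:
  assumes "is_step_set C P J S"
  shows "S \<in> sets borel"
proof -
  have P: "finite P" using assms by (auto simp: is_step_set_def)
  have "real_of_int (step_fun C P J x) = of_int C - (\<Sum>q\<in>P. of_int (J q) * indicator {..<q} x)" for x
  proof -
    have "(\<Sum>q\<in>P. of_int (J q) * indicator {..<q} x) = (\<Sum>q\<in>P. if x < q then real_of_int (J q) else 0)"
      by (intro sum.cong) (auto simp: indicator_def)
    also have "\<dots> = (\<Sum>q\<in>{q\<in>P. x < q}. real_of_int (J q))"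
      by (rule sum.inter_filter[OF P, symmetric])
    finally show ?thesis by (simp add: step_fun_def)
  qed
  moreover have "S = {x\<in>{0..<1}. real_of_int (step_fun C P J x) = 1}"
    using assms by (auto simp: is_step_set_def split: if_splits)
  ultimately have "S = {x\<in>{0..<1}. of_int C - (\<Sum>q\<in>P. of_int (J q) * indicator {..<q} x) = (1::real)}"
    by simp
  also have "\<dots> \<in> sets borel" by measurable
  finally show ?thesis .
qed

subsection \<open>A fold with values at distance 2\<close>

text \<open>Integration by parts on the circle: periodicity of \<open>G\<close> removes the constant
  \<open>C\<close>, and the vanishing total jump removes \<open>G 0\<close>.\<close>

lemma step_fun_weighted_integral:
  fixes J :: "real \<Rightarrow> int" and G g :: "real \<Rightarrow> real"
  assumes P: "finite P" "P \<subseteq> {0..<1}" "(\<Sum>p\<in>P. J p) = 0"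
    and G: "\<And>x. (G has_real_derivative g x) (at x)" "G 1 = G 0"
  shows "((\<lambda>y. of_int (step_fun C P J y) * g y) has_integral (- (\<Sum>p\<in>P. of_int (J p) * G p))) {0..1}"
proof -
  have int_g: "(g has_integral (G b - G a)) {a..b}" if "a \<le> b" for a b
    using that G(1) by (intro fundamental_theorem_of_calculus)
      (auto intro: has_field_derivative_at_within simp flip: has_real_derivative_iff_has_vector_derivative)
  have piece: "((\<lambda>y. if y < p then g y else 0) has_integral (G p - G 0)) {0..1}" if "p \<in> P" for p
  proof -
    have p: "0 \<le> p" "p < 1" using that P by auto
    have "((\<lambda>y. if y \<in> {0..p} then g y else 0) has_integral (G p - G 0)) {0..1}"
      using int_g[of 0 p] p by (subst has_integral_restrict) auto
    then show ?thesis
      by (rule has_integral_spike_finite[of "{p}", rotated 2]) auto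
  qed
  have "((\<lambda>y. of_int C * g y - (\<Sum>p\<in>P. of_int (J p) * (if y < p then g y else 0))) has_integral
      (of_int C * (G 1 - G 0) - (\<Sum>p\<in>P. of_int (J p) * (G p - G 0)))) {0..1}"
    using P(1) piece int_g[of 0 1]
    by (intro has_integral_diff has_integral_sum has_integral_mult_right) auto
  moreover have "of_int C * g y - (\<Sum>p\<in>P. of_int (J p) * (if y < p then g y else 0))
      = of_int (step_fun C P J y) * g y" for y
  proof -
    have "(\<Sum>p\<in>P. of_int (J p) * (if y < p then g y else 0))
        = (\<Sum>p\<in>P. if y < p then of_int (J p) * g y else 0)"
      by (intro sum.cong) auto
    also have "\<dots> = (\<Sum>p\<in>{p\<in>P. y < p}. of_int (J p) * g y)"
      by (rule sum.inter_filter[OF P(1), symmetric])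
    finally show ?thesis by (simp add: step_fun_def left_diff_distrib sum_distrib_right)
  qed
  moreover have "(\<Sum>p\<in>P. of_int (J p) * (G p - G 0)) = (\<Sum>p\<in>P. of_int (J p) * G p)"
  proof -
    have "(\<Sum>p\<in>P. of_int (J p) * G 0) = of_int (\<Sum>p\<in>P. J p) * G 0"
      by (simp add: sum_distrib_right)
    then show ?thesis using P(3) by (simp add: right_diff_distrib sum_subtractf)
  qed
  ultimately show ?thesis using G(2) by simp
qed

text \<open>The derivative \<open>g\<close> of the shifted cosine has mean zero, so only
  \<open>F - v\<close>, with values between 0 and 1, matters. The cosine falls by 2 on the half
  period starting at \<open>s\<close> and rises by 2 on the rest; these are the extreme values of
  the integral. The range of \<open>s\<close> keeps that half period inside
  \<open>{0..1}\<close>.\<close>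

lemma two_valued_step_fun_cos_bound:
  fixes J :: "real \<Rightarrow> int"
  assumes P: "finite P" "P \<subseteq> {0..<1}" "(\<Sum>p\<in>P. J p) = 0"
    and v: "\<And>y. y \<in> {0..<1} \<Longrightarrow> v \<le> step_fun C P J y \<and> step_fun C P J y \<le> v + 1"
    and s: "0 \<le> s" "s \<le> 1 / 2"
  shows "\<bar>\<Sum>p\<in>P. of_int (J p) * cos (2 * pi * (p - s))\<bar> \<le> 2"
proof -
  define G where "G = (\<lambda>y. cos (2 * pi * (y - s)))"
  define g where "g = (\<lambda>y. - (2 * pi) * sin (2 * pi * (y - s)))"
  define F where "F = (\<lambda>y. of_int (step_fun C P J y) :: real)"
  have G': "(G has_real_derivative g x) (at x)" for x
    unfolding G_def g_def by (auto intro!: derivative_eq_intros)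
  have "2 * pi * (1 - s) = 2 * pi * (0 - s) + 2 * pi" by (simp add: algebra_simps)
  then have G1: "G 1 = G 0" unfolding G_def by (simp only: cos_periodic)
  have Gs: "G s = 1" by (simp add: G_def)
  have Gs': "G (s + 1 / 2) = - 1" by (simp add: G_def)
  have int_g: "(g has_integral (G b - G a)) {a..b}" if "a \<le> b" for a b
    using that G' by (intro fundamental_theorem_of_calculus)
      (auto intro: has_field_derivative_at_within simp flip: has_real_derivative_iff_has_vector_derivative)
  \<comment> \<open>The negative part of \<open>g\<close>, kept with its sign.\<close>
  define m where "m = (\<lambda>y. if y \<in> {s..s + 1 / 2} then g y else 0)"
  have int_m: "(m has_integral (- 2)) {0..1}"
    unfolding m_def using int_g[of s "s + 1 / 2"] s Gs Gs' by (subst has_integral_restrict) auto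
  have int_F: "((\<lambda>y. F y * g y) has_integral (- (\<Sum>p\<in>P. of_int (J p) * G p))) {0..1}"
    unfolding F_def by (rule step_fun_weighted_integral[OF P G' G1])
  have int_g1: "((\<lambda>y. of_int v * g y) has_integral (of_int v * (G 1 - G 0))) {0..1}"
    using int_g[of 0 1] by (intro has_integral_mult_right) auto
  have sin_nonneg: "0 \<le> sin (2 * pi * t)" if "0 \<le> t" "t \<le> 1 / 2" for t
    using that mult_left_mono[of t "1 / 2" "2 * pi"] by (intro sin_ge_zero) auto
  have g_mid: "g y \<le> 0" if "y \<in> {s..s + 1 / 2}" for y
  proof -
    have "0 \<le> sin (2 * pi * (y - s))" using that by (intro sin_nonneg) auto
    then show ?thesis by (simp add: g_def)
  qed
  have g_out: "g y \<ge> 0" if "y \<in> {0..1} - {s..s + 1 / 2}" for y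
  proof (cases "y < s")
    case True
    have "0 \<le> sin (2 * pi * (s - y))" using that True s by (intro sin_nonneg) auto
    moreover have "sin (2 * pi * (s - y)) = - sin (2 * pi * (y - s))"
      by (simp flip: sin_minus add: minus_mult_right del: minus_mult_right[symmetric])
    ultimately show ?thesis by (simp add: g_def mult_nonneg_nonpos)
  next
    case False
    then have y: "s + 1 / 2 < y" "y \<le> 1" using that by auto
    have "0 \<le> sin (2 * pi * (y - s - 1 / 2))" using y s by (intro sin_nonneg) auto
    moreover have "2 * pi * (y - s - 1 / 2) = 2 * pi * (y - s) - pi" by (simp add: algebra_simps)
    ultimately have "sin (2 * pi * (y - s)) \<le> 0" by simp
    then show ?thesis by (simp add: g_def mult_nonneg_nonpos)
  qed
  have F: "of_int v \<le> F y" "F y \<le> of_int v + 1" if "y \<in> {0..<1}" for y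
    using v[OF that] by (auto simp: F_def)
  have upper: "- (\<Sum>p\<in>P. of_int (J p) * G p) \<le> of_int v * (G 1 - G 0) + (G 1 - G 0) - (- 2)"
  proof (rule has_integral_le)
    \<comment> \<open>The majorant takes the value \<open>v + 1\<close> where \<open>g\<close> is
      positive and \<open>v\<close> where it is negative. The bounds on \<open>F\<close> say nothing
      at \<open>y = 1\<close>, so there \<open>?h\<close> copies the integrand.\<close>
    let ?h = "\<lambda>y. if y = 1 then F y * g y else of_int v * g y + g y - m y"
    have "((\<lambda>y. of_int v * g y + g y - m y) has_integral
       (of_int v * (G 1 - G 0) + (G 1 - G 0) - (- 2))) {0..1}"
      using int_g[of 0 1] by (intro has_integral_diff has_integral_add int_g1 int_m) auto
    then show "(?h has_integral (of_int v * (G 1 - G 0) + (G 1 - G 0) - (- 2))) {0..1}"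
      by (rule has_integral_spike_finite[of "{1}", rotated 2]) auto
    fix y :: real assume y: "y \<in> {0..1}"
    show "F y * g y \<le> ?h y"
    proof (cases "y = 1")
      case False
      then have y': "y \<in> {0..<1}" using y by auto
      show ?thesis
      proof (cases "y \<in> {s..s + 1 / 2}")
        case True
        then have "m y = g y" by (simp add: m_def)
        then show ?thesis using False mult_right_mono_neg[OF F(1)[OF y'] g_mid[OF True]] by simp
      next
        case out: False
        then have "F y * g y \<le> (of_int v + 1) * g y"
          using y by (intro mult_right_mono F y' g_out) auto
        moreover have "m y = 0" using out by (auto simp: m_def)
        ultimately show ?thesis using False by (simp add: algebra_simps)
      qed
    qed simp
  qed (rule int_F)
  have lower: "of_int v * (G 1 - G 0) + (- 2) \<le> - (\<Sum>p\<in>P. of_int (J p) * G p)"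
  proof (rule has_integral_le)
    let ?h = "\<lambda>y. if y = 1 then F y * g y else of_int v * g y + m y"
    have "((\<lambda>y. of_int v * g y + m y) has_integral (of_int v * (G 1 - G 0) + (- 2))) {0..1}"
      by (intro has_integral_add int_g1 int_m)
    then show "(?h has_integral (of_int v * (G 1 - G 0) + (- 2))) {0..1}"
      by (rule has_integral_spike_finite[of "{1}", rotated 2]) auto
    fix y :: real assume y: "y \<in> {0..1}"
    show "?h y \<le> F y * g y"
    proof (cases "y = 1")
      case False
      then have y': "y \<in> {0..<1}" using y by auto
      show ?thesis
      proof (cases "y \<in> {s..s + 1 / 2}")
        case True
        then have "m y = g y" by (simp add: m_def)
        then show ?thesis using False mult_right_mono_neg[OF F(2)[OF y'] g_mid[OF True]]
          by (simp add: algebra_simps)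
      next
        case out: False
        then have "of_int v * g y \<le> F y * g y"
          using y by (intro mult_right_mono F y' g_out) auto
        moreover have "m y = 0" using out by (auto simp: m_def)
        ultimately show ?thesis using False by simp
      qed
    qed simp
  qed (rule int_F)
  show ?thesis using upper lower G1 by (simp add: G_def)
qed

lemma two_valued_step_fun_fourier_bound:
  fixes J :: "real \<Rightarrow> int"
  assumes P: "finite P" "P \<subseteq> {0..<1}" "(\<Sum>p\<in>P. J p) = 0"
    and v: "\<And>y. y \<in> {0..<1} \<Longrightarrow> v \<le> step_fun C P J y \<and> step_fun C P J y \<le> v + 1"
  shows "cmod (\<Sum>p\<in>P. of_int (J p) * exponential 1 p) \<le> 2"
proof -
  define D where "D = (\<Sum>p\<in>P. of_int (J p) * exponential 1 p)"
  \<comment> \<open>Rotating by the argument makes \<open>D\<close> real. A negative argument is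
    first shifted by half a period to bring \<open>s\<close> into the admissible range, which only
    changes the sign of the rotated value.\<close>
  define s where "s = (if Arg D \<ge> 0 then Arg D / (2 * pi) else Arg D / (2 * pi) + 1 / 2)"
  have "- pi < Arg D" "Arg D \<le> pi" using Arg_bounded[of D] by auto
  then have s: "0 \<le> s" "s \<le> 1 / 2" by (auto simp: s_def field_simps)
  have Re: "Re (D * cis (- (2 * pi * s))) = (\<Sum>p\<in>P. of_int (J p) * cos (2 * pi * (p - s)))"
    unfolding D_def sum_distrib_right Re_sum
  proof (intro sum.cong refl)
    fix p
    have "exponential 1 p * cis (- (2 * pi * s)) = cis (2 * pi * (p - s))"
      by (simp add: exponential_cis cis_mult algebra_simps)
    then show "Re (of_int (J p) * exponential 1 p * cis (- (2 * pi * s)))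
        = of_int (J p) * cos (2 * pi * (p - s))"
      by (simp add: mult.assoc)
  qed
  have "\<bar>Re (D * cis (- (2 * pi * s)))\<bar> = cmod D"
  proof -
    have D: "D = of_real (cmod D) * cis (Arg D)"
      by (metis rcis_cmod_Arg rcis_def)
    have "D * cis (- (2 * pi * s)) = of_real (cmod D) * cis (Arg D - 2 * pi * s)"
      by (subst D) (simp add: mult.assoc cis_mult)
    moreover have "Arg D - 2 * pi * s = 0 \<or> Arg D - 2 * pi * s = - pi"
      by (auto simp: s_def field_simps)
    ultimately show ?thesis by auto
  qed
  moreover have "\<bar>Re (D * cis (- (2 * pi * s)))\<bar> \<le> 2"
    unfolding Re by (rule two_valued_step_fun_cos_bound[OF P v s])
  ultimately show ?thesis unfolding D_def[symmetric] by simp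
qed

text \<open>The exponents start at 1 because the bound on the jump sums is available only for folds
  with \<open>N > 0\<close>.\<close>

lemma mean_powers_unit:
  fixes w :: complex
  assumes "cmod w = 1"
  shows "(\<lambda>M. (\<Sum>n<M. w ^ Suc n) / of_nat M) \<longlonglongrightarrow> (if w = 1 then 1 else 0)"
proof (cases "w = 1")
  case True
  have "eventually (\<lambda>M. (\<Sum>n<M. w ^ Suc n) / of_nat M = 1) sequentially"
    using eventually_gt_at_top[of 0] by eventually_elim (simp add: True)
  then show ?thesis using True by (simp add: tendsto_eventually)
next
  case False
  have bound: "cmod (\<Sum>n<M. w ^ Suc n) \<le> 2 / cmod (w - 1)" for M
  proof -
    have "(\<Sum>n<M. w ^ Suc n) = w * ((w ^ M - 1) / (w - 1))"
      using False by (simp add: sum_distrib_left[symmetric] geometric_sum)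
    then have "cmod (\<Sum>n<M. w ^ Suc n) = cmod (w ^ M - 1) / cmod (w - 1)"
      using assms by (simp add: norm_mult norm_divide)
    also have "cmod (w ^ M - 1) \<le> 2"
      using norm_triangle_ineq4[of "w ^ M" 1] assms by (simp add: norm_power)
    finally show ?thesis by (simp add: divide_right_mono)
  qed
  have "(\<lambda>M. (\<Sum>n<M. w ^ Suc n) / of_nat M) \<longlonglongrightarrow> 0"
  proof (rule Lim_null_comparison)
    show "(\<lambda>M. 2 / cmod (w - 1) * (1 / real M)) \<longlonglongrightarrow> 0"
      by (intro tendsto_mult_right_zero lim_1_over_n)
    show "\<forall>\<^sub>F M in sequentially. cmod ((\<Sum>n<M. w ^ Suc n) / of_nat M) \<le> 2 / cmod (w - 1) * (1 / real M)"
    proof (intro always_eventually allI)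
      fix M
      have "cmod (\<Sum>n<M. w ^ Suc n) / real M \<le> (2 / cmod (w - 1)) / real M"
        by (intro divide_right_mono bound) simp
      then show "cmod ((\<Sum>n<M. w ^ Suc n) / of_nat M) \<le> 2 / cmod (w - 1) * (1 / real M)"
        by (simp only: norm_divide norm_of_nat times_divide_eq_right mult_1_right)
    qed
  qed
  then show ?thesis using False by simp
qed

text \<open>
  A nonnegative trigonometric sum in \<open>n\<close> whose mean is not positive has only zero coefficients,
  so it also vanishes at \<open>n = 0\<close>.
\<close>

lemma trigonometric_sum_nonneg_mean_zero:
  fixes c z :: "'i \<Rightarrow> complex"
  assumes I: "finite I" and z: "\<And>i. i \<in> I \<Longrightarrow> cmod (z i) = 1"
    and h: "\<And>n. n > 0 \<Longrightarrow> (\<Sum>i\<in>I. c i * z i ^ n) = of_real (h n)" "\<And>n. n > 0 \<Longrightarrow> 0 \<le> h n"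
    and mean: "Re (\<Sum>i\<in>{i\<in>I. z i = 1}. c i) \<le> 0"
  shows "(\<Sum>i\<in>I. c i) = 0"
proof -
  \<comment> \<open>\<open>L w\<close> is the coefficient at \<open>w\<close> after equal
    \<open>z i\<close> are merged; the averages \<open>A w\<close> of \<open>h n / w ^ n\<close>
    recover it in the limit.\<close>
  define L where "L = (\<lambda>w. \<Sum>i\<in>{i\<in>I. z i = w}. c i)"
  define A where "A = (\<lambda>w M. (\<Sum>n<M. of_real (h (Suc n)) * inverse w ^ Suc n) / complex_of_nat M)"
  have lim: "A w \<longlonglongrightarrow> L w" if w: "cmod w = 1" for w
  proof -
    have w0: "w \<noteq> 0" using w by auto
    have "(\<lambda>M. \<Sum>i\<in>I. c i * ((\<Sum>n<M. (z i / w) ^ Suc n) / of_nat M))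
        \<longlonglongrightarrow> (\<Sum>i\<in>I. c i * (if z i / w = 1 then 1 else 0))"
      using z w by (intro tendsto_sum tendsto_mult tendsto_const mean_powers_unit) (simp add: norm_divide)
    moreover have "(\<Sum>i\<in>I. c i * (if z i / w = 1 then 1 else 0)) = L w"
    proof -
      have "(\<Sum>i\<in>I. c i * (if z i / w = 1 then 1 else 0)) = (\<Sum>i\<in>I. if z i = w then c i else 0)"
        using w0 by (intro sum.cong) auto
      then show ?thesis unfolding L_def by (simp only: sum.inter_filter[OF I])
    qed
    moreover have "(\<Sum>i\<in>I. c i * ((\<Sum>n<M. (z i / w) ^ Suc n) / of_nat M)) = A w M" for M
    proof -
      have "(\<Sum>n<M. of_real (h (Suc n)) * inverse w ^ Suc n)
          = (\<Sum>n<M. \<Sum>i\<in>I. c i * (z i / w) ^ Suc n)"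
      proof (intro sum.cong refl)
        fix n
        have "of_real (h (Suc n)) = (\<Sum>i\<in>I. c i * z i ^ Suc n)" using h(1)[of "Suc n"] by simp
        then have "of_real (h (Suc n)) * inverse w ^ Suc n
            = (\<Sum>i\<in>I. c i * z i ^ Suc n * inverse w ^ Suc n)" by (simp only: sum_distrib_right)
        then show "of_real (h (Suc n)) * inverse w ^ Suc n = (\<Sum>i\<in>I. c i * (z i / w) ^ Suc n)"
          by (simp only: divide_inverse power_mult_distrib mult.assoc)
      qed
      also have "\<dots> = (\<Sum>i\<in>I. c i * (\<Sum>n<M. (z i / w) ^ Suc n))"
        by (subst sum.swap) (simp only: sum_distrib_left)
      finally have X: "(\<Sum>n<M. of_real (h (Suc n)) * inverse w ^ Suc n)
          = (\<Sum>i\<in>I. c i * (\<Sum>n<M. (z i / w) ^ Suc n))" .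
      show ?thesis
        unfolding A_def X by (subst (2) sum_divide_distrib) (simp only: times_divide_eq_right)
    qed
    ultimately show ?thesis by simp
  qed
  \<comment> \<open>Here positivity of \<open>h\<close> enters: its average against any unimodular
    sequence is dominated by its plain average.\<close>
  have norm_A: "cmod (A w M) \<le> Re (A 1 M)" if w: "cmod w = 1" for w M
  proof -
    have A1: "A 1 M = of_real ((\<Sum>n<M. h (Suc n)) / M)" by (simp add: A_def)
    have "cmod (\<Sum>n<M. of_real (h (Suc n)) * inverse w ^ Suc n) \<le> (\<Sum>n<M. h (Suc n))"
      using h(2) w by (intro order_trans[OF norm_sum] sum_mono)
        (simp add: norm_mult norm_power norm_inverse)
    from divide_right_mono[OF this, of "real M"] show ?thesis
      unfolding A1 by (simp only: A_def norm_divide norm_of_nat Re_complex_of_real of_nat_0_le_iff simp_thms)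
  qed
  have L0: "L w = 0" if w: "cmod w = 1" for w
  proof -
    have "cmod (L w) \<le> Re (L 1)"
      by (rule LIMSEQ_le[OF tendsto_norm[OF lim[OF w]] tendsto_Re[OF lim]]) (use norm_A[OF w] in auto)
    also have "\<dots> \<le> 0" using mean by (simp only: L_def)
    finally show ?thesis by simp
  qed
  have "(\<Sum>i\<in>I. c i) = (\<Sum>w\<in>z ` I. L w)"
    unfolding L_def by (rule sum.image_gen[OF I])
  also have "\<dots> = 0" using L0 z by (intro sum.neutral) auto
  finally show ?thesis .
qed

lemma exists_fold_with_gap:
  fixes J :: "real \<Rightarrow> int"
  assumes P: "finite P" "P \<subseteq> {0..<1}" "(\<Sum>p\<in>P. J p) = 0" and up: "up_variation P J \<ge> 2"
  shows "\<exists>N>0. \<exists>x\<in>{0..<1}. \<exists>y\<in>{0..<1}.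
     step_fun (fold_const N C P J) (fold_points N P) (fold_jump N P J) x + 2
       \<le> step_fun (fold_const N C P J) (fold_points N P) (fold_jump N P J) y"
proof (rule ccontr)
  assume contra: "\<not> ?thesis"
  define D where "D = (\<lambda>N. \<Sum>p\<in>P. of_int (J p) * exponential 1 p ^ N :: complex)"
  have D_le: "cmod (D N) \<le> 2" if N: "N > 0" for N :: nat
  proof -
    let ?F = "step_fun (fold_const N C P J) (fold_points N P) (fold_jump N P J)"
    note props = fold_points_props[OF P(1), of N] sum_fold_jump_zero[OF P(1,3), of N]
    have close: "\<bar>?F x - ?F y\<bar> < 2" if "x \<in> {0..<1}" "y \<in> {0..<1}" for x y
      using contra N that by (metis abs_less_iff add.commute diff_less_eq minus_diff_eq not_le)
    \<comment> \<open>A minimal value of the integer-valued count. Since all values differ from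
      \<open>?F 0\<close> by less than 2, adding 2 makes the argument of \<open>nat\<close> positive
      and loses no information.\<close>
    have "\<exists>x. x \<in> {0..<1} \<and> (\<forall>y. y \<in> {0..<1} \<longrightarrow> nat (?F x - ?F 0 + 2) \<le> nat (?F y - ?F 0 + 2))"
      by (rule ex_has_least_nat[of _ 0]) simp
    then obtain x where x: "x \<in> {0..<1}"
      "\<And>y. y \<in> {0..<1} \<Longrightarrow> nat (?F x - ?F 0 + 2) \<le> nat (?F y - ?F 0 + 2)" by blast
    have "?F x \<le> ?F y \<and> ?F y \<le> ?F x + 1" if y: "y \<in> {0..<1}" for y
      using close[OF x(1) y] close[of y 0] close[of x 0] x(2)[OF y] x(1) y by (auto simp: nat_le_eq_zle)
    then have "cmod (\<Sum>r\<in>fold_points N P. of_int (fold_jump N P J r) * exponential 1 r) \<le> 2"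
      by (intro two_valued_step_fun_fourier_bound[OF props]) auto
    also have "(\<Sum>r\<in>fold_points N P. of_int (fold_jump N P J r) * exponential 1 r)
       = (\<Sum>p\<in>P. of_int (J p) * exponential 1 (frac (real N * p)))"
      by (rule sum_fold_jump[OF P(1)])
    also have "\<dots> = D N"
      unfolding D_def
    proof (intro sum.cong refl)
      fix p
      have "exponential 1 (real N * p)
          = exponential 1 (frac (real N * p)) * exponential 1 (of_int \<lfloor>real N * p\<rfloor>)"
        by (simp flip: exponential_add_right add: frac_def)
      then have "exponential 1 (frac (real N * p)) = exponential 1 (real N * p)"
        using exponential_int_eq_1[of 1] by simp
      also have "\<dots> = exponential 1 p ^ N"
        by (simp add: exponential_cis Complex.DeMoivre mult_ac)
      finally show "of_int (J p) * exponential 1 (frac (real N * p)) = of_int (J p) * exponential 1 p ^ N"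
        by simp
    qed
    finally show ?thesis .
  qed
  \<comment> \<open>\<open>None\<close> carries the constant 4 and \<open>Some (p, q)\<close> a
    product from the expansion of the square of \<open>cmod (D n)\<close>, so the sum over
    \<open>I\<close> is 4 minus that square.\<close>
  define I where "I = insert None (Some ` (P \<times> P))"
  define c :: "(real \<times> real) option \<Rightarrow> complex" where
    "c = (\<lambda>i. case i of None \<Rightarrow> 4 | Some (p, q) \<Rightarrow> - of_int (J p * J q))"
  define z :: "(real \<times> real) option \<Rightarrow> complex" where
    "z = (\<lambda>i. case i of None \<Rightarrow> 1 | Some (p, q) \<Rightarrow> exponential 1 (p - q))"
  have sumI: "(\<Sum>i\<in>I. f i) = f None + (\<Sum>p\<in>P. \<Sum>q\<in>P. f (Some (p, q)))" for f :: "_ \<Rightarrow> complex"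
    unfolding I_def using P(1) by (simp add: sum.reindex sum.cartesian_product case_prod_unfold)
  have h: "(\<Sum>i\<in>I. c i * z i ^ n) = of_real (4 - (cmod (D n))\<^sup>2)" for n
  proof -
    have "complex_of_real ((cmod (D n))\<^sup>2)
       = (\<Sum>p\<in>P. \<Sum>q\<in>P. of_int (J p * J q) * exponential 1 (p - q) ^ n)"
      unfolding complex_norm_square D_def cnj_sum sum_product
    proof (intro sum.cong refl)
      fix p q
      have "exponential 1 (p - q) = exponential 1 p * cnj (exponential 1 q)"
        by (simp add: exponential_cis cis_mult cis_cnj algebra_simps)
      then show "of_int (J p) * exponential 1 p ^ n * cnj (of_int (J q) * exponential 1 q ^ n)
          = of_int (J p * J q) * exponential 1 (p - q) ^ n"
        by (simp add: power_mult_distrib)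
    qed
    then show ?thesis by (simp add: sumI c_def z_def sum_negf del: of_real_power)
  qed
  have mean: "Re (\<Sum>i\<in>{i\<in>I. z i = 1}. c i) \<le> 0"
  proof -
    \<comment> \<open>Distinct points of \<open>{0..<1}\<close> are distinct on the circle, so only
      diagonal terms contribute to the mean.\<close>
    have z1: "exponential 1 (p - q) = 1 \<longleftrightarrow> q = p" if "p \<in> P" "q \<in> P" for p q
    proof
      assume "exponential 1 (p - q) = 1"
      then obtain k :: int where k: "p - q = of_int k"
        unfolding exponential_eq_1_iff by (auto elim: Ints_cases)
      have "0 \<le> p" "p < 1" "0 \<le> q" "q < 1" using that P(2) by auto
      then have "\<bar>real_of_int k\<bar> < 1" using k by linarith
      then have "k = 0" by linarith
      then show "q = p" using k by simp
    qed simp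
    have "(\<Sum>i\<in>{i\<in>I. z i = 1}. c i) = (\<Sum>i\<in>I. if z i = 1 then c i else 0)"
      using P(1) by (intro sum.inter_filter) (simp add: I_def)
    also have "\<dots> = 4 + (\<Sum>p\<in>P. \<Sum>q\<in>P. if q = p then - of_int (J p * J p) else 0)"
      unfolding sumI using z1 by (intro arg_cong2[where f = "(+)"] sum.cong) (auto simp: c_def z_def)
    also have "\<dots> = of_int (4 - (\<Sum>p\<in>P. J p * J p))"
      using P(1) by (simp add: sum_negf)
    finally have "Re (\<Sum>i\<in>{i\<in>I. z i = 1}. c i) = of_int (4 - (\<Sum>p\<in>P. J p * J p))"
      by (simp only: complex_Re_of_int)
    moreover have "4 \<le> (\<Sum>p\<in>P. J p * J p)"
    proof -
      \<comment> \<open>The left side is \<open>\<bar>J p\<bar>\<close>, which an integer square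
        dominates; as the jumps sum to 0 it adds up to twice the up-variation.\<close>
      have "2 * max 0 (J p) - J p \<le> J p * J p" for p
        using self_le_power[of "\<bar>J p\<bar>" 2] by (cases "J p = 0") (auto simp: power2_eq_square max_def)
      then have "(\<Sum>p\<in>P. 2 * max 0 (J p) - J p) \<le> (\<Sum>p\<in>P. J p * J p)" by (intro sum_mono)
      moreover have "(\<Sum>p\<in>P. 2 * max 0 (J p) - J p) = 2 * up_variation P J"
        using P(3) by (simp add: sum_subtractf up_variation_def sum_distrib_left)
      ultimately show ?thesis using up by simp
    qed
    ultimately show ?thesis by (simp only: of_int_le_0_iff)
  qed
  have "(\<Sum>i\<in>I. c i) = 0"
  proof (rule trigonometric_sum_nonneg_mean_zero[OF _ _ h _ mean])
    show "finite I" using P(1) by (simp add: I_def)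
    show "cmod (z i) = 1" if "i \<in> I" for i by (auto simp: z_def split: option.split)
    show "0 \<le> 4 - (cmod (D n))\<^sup>2" if "n > 0" for n
      using power_mono[OF D_le[OF that], of 2] by simp
  qed
  then have "complex_of_real (4 - (cmod (D 0))\<^sup>2) = 0" using h[of 0] by simp
  moreover have "D 0 = of_int (\<Sum>p\<in>P. J p)" by (simp add: D_def)
  ultimately show False using P(3) by simp
qed

subsection \<open>Density of trigonometric polynomials\<close>

definition sq_int :: "(real \<Rightarrow> complex) \<Rightarrow> bool" where
  "sq_int f \<longleftrightarrow> f \<in> borel_measurable borel \<and> set_integrable lborel {0..<1} (\<lambda>x. (cmod (f x))\<^sup>2)"

lemma sq_int_dominated:
  assumes "f \<in> borel_measurable borel" "sq_int g" "sq_int h" "c \<ge> 0" "d \<ge> 0"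
    and "\<And>x. x \<in> {0..<1} \<Longrightarrow> (cmod (f x))\<^sup>2 \<le> c * (cmod (g x))\<^sup>2 + d * (cmod (h x))\<^sup>2"
  shows "sq_int f"
    and "S \<in> sets borel \<Longrightarrow> S \<subseteq> {0..<1} \<Longrightarrow> energy S f \<le> c * energy S g + d * energy S h"
proof -
  have gh: "set_integrable lborel {0..<1} (\<lambda>x. c * (cmod (g x))\<^sup>2 + d * (cmod (h x))\<^sup>2)"
    using assms(2,3) unfolding sq_int_def
    by (intro set_integral_add(1) set_integrable_mult_right) auto
  have [measurable]: "f \<in> borel_measurable borel" using assms by simp
  have f: "set_integrable lborel {0..<1} (\<lambda>x. (cmod (f x))\<^sup>2)"
    by (rule set_integrable_bound[OF gh]) (use assms in \<open>auto simp: set_borel_measurable_def intro!: AE_I2\<close>)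
  then show "sq_int f" using assms by (simp add: sq_int_def)
  assume S: "S \<in> sets borel" "S \<subseteq> {0..<1}"
  have *: "set_integrable lborel S (\<lambda>x. (cmod (u x))\<^sup>2)" if "sq_int u" for u
    using that S unfolding sq_int_def by (metis set_integrable_subset sets_lborel)
  have "energy S f \<le> (LINT x:S|lborel. c * (cmod (g x))\<^sup>2 + d * (cmod (h x))\<^sup>2)"
    unfolding energy_def using S assms gh
    by (intro set_integral_mono * \<open>sq_int f\<close> set_integrable_subset[OF gh]) auto
  also have "\<dots> = c * energy S g + d * energy S h"
    unfolding energy_def using *[OF assms(2)] *[OF assms(3)] by (simp add: set_integral_add(2))
  finally show "energy S f \<le> c * energy S g + d * energy S h" .
qed

lemma sq_int_continuous: "continuous_on UNIV f \<Longrightarrow> sq_int f"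
  unfolding sq_int_def by (simp add: borel_measurable_continuous_onI set_integrable_energy)

lemma sq_int_add:
  assumes "sq_int f" "sq_int g"
  shows "sq_int (\<lambda>x. f x + g x)"
proof (rule sq_int_dominated(1)[OF _ assms])
  show "(\<lambda>x. f x + g x) \<in> borel_measurable borel" using assms by (auto simp: sq_int_def)
  show "(cmod (f x + g x))\<^sup>2 \<le> (1 + 1) * (cmod (f x))\<^sup>2 + (1 + 1 / 1) * (cmod (g x))\<^sup>2" for x
    by (rule norm_add_square_le) simp
qed auto

lemma sq_int_mult_left: "sq_int f \<Longrightarrow> sq_int (\<lambda>x. c * f x)"
  by (rule sq_int_dominated(1)[of _ f f "(cmod c)\<^sup>2" 0])
    (auto simp: sq_int_def norm_mult power_mult_distrib)

lemma sq_int_diff: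
  assumes "sq_int f" "sq_int g"
  shows "sq_int (\<lambda>x. f x - g x)"
  using sq_int_add[OF assms(1) sq_int_mult_left[OF assms(2), of "- 1"]] by simp

lemma energy_add_le_sq_int:
  assumes "sq_int f" "sq_int g" "S \<in> sets borel" "S \<subseteq> {0..<1}" "K > 0"
  shows "energy S (\<lambda>x. f x + g x) \<le> (1 + K) * energy S f + (1 + 1 / K) * energy S g"
  using assms sq_int_add[OF assms(1,2)]
  by (intro sq_int_dominated(2) norm_add_square_le) (auto simp: sq_int_def)

section \<open>Closure of the trigonometric polynomials in the mean-square norm\<close>

text \<open>An inductive form suited to closure under sums and products;
  \<open>is_trig_trig_poly\<close> recovers explicit coefficients.\<close>

inductive is_trig :: "(real \<Rightarrow> complex) \<Rightarrow> bool" where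
  exponential: "is_trig (\<lambda>x. c * exponential (of_int k) x)"
| add: "is_trig f \<Longrightarrow> is_trig g \<Longrightarrow> is_trig (\<lambda>x. f x + g x)"

lemma is_trig_mult_exponential:
  "is_trig f \<Longrightarrow> is_trig (\<lambda>x. c * exponential (of_int k) x * f x)"
proof (induction rule: is_trig.induct)
  case (exponential d l)
  have "(\<lambda>x. c * exponential (of_int k) x * (d * exponential (of_int l) x))
      = (\<lambda>x. (c * d) * exponential (of_int (k + l)) x)"
    by (simp add: exponential_add mult_ac)
  then show ?case using is_trig.exponential[of "c * d" "k + l"] by simp
next
  case (add f g)
  then show ?case using is_trig.add by (simp add: distrib_left)
qed

lemma is_trig_mult: "is_trig f \<Longrightarrow> is_trig g \<Longrightarrow> is_trig (\<lambda>x. f x * g x)"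
proof (induction rule: is_trig.induct)
  case (exponential c k)
  then show ?case by (rule is_trig_mult_exponential)
next
  case (add f1 f2)
  then show ?case using is_trig.add by (simp add: distrib_right)
qed

lemma is_trig_const: "is_trig (\<lambda>x. c)"
  using is_trig.exponential[of c 0] by simp

lemma trig_poly_add:
  assumes "finite F" "finite G"
  shows "trig_poly F a x + trig_poly G b x
    = trig_poly (F \<union> G) (\<lambda>k. (if k \<in> F then a k else 0) + (if k \<in> G then b k else 0)) x"
proof -
  have "trig_poly F a x = trig_poly (F \<union> G) (\<lambda>k. if k \<in> F then a k else 0) x"
    unfolding trig_poly_def using assms by (intro sum.mono_neutral_cong_left) auto
  moreover have "trig_poly G b x = trig_poly (F \<union> G) (\<lambda>k. if k \<in> G then b k else 0) x"
    unfolding trig_poly_def using assms by (intro sum.mono_neutral_cong_left) auto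
  ultimately show ?thesis by (simp add: trig_poly_def distrib_right sum.distrib)
qed

lemma is_trig_trig_poly:
  assumes "is_trig f"
  obtains F a where "finite F" "f = trig_poly F a"
proof -
  have "\<exists>F a. finite F \<and> f = trig_poly F a"
    using assms
  proof (induction rule: is_trig.induct)
    case (exponential c k)
    show ?case by (intro exI[of _ "{k}"] exI[of _ "\<lambda>_. c"]) (auto simp: trig_poly_def)
  next
    case (add f g)
    then obtain F a G b where "finite F" "f = trig_poly F a" "finite G" "g = trig_poly G b" by blast
    then have "finite (F \<union> G)" "(\<lambda>x. f x + g x) = trig_poly (F \<union> G)
        (\<lambda>k. (if k \<in> F then a k else 0) + (if k \<in> G then b k else 0))"
      using trig_poly_add by auto
    then show ?case by blast
  qed
  then show ?thesis using that by blast
qed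

lemma is_trig_sq_int: "is_trig f \<Longrightarrow> sq_int f"
  by (elim is_trig_trig_poly) (auto intro!: sq_int_continuous continuous_intros)

lemma is_trig_real_polynomial:
  "real_polynomial_function g \<Longrightarrow> is_trig (\<lambda>x. of_real (g (exponential 1 x)))"
proof (induction rule: real_polynomial_function.induct)
  case (linear f)
  then interpret bounded_linear f .
  \<comment> \<open>Real linearity gives \<open>f z = Re z * f 1 + Im z * f \<i>\<close>; real and
    imaginary part are combinations of \<open>z\<close> and \<open>cnj z\<close>, here the
    exponentials of frequency 1 and -1.\<close>
  have f: "of_real (f (exponential 1 x)) =
      (of_real (f 1) / 2 + of_real (f \<i>) / (2 * \<i>)) * exponential (of_int 1) x
      + (of_real (f 1) / 2 - of_real (f \<i>) / (2 * \<i>)) * exponential (of_int (- 1)) x" for x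
  proof -
    define z where "z = exponential 1 x"
    have z: "exponential (of_int (- 1)) x = cnj z" by (simp add: z_def cnj_exponential)
    have "f z = f (Re z *\<^sub>R 1 + Im z *\<^sub>R \<i>)"
      by (rule arg_cong[of _ _ f]) (simp add: complex_eq_iff)
    then have "f z = Re z * f 1 + Im z * f \<i>" by (simp add: add scaleR)
    then have "of_real (f z) = of_real (Re z) * of_real (f 1) + of_real (Im z) * complex_of_real (f \<i>)" by simp
    also have "\<dots> = (of_real (f 1) / 2 + of_real (f \<i>) / (2 * \<i>)) * z
      + (of_real (f 1) / 2 - of_real (f \<i>) / (2 * \<i>)) * cnj z"
      by (simp add: complex_eq_iff field_simps)
    moreover have "exponential (of_int 1) x = z" by (simp add: z_def)
    ultimately show ?thesis by (simp only: z z_def[symmetric])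
  qed
  show ?case unfolding f by (intro is_trig.intros)
next
  case (const c)
  show ?case by (rule is_trig_const)
next
  case (add f g)
  then show ?case using is_trig.add by simp
next
  case (mult f g)
  then show ?case using is_trig_mult by simp
qed

definition trig_approx :: "(real \<Rightarrow> complex) \<Rightarrow> bool" where
  "trig_approx f \<longleftrightarrow> sq_int f \<and> (\<forall>\<epsilon>>0. \<exists>p. is_trig p \<and> energy {0..<1} (\<lambda>x. f x - p x) < \<epsilon>)"

lemma trig_approx_closed:
  assumes f: "sq_int f" and g: "\<And>\<epsilon>. \<epsilon> > 0 \<Longrightarrow> \<exists>g. trig_approx g \<and> energy {0..<1} (\<lambda>x. f x - g x) < \<epsilon>"
  shows "trig_approx f"
  unfolding trig_approx_def
proof (intro conjI allI impI f)
  fix \<epsilon> :: real assume \<epsilon>: "\<epsilon> > 0"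
  obtain g where g: "trig_approx g" "energy {0..<1} (\<lambda>x. f x - g x) < \<epsilon> / 4"
    using g[of "\<epsilon> / 4"] \<epsilon> by auto
  then obtain p where p: "is_trig p" "energy {0..<1} (\<lambda>x. g x - p x) < \<epsilon> / 4"
    using \<epsilon> unfolding trig_approx_def by (metis divide_pos_pos zero_less_numeral)
  have "sq_int g" using g by (simp add: trig_approx_def)
  have "energy {0..<1} (\<lambda>x. (f x - g x) + (g x - p x))
     \<le> (1 + 1) * energy {0..<1} (\<lambda>x. f x - g x) + (1 + 1 / 1) * energy {0..<1} (\<lambda>x. g x - p x)"
    by (intro energy_add_le_sq_int sq_int_diff f \<open>sq_int g\<close> is_trig_sq_int p) auto
  also have "\<dots> < \<epsilon>" using g p by simp
  finally show "\<exists>p. is_trig p \<and> energy {0..<1} (\<lambda>x. f x - p x) < \<epsilon>" using p by auto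
qed

lemma trig_approx_trig: "is_trig p \<Longrightarrow> trig_approx p"
  unfolding trig_approx_def by (auto simp: is_trig_sq_int energy_def set_lebesgue_integral_def)

lemma trig_approx_add:
  assumes "trig_approx f" "trig_approx g"
  shows "trig_approx (\<lambda>x. f x + g x)"
  unfolding trig_approx_def
proof (intro conjI allI impI)
  have fg: "sq_int f" "sq_int g" using assms by (auto simp: trig_approx_def)
  then show "sq_int (\<lambda>x. f x + g x)" by (rule sq_int_add)
  fix \<epsilon> :: real assume \<epsilon>: "\<epsilon> > 0"
  then have "\<epsilon> / 4 > 0" by simp
  then obtain p q where p: "is_trig p" "energy {0..<1} (\<lambda>x. f x - p x) < \<epsilon> / 4"
    and q: "is_trig q" "energy {0..<1} (\<lambda>x. g x - q x) < \<epsilon> / 4"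
    using assms unfolding trig_approx_def by metis
  have "energy {0..<1} (\<lambda>x. (f x - p x) + (g x - q x))
     \<le> (1 + 1) * energy {0..<1} (\<lambda>x. f x - p x) + (1 + 1 / 1) * energy {0..<1} (\<lambda>x. g x - q x)"
    by (intro energy_add_le_sq_int sq_int_diff fg is_trig_sq_int p q) auto
  also have "\<dots> < \<epsilon>" using p q by simp
  finally show "\<exists>p. is_trig p \<and> energy {0..<1} (\<lambda>x. f x + g x - p x) < \<epsilon>"
    using is_trig.add[OF p(1) q(1)] by (intro exI[of _ "\<lambda>x. p x + q x"]) (auto simp: algebra_simps)
qed

lemma trig_approx_mult_left:
  assumes "trig_approx f"
  shows "trig_approx (\<lambda>x. c * f x)"
  unfolding trig_approx_def
proof (intro conjI allI impI)
  show "sq_int (\<lambda>x. c * f x)" using assms by (auto simp: trig_approx_def sq_int_mult_left)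
  fix \<epsilon> :: real assume \<epsilon>: "\<epsilon> > 0"
  define K where "K = (cmod c)\<^sup>2 + 1"
  have K: "K > 0" by (simp add: K_def add_nonneg_pos)
  then obtain p where p: "is_trig p" "energy {0..<1} (\<lambda>x. f x - p x) < \<epsilon> / K"
    using assms \<epsilon> unfolding trig_approx_def by (metis divide_pos_pos)
  have "energy {0..<1} (\<lambda>x. c * f x - c * p x) = (cmod c)\<^sup>2 * energy {0..<1} (\<lambda>x. f x - p x)"
    unfolding energy_def by (simp add: norm_mult power_mult_distrib flip: right_diff_distrib)
  also have "\<dots> \<le> K * energy {0..<1} (\<lambda>x. f x - p x)"
    by (intro mult_right_mono) (auto simp: K_def)
  also have "\<dots> < \<epsilon>" using p K by (simp add: field_simps)
  finally show "\<exists>p. is_trig p \<and> energy {0..<1} (\<lambda>x. c * f x - p x) < \<epsilon>"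
    using is_trig_mult[OF is_trig_const[of c] p(1)] by (intro exI[of _ "\<lambda>x. c * p x"]) simp
qed

lemma trig_approx_sum:
  assumes "finite I" "\<And>i. i \<in> I \<Longrightarrow> trig_approx (f i)"
  shows "trig_approx (\<lambda>x. \<Sum>i\<in>I. f i x)"
  using assms
proof (induction I rule: finite_induct)
  case empty
  then show ?case using trig_approx_trig[OF is_trig_const[of 0]] by simp
next
  case (insert i I)
  then show ?case using trig_approx_add by simp
qed

lemma sq_int_bounded:
  assumes "f \<in> borel_measurable borel" "\<And>x. cmod (f x) \<le> B"
  shows "sq_int f"
proof (rule sq_int_dominated(1)[of _ "\<lambda>_. 1" "\<lambda>_. 1" "B\<^sup>2" 0])
  show "(cmod (f x))\<^sup>2 \<le> B\<^sup>2 * (cmod 1)\<^sup>2 + 0 * (cmod 1)\<^sup>2" for x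
    using power_mono[OF assms(2), of x 2] by simp
qed (use assms in \<open>auto intro!: sq_int_continuous\<close>)

text \<open>Regularity of Lebesgue measure squeezes the set between a compact and an open one.
  Urysohn's lemma is applied to their images on the unit circle, not on the line, so that the
  resulting function is periodic and Stone-Weierstrass on the circle applies.\<close>

lemma trig_approx_indicator:
  assumes A: "A \<in> sets borel"
  shows "trig_approx (indicator A)"
proof (rule trig_approx_closed)
  show sq: "sq_int (indicator A)"
    using A by (intro sq_int_bounded[of _ 1]) (auto simp: indicator_def)
  fix \<epsilon> :: real assume \<epsilon>: "\<epsilon> > 0"
  \<comment> \<open>The points 0 and 1 have the same image on the circle. Removing 0 keeps
    \<open>K\<close> away from this seam, so its image misses that of
    \<open>{0..1} - U\<close>.\<close>
  define B where "B = A \<inter> {0<..<1}"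
  have B: "B \<in> sets lebesgue" "B \<in> sets borel" using A by (auto simp: B_def)
  obtain K where K: "closed K" "K \<subseteq> B" "B - K \<in> lmeasurable" "emeasure lebesgue (B - K) < ennreal (\<epsilon> / 4)"
    using sets_lebesgue_inner_closed[OF B(1), of "\<epsilon> / 4"] \<epsilon> by auto
  obtain V where V: "open V" "B \<subseteq> V" "V - B \<in> lmeasurable" "emeasure lebesgue (V - B) < ennreal (\<epsilon> / 4)"
    using sets_lebesgue_outer_open[OF B(1), of "\<epsilon> / 4"] \<epsilon> by auto
  define U where "U = V \<inter> {0<..<1}"
  have U: "open U" "B \<subseteq> U" "U \<subseteq> {0<..<1}" using V by (auto simp: U_def B_def)
  have K01: "K \<subseteq> {0<..<1}" using K by (auto simp: B_def)
  have KU: "K \<subseteq> U" using K U by auto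
  have "compact K"
    using K(1) bounded_subset[OF _ K01] by (simp add: compact_eq_bounded_closed)
  moreover have "compact ({0..1} - U)" using U by (intro compact_diff) auto
  ultimately have cl: "closed (exponential 1 ` K)" "closed (exponential 1 ` ({0..1} - U))"
    by (auto intro!: compact_imp_closed compact_continuous_image continuous_intros)
  have disj: "exponential 1 ` K \<inter> exponential 1 ` ({0..1} - U) = {}"
  proof -
    have False if xy: "x \<in> K" "y \<in> {0..1} - U" "exponential 1 x = exponential 1 y" for x y
    proof -
      have "exponential 1 x = exponential 1 (x - y) * exponential 1 y"
        by (simp flip: exponential_add_right)
      then have "exponential 1 (x - y) = 1" using xy by simp
      then obtain k :: int where k: "x - y = of_int k"
        unfolding exponential_eq_1_iff by (auto elim: Ints_cases)
      have "0 < x" "x < 1" "0 \<le> y" "y \<le> 1" using xy K01 by auto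
      then have "\<bar>real_of_int k\<bar> < 1" using k by linarith
      then have "k = 0" by linarith
      then show False using k xy KU by auto
    qed
    then show ?thesis by blast
  qed
  obtain H :: "complex \<Rightarrow> real" where H: "continuous_on UNIV H" "\<And>z. H z \<in> closed_segment 1 0"
    "\<And>z. z \<in> exponential 1 ` K \<Longrightarrow> H z = 1" "\<And>z. z \<in> exponential 1 ` ({0..1} - U) \<Longrightarrow> H z = 0"
    using Urysohn[OF cl disj] by metis
  have H01: "0 \<le> H z" "H z \<le> 1" for z
    using H(2)[of z] by (auto simp: closed_segment_eq_real_ivl)
  define h where "h = (\<lambda>x. complex_of_real (H (exponential 1 x)))"
  have h_cont: "continuous_on UNIV h"
    unfolding h_def
    by (intro continuous_intros continuous_on_compose2[OF H(1)]) auto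
  have "trig_approx h"
  proof (rule trig_approx_closed)
    show "sq_int h" by (rule sq_int_continuous[OF h_cont])
    fix \<delta> :: real assume \<delta>: "\<delta> > 0"
    obtain g where g: "real_polynomial_function g" "\<And>z. z \<in> sphere 0 1 \<Longrightarrow> \<bar>H z - g z\<bar> < sqrt (\<delta> / 2)"
      using Stone_Weierstrass_real_polynomial_function[OF compact_sphere continuous_on_subset[OF H(1)]]
        \<delta> by (metis half_gt_zero real_sqrt_gt_zero top_greatest)
    define p where "p = (\<lambda>x. complex_of_real (g (exponential 1 x)))"
    have p: "is_trig p" unfolding p_def by (rule is_trig_real_polynomial[OF g(1)])
    have "energy {0..<1} (\<lambda>x. h x - p x) \<le> \<delta> / 2 * energy {0..<1} (\<lambda>_. 1) + 0 * energy {0..<1} (\<lambda>_. 1)"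
    proof (rule sq_int_dominated(2))
      fix x :: real
      have "cmod (h x - p x) = \<bar>H (exponential 1 x) - g (exponential 1 x)\<bar>"
        by (simp add: h_def p_def flip: of_real_diff)
      also have "\<dots> < sqrt (\<delta> / 2)" by (rule g(2)) simp
      finally have "(cmod (h x - p x))\<^sup>2 \<le> (sqrt (\<delta> / 2))\<^sup>2" by (intro power_mono) auto
      then show "(cmod (h x - p x))\<^sup>2 \<le> \<delta> / 2 * (cmod 1)\<^sup>2 + 0 * (cmod 1)\<^sup>2" using \<delta> by simp
    qed (use sq_int_diff[OF sq_int_continuous[OF h_cont] is_trig_sq_int[OF p]] \<delta>
        sq_int_continuous[of "\<lambda>_. 1"] in \<open>auto simp: sq_int_def\<close>)
    also have "energy {0..<1} (\<lambda>_. 1) = 1" by (simp add: energy_def set_lebesgue_integral_def)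
    finally show "\<exists>g. trig_approx g \<and> energy {0..<1} (\<lambda>x. h x - g x) < \<delta>"
      using trig_approx_trig[OF p] \<delta> by (intro exI[of _ p]) auto
  qed
  moreover have "energy {0..<1} (\<lambda>x. indicator A x - h x) < \<epsilon>"
  proof -
    \<comment> \<open>The point 0 is listed because it may have been removed from \<open>A\<close>;
      any other error lies in one of the two thin differences.\<close>
    have le: "(cmod (indicator A x - h x))\<^sup>2 \<le> indicator ((V - B) \<union> (B - K) \<union> {0}) x" if "x \<in> {0..<1}" for x
    proof (cases "x \<in> (V - B) \<union> (B - K) \<union> {0}")
      case True
      have "\<bar>indicator A x - H (exponential 1 x)\<bar> \<le> 1"
        using H01[of "exponential 1 x"] by (auto simp: indicator_def)
      moreover have "indicator A x - h x = of_real (indicator A x - H (exponential 1 x))"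
        by (simp add: h_def indicator_def)
      ultimately have "(cmod (indicator A x - h x))\<^sup>2 \<le> 1\<^sup>2"
        by (intro power_mono) (auto simp only: norm_of_real norm_ge_zero)
      then show ?thesis using True by simp
    next
      case False
      have "indicator A x = h x"
      proof (cases "x \<in> K")
        case True
        then show ?thesis using K(2) H(3) by (auto simp: h_def B_def)
      next
        case nK: False
        then have "x \<notin> A" "x \<in> {0..1} - U" using False that U(2) by (auto simp: B_def U_def)
        then show ?thesis using H(4) by (simp add: h_def)
      qed
      then show ?thesis by simp
    qed
    let ?W = "(V - B) \<union> (B - K) \<union> {0}"
    have W: "?W \<in> sets borel" using V K B by auto
    have emW: "emeasure lborel ?W < ennreal (\<epsilon> / 2)"
    proof -
      have ss: "V - B \<in> sets lborel" "B - K \<in> sets lborel" "{0} \<in> sets (lborel :: real measure)"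
        using V K B by auto
      have "emeasure lborel ?W \<le> emeasure lborel ((V - B) \<union> (B - K)) + emeasure lborel {0 :: real}"
        by (rule emeasure_subadditive[OF sets.Un[OF ss(1,2)] ss(3)])
      also have "\<dots> \<le> emeasure lborel (V - B) + emeasure lborel (B - K)"
        using emeasure_subadditive[OF ss(1,2)] by simp
      also have "\<dots> < ennreal (\<epsilon> / 4 + \<epsilon> / 4)"
        using V(4) K(4) ss by (intro add_mono_ennreal) (auto simp: emeasure_completion)
      also have "\<dots> = ennreal (\<epsilon> / 2)" by simp
      finally show ?thesis .
    qed
    have fin: "emeasure lborel ?W < \<infinity>" using emW by (rule less_trans) simp
    have "energy {0..<1} (\<lambda>x. indicator A x - h x) \<le> (\<integral>x. indicator ?W x \<partial>lborel)"
      unfolding energy_def set_lebesgue_integral_def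
    proof (rule integral_mono)
      show "integrable lborel (\<lambda>x. indicat_real {0..<1} x *\<^sub>R (cmod (indicator A x - h x))\<^sup>2)"
        using sq_int_diff[OF sq sq_int_continuous[OF h_cont]] by (simp add: sq_int_def set_integrable_def)
      show "integrable lborel (\<lambda>x. indicat_real ?W x)" using W fin by (simp add: integrable_indicator_iff)
      show "indicat_real {0..<1} x *\<^sub>R (cmod (indicator A x - h x))\<^sup>2 \<le> indicator ?W x" for x
        using le[of x] by (cases "x \<in> {0..<1}") auto
    qed
    also have "\<dots> = measure lborel ?W" using W by simp
    also have "\<dots> \<le> \<epsilon> / 2"
      using emW \<epsilon> unfolding measure_def by (intro enn2real_leI) auto
    finally show ?thesis using \<epsilon> by simp
  qed
  ultimately show "\<exists>g. trig_approx g \<and> energy {0..<1} (\<lambda>x. indicator A x - g x) < \<epsilon>" by blast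
qed

theorem trig_approx_sq_int:
  assumes f: "sq_int f"
  shows "trig_approx f"
proof (rule trig_approx_closed[OF f])
  fix \<epsilon> :: real assume \<epsilon>: "\<epsilon> > 0"
  have fm[measurable]: "f \<in> borel_measurable borel" using f by (simp add: sq_int_def)
  obtain s where s: "\<And>i::nat. simple_function borel (s i)" "\<And>x. (\<lambda>i. s i x) \<longlonglongrightarrow> f x"
    "\<And>i x. cmod (s i x) \<le> 2 * cmod (f x)"
    using borel_measurable_implies_sequence_metric[OF fm, of 0] by auto
  have sm[measurable]: "s i \<in> borel_measurable borel" for i
    using s(1) by (rule borel_measurable_simple_function)
  have "(\<lambda>i. energy {0..<1} (\<lambda>x. f x - s i x)) \<longlonglongrightarrow> (\<integral>x. 0 \<partial>(lborel :: real measure))"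
    unfolding energy_def set_lebesgue_integral_def
  proof (rule integral_dominated_convergence)
    \<comment> \<open>The factor is 3 squared: \<open>s i\<close> has modulus at most twice that of
      \<open>f\<close>, so the difference has at most three times it.\<close>
    show "integrable lborel (\<lambda>x. 9 * (indicat_real {0..<1} x *\<^sub>R (cmod (f x))\<^sup>2))"
      using f by (intro integrable_mult_right) (simp add: sq_int_def set_integrable_def)
    show "AE x in lborel. (\<lambda>i. indicat_real {0..<1} x *\<^sub>R (cmod (f x - s i x))\<^sup>2) \<longlonglongrightarrow> 0"
    proof (rule AE_I2)
      fix x
      have "(\<lambda>i. indicat_real {0..<1} x *\<^sub>R (cmod (f x - s i x))\<^sup>2)
          \<longlonglongrightarrow> indicat_real {0..<1} x *\<^sub>R (cmod (f x - f x))\<^sup>2"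
        by (intro tendsto_intros s(2))
      then show "(\<lambda>i. indicat_real {0..<1} x *\<^sub>R (cmod (f x - s i x))\<^sup>2) \<longlonglongrightarrow> 0" by simp
    qed
    show "AE x in lborel. norm (indicat_real {0..<1} x *\<^sub>R (cmod (f x - s i x))\<^sup>2)
        \<le> 9 * (indicat_real {0..<1} x *\<^sub>R (cmod (f x))\<^sup>2)" for i
    proof (rule AE_I2)
      fix x
      have "cmod (f x - s i x) \<le> 3 * cmod (f x)"
        using norm_triangle_ineq4[of "f x" "s i x"] s(3)[of i x] by simp
      then have "(cmod (f x - s i x))\<^sup>2 \<le> (3 * cmod (f x))\<^sup>2" by (intro power_mono) auto
      then show "norm (indicat_real {0..<1} x *\<^sub>R (cmod (f x - s i x))\<^sup>2)
          \<le> 9 * (indicat_real {0..<1} x *\<^sub>R (cmod (f x))\<^sup>2)"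
        by (auto simp: indicator_def power_mult_distrib)
    qed
  qed auto
  then have "eventually (\<lambda>i. energy {0..<1} (\<lambda>x. f x - s i x) < \<epsilon>) sequentially"
    using \<epsilon> by (intro order_tendstoD(2)) auto
  then obtain i where i: "energy {0..<1} (\<lambda>x. f x - s i x) < \<epsilon>"
    by (auto simp: eventually_sequentially)
  have fin: "finite (range (s i))" using s(1)[of i] by (simp add: simple_function_def)
  have "s i = (\<lambda>x. \<Sum>y\<in>range (s i). y * indicator {x. s i x = y} x)"
  proof
    fix x
    have "(\<Sum>y\<in>range (s i). y * indicator {x. s i x = y} x) = (\<Sum>y\<in>range (s i). if y = s i x then y else 0)"
      by (intro sum.cong) (auto simp: indicator_def)
    then show "s i x = (\<Sum>y\<in>range (s i). y * indicator {x. s i x = y} x)" using fin by simp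
  qed
  moreover have "trig_approx (\<lambda>x. \<Sum>y\<in>range (s i). y * indicator {x. s i x = y} x)"
    by (intro trig_approx_sum fin trig_approx_mult_left trig_approx_indicator) measurable
  ultimately show "\<exists>g. trig_approx g \<and> energy {0..<1} (\<lambda>x. f x - g x) < \<epsilon>" using i by auto
qed

corollary trig_poly_dense:
  assumes "sq_int f" "\<epsilon> > 0"
  obtains F a where "finite F" "energy {0..<1} (\<lambda>x. f x - trig_poly F a x) < \<epsilon>"
proof -
  obtain p where "is_trig p" "energy {0..<1} (\<lambda>x. f x - p x) < \<epsilon>"
    using trig_approx_sq_int[OF assms(1)] assms(2) unfolding trig_approx_def by blast
  then show ?thesis by (elim is_trig_trig_poly) (use that in auto)
qed

subsection \<open>Short arcs\<close>

lemma exponential_scale: "a \<noteq> 0 \<Longrightarrow> exponential (l / a) (0 + a * x) = exponential l x"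
  by (simp add: exponential_def mult_ac)

lemma scaled_interval: "a > 0 \<Longrightarrow> {x. 0 + a * x \<in> {0..<a}} = {0..<1::real}"
  by (auto simp: zero_le_mult_iff)

lemma energy_scaled_exponentials:
  assumes "a > 0" "finite G"
  shows "energy {0..<a} (\<lambda>x. \<Sum>n\<in>G. c n * exponential (of_int n / a) x) = a * (\<Sum>n\<in>G. (cmod (c n))\<^sup>2)"
proof -
  have "energy {0..<a} (\<lambda>x. \<Sum>n\<in>G. c n * exponential (of_int n / a) x)
      = \<bar>a\<bar> * energy {x. 0 + a * x \<in> {0..<a}} (\<lambda>x. \<Sum>n\<in>G. c n * exponential (of_int n / a) (0 + a * x))"
    using assms by (intro energy_affine) simp
  also have "\<dots> = \<bar>a\<bar> * energy {0..<1} (trig_poly G c)"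
    using assms(1) unfolding scaled_interval[OF assms(1)] trig_poly_def
    by (subst exponential_scale) auto
  finally show ?thesis using assms by (simp add: parseval)
qed

text \<open>Cauchy-Schwarz with each weight split into two square roots, so that the total weight
  and not the number of terms enters.\<close>

lemma weighted_norm_sum_square_le:
  assumes "\<And>k. k \<in> I \<Longrightarrow> 0 \<le> w k" "\<And>k. k \<in> I \<Longrightarrow> cmod (v k) \<le> w k"
  shows "(cmod (\<Sum>k\<in>I. v k * y k))\<^sup>2 \<le> (\<Sum>k\<in>I. w k) * (\<Sum>k\<in>I. w k * (cmod (y k))\<^sup>2)"
proof -
  have "cmod (\<Sum>k\<in>I. v k * y k) \<le> (\<Sum>k\<in>I. sqrt (w k) * (sqrt (w k) * cmod (y k)))"
  proof (rule order_trans[OF norm_sum], rule sum_mono)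
    fix k assume k: "k \<in> I"
    have "cmod (v k * y k) \<le> w k * cmod (y k)"
      using assms(2)[OF k] by (simp add: norm_mult mult_right_mono)
    also have "\<dots> = sqrt (w k) * (sqrt (w k) * cmod (y k))"
      using assms(1)[OF k] by (simp flip: mult.assoc)
    finally show "cmod (v k * y k) \<le> sqrt (w k) * (sqrt (w k) * cmod (y k))" .
  qed
  then have "(cmod (\<Sum>k\<in>I. v k * y k))\<^sup>2 \<le> (\<Sum>k\<in>I. sqrt (w k) * (sqrt (w k) * cmod (y k)))\<^sup>2"
    by (intro power_mono) auto
  also have "\<dots> \<le> (\<Sum>k\<in>I. (sqrt (w k))\<^sup>2) * (\<Sum>k\<in>I. (sqrt (w k) * cmod (y k))\<^sup>2)"
    by (rule Cauchy_Schwarz_ineq_sum)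
  also have "\<dots> = (\<Sum>k\<in>I. w k) * (\<Sum>k\<in>I. w k * (cmod (y k))\<^sup>2)"
    using assms(1) by (intro arg_cong2[where f = "(*)"] sum.cong) (auto simp: power_mult_distrib)
  finally show ?thesis .
qed

text \<open>
  Expanding \<open>e(-\<delta> x) - 1\<close> in powers of \<open>\<delta> x\<close> decouples the frequency from \<open>x\<close>; each Taylor term is
  then estimated by orthogonality of the \<open>e(n x / a)\<close> on an interval of length \<open>a\<close>.
\<close>

lemma perturbation_energy_le:
  assumes a: "a > 0" and G: "finite G" and \<delta>: "\<And>n. n \<in> G \<Longrightarrow> 0 \<le> \<delta> n \<and> \<delta> n \<le> 1"
    and W: "exp (2 * pi * a) - 1 \<le> W"
  shows "energy {0..<a} (\<lambda>x. \<Sum>n\<in>G. c n * (exponential (- \<delta> n) x - 1) * exponential (of_int n / a) x)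
     \<le> 2 * W\<^sup>2 * a * (\<Sum>n\<in>G. (cmod (c n))\<^sup>2)"
    (is "energy _ ?D \<le> _")
proof -
  define S where "S = (\<Sum>n\<in>G. (cmod (c n))\<^sup>2)"
  \<comment> \<open>\<open>w k\<close> bounds the Taylor factor \<open>v k\<close> on the window,
    and its sum over positive \<open>k\<close> is at most \<open>W\<close>; the estimate is
    therefore uniform in the truncation \<open>K\<close>.\<close>
  define w where "w = (\<lambda>k::nat. (2 * pi * a) ^ k / fact k)"
  have w0: "w k \<ge> 0" for k using a by (simp add: w_def)
  define g where "g = (\<lambda>k x. \<Sum>n\<in>G. (c n * of_real (\<delta> n ^ k)) * exponential (of_int n / a) x)"
  define v where "v = (\<lambda>k x. (- (2 * pi * \<i> * complex_of_real x)) ^ k / fact k)"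
  define T where "T = (\<lambda>K x. \<Sum>k\<in>{1..K}. v k x * g k x)"
  have cont_g: "continuous_on UNIV (g k)" for k
    unfolding g_def by (intro continuous_intros)
  have cont_T: "continuous_on UNIV (T K)" for K
    unfolding T_def v_def by (intro continuous_intros continuous_on_subset[OF cont_g]) auto
  have cont_D: "continuous_on UNIV ?D" by (intro continuous_intros)
  have sum_w: "(\<Sum>k\<in>{1..K}. w k) \<le> W" for K
  proof -
    have sums: "w sums exp (2 * pi * a)"
      using exp_converges[of "2 * pi * a"] by (simp add: w_def field_simps)
    have "(\<Sum>k<Suc K. w k) \<le> exp (2 * pi * a)"
      using sums w0 sum_le_suminf[of w "{..<Suc K}"] by (simp add: sums_iff)
    moreover have "(\<Sum>k<Suc K. w k) = w 0 + (\<Sum>k\<in>{1..K}. w k)"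
      by (simp add: lessThan_Suc_atMost atMost_atLeast0 sum.atLeast_Suc_atMost)
    ultimately show ?thesis using W by (simp add: w_def)
  qed
  have W0: "W \<ge> 0" using sum_w[of 0] by simp
  have energy_g: "energy {0..<a} (g k) \<le> a * S" for k
  proof -
    have "energy {0..<a} (g k) = a * (\<Sum>n\<in>G. (cmod (c n * of_real (\<delta> n ^ k)))\<^sup>2)"
      unfolding g_def by (rule energy_scaled_exponentials[OF a G])
    also have "\<dots> \<le> a * S"
      unfolding S_def
    proof (intro mult_left_mono sum_mono)
      fix n assume n: "n \<in> G"
      have "\<bar>\<delta> n ^ k\<bar> \<le> 1" using \<delta>[OF n] by (simp add: power_le_one power_abs)
      then have "cmod (c n * of_real (\<delta> n ^ k)) \<le> cmod (c n) * 1"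
        unfolding norm_mult norm_of_real by (intro mult_left_mono) auto
      then show "(cmod (c n * of_real (\<delta> n ^ k)))\<^sup>2 \<le> (cmod (c n))\<^sup>2" by (intro power_mono) auto
    qed (use a in auto)
    finally show ?thesis .
  qed
  have energy_T: "energy {0..<a} (T K) \<le> W\<^sup>2 * a * S" for K
  proof -
    have "energy {0..<a} (T K) \<le> (\<Sum>k\<in>{1..K}. (W * w k) * energy {0..<a} (g k))"
    proof (rule energy_le_sum)
      fix x assume x: "x \<in> {0..<a}"
      have "cmod (v k x) \<le> w k" for k
        using x by (simp add: v_def w_def norm_divide norm_power norm_mult divide_right_mono power_mono)
      then have "(cmod (T K x))\<^sup>2 \<le> (\<Sum>k\<in>{1..K}. w k) * (\<Sum>k\<in>{1..K}. w k * (cmod (g k x))\<^sup>2)"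
        unfolding T_def by (intro weighted_norm_sum_square_le w0)
      also have "\<dots> \<le> W * (\<Sum>k\<in>{1..K}. w k * (cmod (g k x))\<^sup>2)"
        using sum_w w0 by (intro mult_right_mono sum_nonneg) auto
      finally show "(cmod (T K x))\<^sup>2 \<le> (\<Sum>k\<in>{1..K}. W * w k * (cmod (g k x))\<^sup>2)"
        by (simp add: sum_distrib_left mult.assoc)
    qed (auto intro: cont_g cont_T)
    also have "\<dots> \<le> (\<Sum>k\<in>{1..K}. (W * w k) * (a * S))"
      using energy_g w0 W0 by (intro sum_mono mult_left_mono mult_nonneg_nonneg) auto
    also have "\<dots> = (\<Sum>k\<in>{1..K}. w k) * (W * (a * S))"
      unfolding sum_distrib_right by (intro sum.cong refl) (simp only: mult_ac)
    also have "\<dots> \<le> W * (W * (a * S))"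
      using sum_w W0 a by (intro mult_right_mono mult_nonneg_nonneg) (auto simp: S_def sum_nonneg)
    finally show ?thesis by (simp add: power2_eq_square mult_ac)
  qed
  \<comment> \<open>A crude pointwise remainder. Its dependence on the sum of the
    \<open>cmod (c n)\<close> is harmless, as \<open>G\<close> stays fixed while \<open>K\<close>
    tends to infinity.\<close>
  define \<rho> where "\<rho> = (\<lambda>K. (\<Sum>n\<in>G. cmod (c n)) * ((2 * pi * a) ^ Suc K / fact K))"
  have approx: "cmod (?D x - T K x) \<le> \<rho> K" if x: "x \<in> {0..<a}" for x K
  proof -
    define z where "z = (\<lambda>n. - (2 * pi * \<i> * complex_of_real x) * of_real (\<delta> n))"
    have exp_z: "exponential (- \<delta> n) x = exp (z n)" for n
      by (simp add: exponential_def z_def mult_ac)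
    have zk: "z n ^ k = (- (2 * pi * \<i> * complex_of_real x)) ^ k * of_real (\<delta> n ^ k)" for n k
      unfolding z_def power_mult_distrib of_real_power ..
    have vg: "v k x * g k x = (\<Sum>n\<in>G. c n * (z n ^ k / fact k) * exponential (of_int n / a) x)" for k
      unfolding g_def sum_distrib_left zk by (intro sum.cong refl) (simp only: v_def times_divide_eq_left times_divide_eq_right mult_ac)
    have T: "T K x = (\<Sum>n\<in>G. c n * (\<Sum>k\<in>{1..K}. z n ^ k / fact k) * exponential (of_int n / a) x)"
      unfolding T_def vg by (subst sum.swap) (simp only: sum_distrib_left sum_distrib_right)
    have "(\<Sum>k\<le>K. z n ^ k / fact k) = 1 + (\<Sum>k\<in>{1..K}. z n ^ k / fact k)" for n
      by (simp add: atMost_atLeast0 sum.atLeast_Suc_atMost)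
    then have "?D x - T K x = (\<Sum>n\<in>G. c n * (exp (z n) - (\<Sum>k\<le>K. z n ^ k / fact k)) * exponential (of_int n / a) x)"
      unfolding T exp_z by (simp add: sum_subtractf[symmetric] algebra_simps)
    also have "cmod \<dots> \<le> (\<Sum>n\<in>G. cmod (c n) * ((2 * pi * a) ^ Suc K / fact K))"
    proof (rule order_trans[OF norm_sum], rule sum_mono)
      fix n assume n: "n \<in> G"
      have "cmod (z n) \<le> 2 * pi * a"
      proof -
        have "x * \<delta> n \<le> a * 1" using x \<delta>[OF n] by (intro mult_mono) auto
        then show ?thesis using x \<delta>[OF n] by (simp add: z_def norm_mult mult.assoc)
      qed
      moreover have "cmod (exp (z n) - (\<Sum>k\<le>K. z n ^ k / fact k)) \<le> exp \<bar>Re (z n)\<bar> * (cmod (z n)) ^ Suc K / fact K"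
        by (rule Taylor_exp)
      moreover have "Re (z n) = 0" by (simp add: z_def)
      ultimately have "cmod (exp (z n) - (\<Sum>k\<le>K. z n ^ k / fact k)) \<le> (2 * pi * a) ^ Suc K / fact K"
        by (simp del: power_Suc add: order_trans[OF _ divide_right_mono[OF power_mono]])
      then show "cmod (c n * (exp (z n) - (\<Sum>k\<le>K. z n ^ k / fact k)) * exponential (of_int n / a) x)
          \<le> cmod (c n) * ((2 * pi * a) ^ Suc K / fact K)"
        unfolding norm_mult norm_exponential mult_1_right by (rule mult_left_mono) simp
    qed
    finally show ?thesis unfolding \<rho>_def sum_distrib_right .
  qed
  have "energy {0..<a} ?D \<le> 2 * (W\<^sup>2 * a * S) + 2 * (\<rho> K)\<^sup>2 * a" for K
  proof -
    have "energy {0..<a} ?D \<le> 2 * energy {0..<a} (T K) + 2 * (\<rho> K)\<^sup>2 * energy {0..<a} (\<lambda>_. 1)"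
    proof (rule energy_le_two)
      fix x assume x: "x \<in> {0..<a}"
      have "(cmod (T K x + (?D x - T K x)))\<^sup>2 \<le> (1 + 1) * (cmod (T K x))\<^sup>2 + (1 + 1 / 1) * (cmod (?D x - T K x))\<^sup>2"
        by (rule norm_add_square_le) simp
      moreover have "(cmod (?D x - T K x))\<^sup>2 \<le> (\<rho> K)\<^sup>2"
        using approx[OF x] by (intro power_mono) auto
      ultimately show "(cmod (?D x))\<^sup>2 \<le> 2 * (cmod (T K x))\<^sup>2 + 2 * (\<rho> K)\<^sup>2 * (cmod 1)\<^sup>2"
        by simp
    qed (auto intro: cont_T cont_D)
    also have "energy {0..<a} (\<lambda>_. 1) = a"
      using a by (simp add: energy_def set_lebesgue_integral_def)
    finally show ?thesis using energy_T[of K] by simp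
  qed
  moreover have "(\<lambda>K. 2 * (W\<^sup>2 * a * S) + 2 * (\<rho> K)\<^sup>2 * a) \<longlonglongrightarrow> 2 * (W\<^sup>2 * a * S) + 2 * 0\<^sup>2 * a"
  proof (intro tendsto_intros)
    have "(\<lambda>K. (2 * pi * a) ^ K / fact K) \<longlonglongrightarrow> 0"
      using summable_LIMSEQ_zero[OF summable_exp[of "2 * pi * a"]] by (simp add: divide_inverse mult.commute)
    then have "(\<lambda>K. (\<Sum>n\<in>G. cmod (c n)) * (2 * pi * a) * ((2 * pi * a) ^ K / fact K)) \<longlonglongrightarrow> 0"
      by (rule tendsto_mult_right_zero)
    then show "\<rho> \<longlonglongrightarrow> 0" by (simp add: \<rho>_def mult_ac)
  qed
  ultimately have "energy {0..<a} ?D \<le> 2 * (W\<^sup>2 * a * S) + 2 * 0\<^sup>2 * a"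
    by (intro LIMSEQ_le_const) auto
  then show ?thesis by (simp add: S_def mult_ac)
qed

section \<open>Frequencies rounded to integers\<close>

definition arc_freqs :: "real \<Rightarrow> int set" where
  "arc_freqs a = range (\<lambda>n::int. \<lfloor>of_int n / a\<rfloor>)"

lemma inj_arc_freqs:
  fixes a :: real
  assumes "0 < a" "a < 1"
  shows "inj (\<lambda>n::int. \<lfloor>of_int n / a\<rfloor>)"
proof (rule strict_mono_imp_inj_on, rule strict_monoI)
  fix m n :: int assume "m < n"
  then have "of_int m + 1 \<le> real_of_int n" by linarith
  then have "(of_int m + 1) / a \<le> of_int n / a" using assms by (simp add: divide_right_mono)
  moreover have "1 / a > 1" using assms by simp
  ultimately have "of_int m / a + 1 \<le> of_int n / a" unfolding add_divide_distrib by linarith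
  then show "\<lfloor>of_int m / a\<rfloor> < \<lfloor>of_int n / a\<rfloor>" by linarith
qed

text \<open>The threshold 1/40 originates here: it gives \<open>2 * pi * a \<le> 1 / 5\<close>, so
  \<open>W = 1 / 4\<close> is admissible and the relative error is twice the square of
  \<open>W\<close>, that is 1/8.\<close>

lemma arc_freqs_perturbation:
  assumes a: "0 < a" "a \<le> 1 / 40" and G: "finite G"
  shows "energy {0..<a} (\<lambda>x. (\<Sum>n\<in>G. c n * exponential (of_int \<lfloor>of_int n / a\<rfloor>) x)
           - (\<Sum>n\<in>G. c n * exponential (of_int n / a) x)) \<le> a / 8 * (\<Sum>n\<in>G. (cmod (c n))\<^sup>2)"
proof -
  let ?\<delta> = "\<lambda>n::int. frac (of_int n / a)"
  have "exponential (of_int \<lfloor>of_int n / a\<rfloor>) x = exponential (- ?\<delta> n) x * exponential (of_int n / a) x" for n :: int and x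
    by (simp add: frac_def flip: exponential_add)
  then have eq: "(\<Sum>n\<in>G. c n * exponential (of_int \<lfloor>of_int n / a\<rfloor>) x) - (\<Sum>n\<in>G. c n * exponential (of_int n / a) x)
      = (\<Sum>n\<in>G. c n * (exponential (- ?\<delta> n) x - 1) * exponential (of_int n / a) x)" for x
    by (simp add: sum_subtractf[symmetric] algebra_simps)
  have "2 * pi * a \<le> 2 * 4 * (1 / 40)"
    using a pi_less_4 by (intro mult_mono) auto
  then have t: "2 * pi * a \<le> 1 / 5" "0 \<le> 2 * pi * a" using a by auto
  have "exp (2 * pi * a) - 1 \<le> 2 * pi * a + (2 * pi * a)\<^sup>2"
    using exp_bound[of "2 * pi * a"] t by simp
  also have "(2 * pi * a)\<^sup>2 \<le> (1 / 5)\<^sup>2" using t by (intro power_mono) auto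
  finally have "exp (2 * pi * a) - 1 \<le> 1 / 4" using t by (simp add: power2_eq_square)
  from perturbation_energy_le[OF a(1) G _ this, of ?\<delta> c] show ?thesis
    unfolding eq by (simp add: frac_ge_0 less_imp_le[OF frac_lt_1] power2_eq_square)
qed

text \<open>The unrounded system is orthogonal with energy \<open>a\<close> per unit coefficient;
  the perturbation, doubled by the triangle inequality, removes only a quarter of it.\<close>

lemma arc_lower_bound:
  assumes a: "0 < a" "a \<le> 1 / 40" and F: "finite F" "F \<subseteq> arc_freqs a"
  shows "a / 4 * (\<Sum>k\<in>F. (cmod (b k))\<^sup>2) \<le> energy {0..<a} (trig_poly F b)"
proof -
  let ?l = "\<lambda>n::int. \<lfloor>of_int n / a\<rfloor>"
  have inj: "inj ?l" using a by (intro inj_arc_freqs) auto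
  define G where "G = ?l -` F"
  have G: "finite G" "F = ?l ` G"
    unfolding G_def using F inj by (auto simp: arc_freqs_def intro: finite_vimageI)
  have injG: "inj_on ?l G" using inj by (rule inj_on_subset) simp
  define c where "c = (\<lambda>n. b (?l n))"
  define q where "q = (\<lambda>x. \<Sum>n\<in>G. c n * exponential (of_int n / a) x)"
  define Q where "Q = (\<lambda>x. \<Sum>n\<in>G. c n * exponential (of_int (?l n)) x)"
  have Q: "trig_poly F b = Q"
    unfolding trig_poly_def Q_def G(2) sum.reindex[OF injG] by (simp add: c_def fun_eq_iff)
  have S: "(\<Sum>k\<in>F. (cmod (b k))\<^sup>2) = (\<Sum>n\<in>G. (cmod (c n))\<^sup>2)"
    unfolding G(2) sum.reindex[OF injG] by (simp add: c_def)
  have cont: "continuous_on UNIV q" "continuous_on UNIV Q"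
    unfolding q_def Q_def by (intro continuous_intros)+
  have "energy {0..<a} q \<le> 2 * energy {0..<a} Q + 2 * energy {0..<a} (\<lambda>x. Q x - q x)"
  proof (rule energy_le_two)
    show "(cmod (q x))\<^sup>2 \<le> 2 * (cmod (Q x))\<^sup>2 + 2 * (cmod (Q x - q x))\<^sup>2" for x
      using norm_add_square_le[of 1 "Q x" "- (Q x - q x)"] by (simp add: norm_minus_commute)
  qed (use cont in \<open>auto intro!: continuous_intros\<close>)
  moreover have "energy {0..<a} (\<lambda>x. Q x - q x) \<le> a / 8 * (\<Sum>n\<in>G. (cmod (c n))\<^sup>2)"
    unfolding Q_def q_def by (rule arc_freqs_perturbation[OF a G(1)])
  moreover have "energy {0..<a} q = a * (\<Sum>n\<in>G. (cmod (c n))\<^sup>2)"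
    unfolding q_def by (rule energy_scaled_exponentials[OF a(1) G(1)])
  ultimately have "3 / 8 * (a * (\<Sum>n\<in>G. (cmod (c n))\<^sup>2)) \<le> energy {0..<a} Q" by simp
  moreover have "0 \<le> a * (\<Sum>n\<in>G. (cmod (c n))\<^sup>2)" using a by (simp add: sum_nonneg)
  ultimately show ?thesis unfolding Q S by simp
qed

text \<open>
  A trigonometric polynomial \<open>p\<close> without frequencies in \<open>arc_freqs a\<close> cannot concentrate on the arc:
  there it is close to some \<open>q\<close> with frequencies \<open>n / a\<close>, hence close to a \<open>Q\<close> with frequencies in
  \<open>arc_freqs a\<close>, but \<open>Q\<close> is orthogonal to \<open>p\<close> on the whole circle.
\<close>

lemma arc_complement_lower_bound:
  assumes a: "0 < a" "a \<le> 1 / 40" and F: "finite F" "F \<subseteq> - arc_freqs a"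
  shows "(\<Sum>k\<in>F. (cmod (b k))\<^sup>2) \<le> (1 + 32 / a) * energy {a..<1} (trig_poly F b)"
proof -
  let ?l = "\<lambda>n::int. \<lfloor>of_int n / a\<rfloor>"
  have inj: "inj ?l" using a by (intro inj_arc_freqs) auto
  define p where "p = trig_poly F b"
  have cont_p: "continuous_on UNIV p" unfolding p_def by (intro continuous_intros)
  have split: "energy {0..<1} f = energy {0..<a} f + energy {a..<1} f" if "continuous_on UNIV f" for f
  proof -
    have "{0..<1} = {0..<a} \<union> {a..<1}" using a by auto
    then show ?thesis using that energy_Un[of f "{0..<a}" "{a..<1}"] by simp
  qed
  define X where "X = (\<Sum>k\<in>F. (cmod (b k))\<^sup>2)"
  have X: "X = energy {0..<a} p + energy {a..<1} p"
    using split[OF cont_p] parseval[OF F(1), of b] by (simp add: X_def p_def)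
  \<comment> \<open>On the arc \<open>p\<close> is in general only a limit of finite sums with
    frequencies \<open>n / a\<close>; the slack \<open>\<epsilon>\<close> accounts for this and is
    removed at the end.\<close>
  have bound: "energy {0..<a} p \<le> 11 * \<epsilon> + 32 / a * energy {a..<1} p" if \<epsilon>: "\<epsilon> > 0" for \<epsilon>
  proof -
    have "continuous_on UNIV (\<lambda>t. p (a * t))"
      unfolding p_def by (intro continuous_intros)
    then have "sq_int (\<lambda>t. p (a * t))" by (rule sq_int_continuous)
    then obtain G \<alpha> where G: "finite G" "energy {0..<1} (\<lambda>t. p (a * t) - trig_poly G \<alpha> t) < \<epsilon> / a"
      using \<epsilon> a by (elim trig_poly_dense[of _ "\<epsilon> / a"]) auto
    define q where "q = (\<lambda>x. \<Sum>n\<in>G. \<alpha> n * exponential (of_int n / a) x)"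
    define Q where "Q = (\<lambda>x. \<Sum>n\<in>G. \<alpha> n * exponential (of_int (?l n)) x)"
    define S where "S = (\<Sum>n\<in>G. (cmod (\<alpha> n))\<^sup>2)"
    have cont: "continuous_on UNIV q" "continuous_on UNIV Q"
      unfolding q_def Q_def by (intro continuous_intros)+
    have pq: "energy {0..<a} (\<lambda>x. p x - q x) \<le> \<epsilon>"
    proof -
      have "energy {0..<a} (\<lambda>x. p x - q x)
          = \<bar>a\<bar> * energy {x. 0 + a * x \<in> {0..<a}} (\<lambda>t. p (0 + a * t) - q (0 + a * t))"
        using a by (intro energy_affine) simp
      moreover have "q (0 + a * t) = trig_poly G \<alpha> t" for t
        unfolding q_def trig_poly_def using a by (subst exponential_scale) auto
      ultimately have "energy {0..<a} (\<lambda>x. p x - q x) = a * energy {0..<1} (\<lambda>t. p (a * t) - trig_poly G \<alpha> t)"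
        unfolding scaled_interval[OF a(1)] using a by simp
      then show ?thesis using G(2) a by (simp add: field_simps)
    qed
    have qQ: "energy {0..<a} (\<lambda>x. Q x - q x) \<le> a / 8 * S"
      unfolding Q_def q_def S_def by (rule arc_freqs_perturbation[OF a G(1)])
    have q: "energy {0..<a} q = a * S"
      unfolding q_def S_def by (rule energy_scaled_exponentials[OF a(1) G(1)])
    have injG: "inj_on ?l G" using inj by (rule inj_on_subset) simp
    define \<beta> where "\<beta> = (\<lambda>k. \<alpha> (the_inv ?l k))"
    have \<beta>: "\<beta> (?l n) = \<alpha> n" for n using the_inv_f_f[OF inj, of n] by (simp add: \<beta>_def)
    have Q_poly: "Q = trig_poly (?l ` G) \<beta>"
      unfolding trig_poly_def Q_def sum.reindex[OF injG] by (simp add: \<beta> fun_eq_iff)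
    have S_\<beta>: "S = (\<Sum>k\<in>?l ` G. (cmod (\<beta> k))\<^sup>2)"
      unfolding S_def sum.reindex[OF injG] by (simp add: \<beta>)
    have Q: "energy {0..<1} Q = S"
      unfolding Q_poly S_\<beta> using G by (intro parseval) auto
    have disj: "F \<inter> ?l ` G = {}" using F(2) by (auto simp: arc_freqs_def)
    have total: "energy {0..<1} (\<lambda>x. p x - Q x) = X + S"
    proof -
      define d where "d = (\<lambda>k. if k \<in> F then b k else - \<beta> k)"
      have fin: "finite (?l ` G)" using G(1) by simp
      have d: "d k = b k" if "k \<in> F" for k using that by (simp add: d_def)
      have d': "d k = - \<beta> k" if "k \<in> ?l ` G" for k using that disj by (auto simp: d_def)
      have "trig_poly (F \<union> ?l ` G) d x = trig_poly F d x + trig_poly (?l ` G) d x" for x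
        unfolding trig_poly_def by (rule sum.union_disjoint[OF F(1) fin disj])
      moreover have "trig_poly F d x = p x" for x
        unfolding p_def trig_poly_def by (intro sum.cong) (simp_all add: d)
      moreover have "trig_poly (?l ` G) d x = - Q x" for x
        unfolding Q_poly trig_poly_def sum_negf[symmetric]
        by (intro sum.cong refl) (simp only: d' mult_minus_left)
      ultimately have "energy {0..<1} (\<lambda>x. p x - Q x) = energy {0..<1} (trig_poly (F \<union> ?l ` G) d)"
        by (intro energy_cong) simp
      also have "\<dots> = (\<Sum>k\<in>F \<union> ?l ` G. (cmod (d k))\<^sup>2)"
        using F(1) fin by (intro parseval) auto
      also have "\<dots> = (\<Sum>k\<in>F. (cmod (d k))\<^sup>2) + (\<Sum>k\<in>?l ` G. (cmod (d k))\<^sup>2)"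
        by (rule sum.union_disjoint[OF F(1) fin disj])
      also have "\<dots> = X + S"
        unfolding X_def S_\<beta>
        by (intro arg_cong2[where f = "(+)"] sum.cong refl) (simp_all only: d d' norm_minus_cancel)
      finally show ?thesis .
    qed
    have on_arc: "energy {0..<a} (\<lambda>x. p x - Q x) \<le> 2 * \<epsilon> + a * S / 4"
    proof -
      have "energy {0..<a} (\<lambda>x. p x - Q x)
          \<le> 2 * energy {0..<a} (\<lambda>x. p x - q x) + 2 * energy {0..<a} (\<lambda>x. Q x - q x)"
      proof (rule energy_le_two)
        show "(cmod (p x - Q x))\<^sup>2 \<le> 2 * (cmod (p x - q x))\<^sup>2 + 2 * (cmod (Q x - q x))\<^sup>2" for x
          using norm_add_square_le[of 1 "p x - q x" "- (Q x - q x)"] by (simp add: norm_minus_commute)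
      qed (use cont cont_p in \<open>auto intro!: continuous_intros\<close>)
      then show ?thesis using pq qQ by simp
    qed
    \<comment> \<open>\<open>Q\<close> enters both sides of the final comparison with energy
      \<open>S\<close>, so its factor may exceed 1 only slightly. The weight \<open>8 / a\<close>
      leaves an excess \<open>a * S / 8\<close>, which together with the \<open>a * S / 4\<close>
      from the arc is \<open>3 / 8 * (a * S)\<close>.\<close>
    have off_arc: "energy {a..<1} (\<lambda>x. p x - Q x) \<le> (1 + 8 / a) * energy {a..<1} p + (1 + a / 8) * energy {a..<1} Q"
    proof (rule energy_le_two)
      show "(cmod (p x - Q x))\<^sup>2 \<le> (1 + 8 / a) * (cmod (p x))\<^sup>2 + (1 + a / 8) * (cmod (Q x))\<^sup>2" for x
        using norm_add_square_le[of "8 / a" "p x" "- Q x"] a by simp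
    qed (use cont cont_p in \<open>auto intro!: continuous_intros\<close>)
    have q_p: "a * S \<le> 2 * energy {0..<a} p + 2 * \<epsilon>"
    proof -
      have "energy {0..<a} q \<le> 2 * energy {0..<a} p + 2 * energy {0..<a} (\<lambda>x. p x - q x)"
      proof (rule energy_le_two)
        show "(cmod (q x))\<^sup>2 \<le> 2 * (cmod (p x))\<^sup>2 + 2 * (cmod (p x - q x))\<^sup>2" for x
          using norm_add_square_le[of 1 "p x" "- (p x - q x)"] by (simp add: norm_minus_commute)
      qed (use cont cont_p in \<open>auto intro!: continuous_intros\<close>)
      then show ?thesis using pq q by simp
    qed
    have EQ: "energy {a..<1} Q \<le> S" using split[OF cont(2)] Q by simp
    have "X + S = energy {0..<a} (\<lambda>x. p x - Q x) + energy {a..<1} (\<lambda>x. p x - Q x)"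
      using total split[of "\<lambda>x. p x - Q x"] cont cont_p by (simp add: continuous_intros)
    also have "\<dots> \<le> 2 * \<epsilon> + a * S / 4 + ((1 + 8 / a) * energy {a..<1} p + (1 + a / 8) * S)"
    proof -
      have "(1 + a / 8) * energy {a..<1} Q \<le> (1 + a / 8) * S"
        using EQ a by (intro mult_left_mono) auto
      then show ?thesis using on_arc off_arc by linarith
    qed
    finally have "X \<le> 2 * \<epsilon> + 3 / 8 * (a * S) + (1 + 8 / a) * energy {a..<1} p"
      by (simp add: algebra_simps)
    then have "energy {0..<a} p \<le> 2 * \<epsilon> + 3 / 8 * (a * S) + 8 / a * energy {a..<1} p"
      using X by (simp add: algebra_simps)
    \<comment> \<open>By \<open>q_p\<close> the term with \<open>a * S\<close> is at most three
      quarters of the left side plus \<open>3 / 4 * \<epsilon>\<close>. Multiplying what remains by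
      4 gives the constants 11 and 32.\<close>
    then show ?thesis using q_p by (simp add: algebra_simps)
  qed
  have "energy {0..<a} p \<le> 32 / a * energy {a..<1} p"
  proof (rule field_le_epsilon)
    fix e :: real assume "e > 0"
    then show "energy {0..<a} p \<le> 32 / a * energy {a..<1} p + e"
      using bound[of "e / 11"] by simp
  qed
  then show ?thesis using X unfolding X_def p_def by (simp add: algebra_simps)
qed

section \<open>Arcs in arbitrary position\<close>

lemma trig_poly_shift_window:
  "energy {u + s..<v + s} (trig_poly F b) = energy {u..<v} (trig_poly F (\<lambda>k. b k * exponential (of_int k) s))"
  unfolding energy_translate trig_poly_translate ..

text \<open>Translation multiplies each coefficient by a number of modulus 1. The second window may
  leave \<open>{0..<1}\<close>; periodicity brings it back when it is used.\<close>

lemma riesz_lower_short_window: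
  assumes a: "0 < a" "a \<le> 1 / 40"
  shows "riesz_lower {u..<u + a} (arc_freqs a)" "riesz_lower {u + a..<u + 1} (- arc_freqs a)"
proof -
  have norm: "(\<Sum>k\<in>F. (cmod (b k * exponential (of_int k) u))\<^sup>2) = (\<Sum>k\<in>F. (cmod (b k))\<^sup>2)" for F and b :: "int \<Rightarrow> complex"
    by (simp add: norm_mult)
  show "riesz_lower {u..<u + a} (arc_freqs a)"
    unfolding riesz_lower_def
  proof (intro exI[of _ "a / 4"] conjI allI impI)
    fix F :: "int set" and b :: "int \<Rightarrow> complex" assume F: "finite F" "F \<subseteq> arc_freqs a"
    from arc_lower_bound[OF a F, of "\<lambda>k. b k * exponential (of_int k) u"]
    have "a / 4 * (\<Sum>k\<in>F. (cmod (b k))\<^sup>2) \<le> energy {0..<a} (trig_poly F (\<lambda>k. b k * exponential (of_int k) u))"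
      by (simp only: norm)
    also have "\<dots> = energy {u..<u + a} (trig_poly F b)"
      using trig_poly_shift_window[of 0 u a F b] by (simp add: add.commute)
    finally show "a / 4 * (\<Sum>k\<in>F. (cmod (b k))\<^sup>2) \<le> energy {u..<u + a} (trig_poly F b)" .
  qed (use a in simp)
  have pos: "1 + 32 / a > 0" using a by (simp add: add_pos_pos)
  show "riesz_lower {u + a..<u + 1} (- arc_freqs a)"
    unfolding riesz_lower_def
  proof (intro exI[of _ "1 / (1 + 32 / a)"] conjI allI impI)
    fix F :: "int set" and b :: "int \<Rightarrow> complex" assume F: "finite F" "F \<subseteq> - arc_freqs a"
    from arc_complement_lower_bound[OF a F, of "\<lambda>k. b k * exponential (of_int k) u"]
    have "(\<Sum>k\<in>F. (cmod (b k))\<^sup>2) \<le> (1 + 32 / a) * energy {a..<1} (trig_poly F (\<lambda>k. b k * exponential (of_int k) u))"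
      by (simp only: norm)
    also have "energy {a..<1} (trig_poly F (\<lambda>k. b k * exponential (of_int k) u)) = energy {u + a..<u + 1} (trig_poly F b)"
      using trig_poly_shift_window[of a u 1 F b] by (simp add: add.commute)
    finally show "1 / (1 + 32 / a) * (\<Sum>k\<in>F. (cmod (b k))\<^sup>2) \<le> energy {u + a..<u + 1} (trig_poly F b)"
      using pos by (simp add: pos_divide_le_eq mult.commute)
  qed (use pos in simp)
qed

lemma riesz_lower_cong:
  assumes "\<And>F b. energy S (trig_poly F b) = energy T (trig_poly F b)"
  shows "riesz_lower S \<Lambda> \<longleftrightarrow> riesz_lower T \<Lambda>"
  unfolding riesz_lower_def assms ..

text \<open>By periodicity the piece left of \<open>s\<close> can be moved behind 1, where it joins
  the piece right of \<open>t\<close> into one window.\<close>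

lemma energy_interval_complement:
  assumes "0 \<le> s" "s < t" "t < 1"
  shows "energy ({0..<1} - {s..<t}) (trig_poly F b) = energy {t..<s + 1} (trig_poly F b)"
proof -
  have cont: "continuous_on UNIV (trig_poly F b)" by (intro continuous_intros)
  have "{0..<1} - {s..<t} = {0..<s} \<union> {t..<1}" using assms by auto
  then have "energy ({0..<1} - {s..<t}) (trig_poly F b) = energy {0..<s} (trig_poly F b) + energy {t..<1} (trig_poly F b)"
    using assms energy_Un[OF cont, of "{0..<s}" "{t..<1}"] by simp
  also have "energy {0..<s} (trig_poly F b) = energy {1..<s + 1} (trig_poly F b)"
    using energy_translate[of 0 1 s "trig_poly F b"] trig_poly_plus_int[of F b _ 1] by simp
  also have "\<dots> + energy {t..<1} (trig_poly F b) = energy {t..<s + 1} (trig_poly F b)"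
  proof -
    have "{t..<s + 1} = {1..<s + 1} \<union> {t..<1}" using assms by auto
    then show ?thesis using assms energy_Un[OF cont, of "{1..<s + 1}" "{t..<1}"] by auto
  qed
  finally show ?thesis .
qed

lemma has_integer_basis_extreme_interval:
  assumes st: "0 \<le> s" "s < t" "t < 1" and len: "t - s \<le> 1 / 40 \<or> t - s \<ge> 39 / 40"
  shows "has_integer_basis {s..<t}"
  using len
proof
  assume len: "t - s \<le> 1 / 40"
  define a where "a = t - s"
  have a: "0 < a" "a \<le> 1 / 40" using st len by (auto simp: a_def)
  have eq: "s + a = t" by (simp add: a_def)
  note bounds = riesz_lower_short_window[OF a, of s, unfolded eq]
  have "riesz_lower ({0..<1} - {s..<t}) (- arc_freqs a)"
    using bounds(2) riesz_lower_cong[OF energy_interval_complement[OF st]] by simp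
  with bounds(1) show ?thesis
    unfolding has_integer_basis_def by (intro exI[of _ "arc_freqs a"] conjI)
next
  assume len: "t - s \<ge> 39 / 40"
  \<comment> \<open>Now the complement is the short arc, running from \<open>t\<close> across 1 to
    \<open>s + 1\<close>, and \<open>arc_freqs a\<close> exchanges roles with its
    complement.\<close>
  define a where "a = s + 1 - t"
  have a: "0 < a" "a \<le> 1 / 40" using st len by (auto simp: a_def)
  have eq: "t + a = s + 1" by (simp add: a_def)
  note bounds = riesz_lower_short_window[OF a, of t, unfolded eq]
  have shift: "energy {s..<t} (trig_poly F b) = energy {s + 1..<t + 1} (trig_poly F b)" for F b
    using energy_translate[of s 1 t "trig_poly F b"] trig_poly_plus_int[of F b _ 1] by simp
  have "riesz_lower {s..<t} (- arc_freqs a)"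
    using bounds(2) riesz_lower_cong[OF shift] by simp
  moreover have "riesz_lower ({0..<1} - {s..<t}) (- (- arc_freqs a))"
    using bounds(1) riesz_lower_cong[OF energy_interval_complement[OF st]] by simp
  ultimately show ?thesis
    unfolding has_integer_basis_def by (intro exI[of _ "- arc_freqs a"] conjI)
qed

subsection \<open>Step sets\<close>

text \<open>The jumps sum to 0, so downward and upward variation agree and at most one jump in each
  direction remains. Whether the up-jump or the down-jump comes first decides between an arc and the
  complement of one.\<close>

lemma step_set_one_jump:
  assumes S: "is_step_set C P J S" and up: "up_variation P J \<le> 1"
  obtains "S = {}" | "S = {0..<1}"
  | s t where "s \<in> P" "t \<in> P" "s < t" "S = {s..<t} \<or> S = {0..<1} - {s..<t}"
proof -
  have P: "finite P" "P \<subseteq> {0..<1}" "(\<Sum>p\<in>P. J p) = 0" "S \<subseteq> {0..<1}"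
    and F: "\<And>x. x \<in> {0..<1} \<Longrightarrow> step_fun C P J x = (if x \<in> S then 1 else 0)"
    using S by (auto simp: is_step_set_def)
  show ?thesis
  proof (cases "up_variation P J \<le> 0")
    case True
    then have "C = (if x \<in> S then 1 else 0)" if "x \<in> {0..<1}" for x
      using F[OF that] up_variation_eq_0[OF P(1,3)] by simp
    then have "S = {} \<or> S = {0..<1}" using P(4) by (smt (verit) subset_antisym subset_eq empty_iff)
    then show ?thesis using that by blast
  next
    case False
    then have up1: "(\<Sum>p\<in>P. max 0 (J p)) = 1" using up by (simp add: up_variation_def)
    have "(\<Sum>p\<in>P. max 0 (- J p)) = (\<Sum>p\<in>P. max 0 (J p)) - (\<Sum>p\<in>P. J p)"
      unfolding sum_subtractf[symmetric] by (intro sum.cong refl) (simp add: max_def)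
    then have down1: "(\<Sum>p\<in>P. max 0 (- J p)) = 1" using up1 P(3) by simp
    have unique: "\<exists>p\<in>P. f p = 1 \<and> (\<forall>q\<in>P - {p}. f q = 0)"
      if f: "\<And>p. f p \<ge> 0" "(\<Sum>p\<in>P. f p) = 1" for f :: "real \<Rightarrow> int"
    proof -
      obtain p where p: "p \<in> P" "f p \<noteq> 0" using f(2) by (metis sum.neutral zero_neq_one)
      then have "f p \<ge> 1" using f(1)[of p] by simp
      moreover have "(\<Sum>q\<in>P. f q) = f p + (\<Sum>q\<in>P - {p}. f q)"
        using P(1) p(1) by (rule sum.remove)
      moreover have "(\<Sum>q\<in>P - {p}. f q) \<ge> 0" using f(1) by (intro sum_nonneg)
      ultimately have "f p = 1" "(\<Sum>q\<in>P - {p}. f q) = 0" using f(2) by auto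
      then have "\<forall>q\<in>P - {p}. f q = 0" using P(1) f(1) by (subst (asm) sum_nonneg_eq_0_iff) auto
      then show ?thesis using p(1) \<open>f p = 1\<close> by blast
    qed
    obtain u where u: "u \<in> P" "max 0 (J u) = 1" "\<forall>q\<in>P - {u}. max 0 (J q) = 0"
      using unique[of "\<lambda>p. max 0 (J p)"] up1 by auto
    obtain d where d: "d \<in> P" "max 0 (- J d) = 1" "\<forall>q\<in>P - {d}. max 0 (- J q) = 0"
      using unique[of "\<lambda>p. max 0 (- J p)"] down1 by auto
    have Ju: "J u = 1" and Jd: "J d = - 1" using u(2) d(2) by (auto simp: max_def split: if_splits)
    have ud: "u \<noteq> d" using Ju Jd by auto
    have J0: "J q = 0" if "q \<in> P" "q \<noteq> u" "q \<noteq> d" for q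
    proof -
      have "max 0 (J q) = 0" "max 0 (- J q) = 0" using that u(3) d(3) by auto
      then show ?thesis by (simp add: max_def split: if_splits)
    qed
    have val: "step_fun C P J x = C - ((if x < u then 1 else 0) - (if x < d then 1 else 0))" for x
    proof -
      have "(\<Sum>q\<in>{q\<in>P. x < q}. J q) = (\<Sum>q\<in>P. if x < q then J q else 0)"
        using P(1) by (rule sum.inter_filter)
      also have "\<dots> = (\<Sum>q\<in>{u, d}. if x < q then J q else 0)"
        using P(1) u(1) d(1) J0 by (intro sum.mono_neutral_right) auto
      also have "\<dots> = (if x < u then 1 else 0) - (if x < d then 1 else 0)"
        using ud Ju Jd by simp
      finally show ?thesis by (simp add: step_fun_def)
    qed
    have u01: "u \<in> {0..<1}" and d01: "d \<in> {0..<1}" using u(1) d(1) P(2) by auto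
    have mem: "x \<in> S \<longleftrightarrow> C - ((if x < u then 1 else 0) - (if x < d then 1 else 0)) = 1"
      "C - ((if x < u then 1 else 0) - (if x < d then 1 else 0)) \<in> {0, 1}" if "x \<in> {0..<1}" for x
      using F[OF that] by (auto simp: val split: if_splits)
    show ?thesis
    proof (cases "u < d")
      case True
      have "C = 0" using mem(2)[OF u01] mem(2)[OF d01] True by auto
      then have "S = {u..<d}" using mem(1) P(4) u01 d01 True by (auto split: if_splits)
      then show ?thesis using that(3)[OF u(1) d(1) True] by blast
    next
      case False
      then have du: "d < u" using ud by simp
      have "C = 1" using mem(2)[OF u01] mem(2)[OF d01] du by auto
      then have "S = {0..<1} - {d..<u}" using mem(1) P(4) u01 d01 du by (auto split: if_splits)
      then show ?thesis using that(3)[OF d(1) u(1) du] by blast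
    qed
  qed
qed

text \<open>Dirichlet's theorem supplies \<open>N\<close> with \<open>N * (t - s)\<close> within
  1/40 of an integer. A level set of this fold is empty, full, or bounded by the fractional parts of
  \<open>N * s\<close> and \<open>N * t\<close>, whose difference is then close to 0 or 1.\<close>

lemma has_integer_basis_interval:
  assumes st: "0 \<le> s" "s < t" "t < 1"
  shows "has_integer_basis {s..<t}"
proof -
  define J :: "real \<Rightarrow> int" where "J = (\<lambda>p. if p = s then 1 else - 1)"
  have P: "finite {s, t}" by simp
  have S: "is_step_set 0 {s, t} J {s..<t}"
    unfolding is_step_set_def
  proof (intro conjI ballI)
    show "(\<Sum>p\<in>{s, t}. J p) = 0" using st by (simp add: J_def)
    fix x :: real assume "x \<in> {0..<1}"
    have "(\<Sum>q\<in>{q\<in>{s, t}. x < q}. J q) = (\<Sum>q\<in>{s, t}. if x < q then J q else 0)"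
      by (rule sum.inter_filter[OF P])
    then show "step_fun 0 {s, t} J x = (if x \<in> {s..<t} then 1 else 0)"
      using st by (auto simp: step_fun_def J_def)
  qed (use st in auto)
  have up: "up_variation {s, t} J = 1" using st by (simp add: up_variation_def J_def)
  obtain q h where q: "0 < q" "\<bar>of_int q * (t - s) - of_int h\<bar> < 1 / real 40"
    by (rule Dirichlet_approx_simult[of 40 1 "\<lambda>_. t - s"]) auto
  define N where "N = nat q"
  have N: "N > 0" "\<bar>real N * (t - s) - of_int h\<bar> < 1 / 40" using q by (auto simp: N_def)
  show ?thesis
  proof (rule has_integer_basis_fold[OF _ _ N(1)])
    fix r
    let ?L = "fold_level N {s..<t} (Suc r)"
    let ?P = "fold_points N {s, t}"
    have upN: "up_variation ?P (compose_jump (level_ind (int (Suc r))) (fold_const N 0 {s, t} J) ?P (fold_jump N {s, t} J)) \<le> 1"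
      using up_variation_level[OF fold_points_props(1)[OF P]] up_variation_fold[OF P, of N J] up
      by (metis order_trans)
    have L01: "?L \<subseteq> {0..<1}" by (auto simp: fold_level_def)
    show "has_integer_basis ?L"
    proof (cases rule: step_set_one_jump[OF is_step_set_fold_level[OF S N(1)] upN])
      case (3 s' t')
      have st': "0 \<le> s'" "t' < 1" using 3 fold_points_props(2)[OF P, of N] by auto
      \<comment> \<open>Since \<open>s' < t'\<close>, the two points cannot come from the same
        endpoint.\<close>
      have "\<exists>k::int. t' - s' = real N * (t - s) + of_int k \<or> t' - s' = - (real N * (t - s)) + of_int k"
      proof -
        have "s' = real N * s - of_int \<lfloor>real N * s\<rfloor> \<or> s' = real N * t - of_int \<lfloor>real N * t\<rfloor>"
          and "t' = real N * s - of_int \<lfloor>real N * s\<rfloor> \<or> t' = real N * t - of_int \<lfloor>real N * t\<rfloor>"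
          using 3(1,2) by (auto simp: fold_points_def frac_def)
        then show ?thesis
          using 3(3)
          by (auto simp: algebra_simps intro: exI[of _ "\<lfloor>real N * s\<rfloor> - \<lfloor>real N * t\<rfloor>"]
              exI[of _ "\<lfloor>real N * t\<rfloor> - \<lfloor>real N * s\<rfloor>"])
      qed
      then obtain m :: int where m: "\<bar>t' - s' - of_int m\<bar> < 1 / 40"
      proof (elim exE disjE)
        fix k :: int assume "t' - s' = real N * (t - s) + of_int k"
        then show ?thesis using that[of "h + k"] N(2) by simp
      next
        fix k :: int assume "t' - s' = - (real N * (t - s)) + of_int k"
        then have "\<bar>t' - s' - of_int (k - h)\<bar> < 1 / 40" using N(2) unfolding of_int_diff by linarith
        then show ?thesis by (rule that)
      qed
      have "real_of_int m > - 1" "real_of_int m < 2" using m 3(3) st' by linarith+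
      then have "m = 0 \<or> m = 1" by linarith
      then have "real_of_int m = 0 \<or> real_of_int m = 1" by auto
      then have "t' - s' \<le> 1 / 40 \<or> t' - s' \<ge> 39 / 40" using m by (elim disjE) linarith+
      then have "has_integer_basis {s'..<t'}"
        using st' 3(3) by (intro has_integer_basis_extreme_interval)
      moreover from this have "has_integer_basis ({0..<1} - {s'..<t'})"
        using st' by (intro has_integer_basis_Compl) auto
      ultimately show ?thesis using 3(4) by auto
    qed auto
  qed (use st in auto)
qed

theorem has_integer_basis_step_set:
  assumes "is_step_set C P J S"
  shows "has_integer_basis S"
  using assms
proof (induction "nat (up_variation P J)" arbitrary: C P J S rule: less_induct)
  case less
  have P: "finite P" "P \<subseteq> {0..<1}" "(\<Sum>p\<in>P. J p) = 0" "S \<subseteq> {0..<1}"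
    using less.prems by (auto simp: is_step_set_def)
  show ?case
  proof (cases "up_variation P J \<le> 1")
    case True
    show ?thesis
    proof (cases rule: step_set_one_jump[OF less.prems True])
      case (3 s t)
      then have st: "0 \<le> s" "t < 1" using P(2) by auto
      then have "has_integer_basis {s..<t}" using 3 by (intro has_integer_basis_interval)
      moreover from this have "has_integer_basis ({0..<1} - {s..<t})"
        using st by (intro has_integer_basis_Compl) auto
      ultimately show ?thesis using 3(4) by auto
    qed auto
  next
    case False
    then have "up_variation P J \<ge> 2" by simp
    from exists_fold_with_gap[OF P(1-3) this] obtain N x y where N: "N > 0"
      and xy: "step_fun (fold_const N C P J) (fold_points N P) (fold_jump N P J) x + 2
       \<le> step_fun (fold_const N C P J) (fold_points N P) (fold_jump N P J) y" by blast
    show ?thesis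
    proof (rule has_integer_basis_fold[OF is_step_set_borel[OF less.prems] P(4) N])
      fix r
      note level = is_step_set_fold_level[OF less.prems N, of "Suc r"]
      have "up_variation (fold_points N P) (compose_jump (level_ind (int (Suc r)))
          (fold_const N C P J) (fold_points N P) (fold_jump N P J))
        < up_variation (fold_points N P) (fold_jump N P J)"
        by (intro up_variation_level_less[OF _ _ xy] fold_points_props sum_fold_jump_zero P)
      also have "\<dots> \<le> up_variation P J" by (rule up_variation_fold[OF P(1)])
      finally have "nat (up_variation (fold_points N P) (compose_jump (level_ind (int (Suc r)))
          (fold_const N C P J) (fold_points N P) (fold_jump N P J))) < nat (up_variation P J)"
        using False by linarith
      from less.hyps[OF this level] show "has_integer_basis (fold_level N S (Suc r))" .
    qed
  qed
qed

subsection \<open>Completeness\<close>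

text \<open>
  The part of a trigonometric polynomial with frequencies outside \<open>\<Lambda>\<close> has a fixed proportion of its
  energy outside \<open>S\<close>, so that dropping it leaves an approximation of \<open>f\<close> on \<open>S\<close> with a relative error
  bounded away from 1.
\<close>

lemma trig_approx_contraction:
  assumes S: "S \<in> sets borel" "S \<subseteq> {0..<1}"
    and c: "0 < c" "c \<le> 1"
    and lower: "\<And>F a. finite F \<Longrightarrow> F \<subseteq> - \<Lambda> \<Longrightarrow>
      c * (\<Sum>k\<in>F. (cmod (a k))\<^sup>2) \<le> energy ({0..<1} - S) (trig_poly F a)"
    and g: "sq_int g" and pos: "energy S g > 0"
  shows "\<exists>F a. finite F \<and> F \<subseteq> \<Lambda> \<and> energy S (\<lambda>x. g x - trig_poly F a x) \<le> (1 - c / 4) * energy S g"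
proof -
  define E where "E = energy S g"
  \<comment> \<open>Small against the gain \<open>c\<close>: the approximation costs the factors
    \<open>1 + \<eta>\<close> and \<open>1 + 2 * \<eta>\<close> and a term \<open>\<eta>\<close>,
    after which \<open>1 - c\<close> has become at most \<open>1 - c / 4\<close>.\<close>
  define \<eta> where "\<eta> = c / 8"
  have \<eta>: "\<eta> > 0" using c by (simp add: \<eta>_def)
  \<comment> \<open>Extension by 0 creates no energy outside \<open>S\<close>, so Parseval bounds
    the coefficients of the approximant in terms of \<open>E\<close> alone.\<close>
  define g0 where "g0 = (\<lambda>x. indicator S x * g x)"
  have gm[measurable]: "g \<in> borel_measurable borel" using g by (simp add: sq_int_def)
  have g0: "sq_int g0"
    by (rule sq_int_dominated(1)[of _ g g 1 0]) (use S g in \<open>auto simp: g0_def indicator_def\<close>)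
  have g0E: "energy {0..<1} g0 = E"
  proof -
    have "indicat_real {0..<1} x *\<^sub>R (cmod (g0 x))\<^sup>2 = indicat_real S x *\<^sub>R (cmod (g x))\<^sup>2" for x
      using S(2) by (auto simp: g0_def indicator_def)
    then show ?thesis by (simp add: E_def energy_def set_lebesgue_integral_def)
  qed
  have "E * (\<eta> / (1 + 1 / \<eta>)) > 0" using pos \<eta> by (simp add: E_def add_pos_pos)
  then obtain H b where H: "finite H"
    "energy {0..<1} (\<lambda>x. g0 x - trig_poly H b x) < E * (\<eta> / (1 + 1 / \<eta>))"
    using trig_poly_dense[OF g0] by metis
  then have small: "(1 + 1 / \<eta>) * energy {0..<1} (\<lambda>x. g0 x - trig_poly H b x) \<le> E * \<eta>"
    using \<eta> by (simp add: field_simps add_pos_pos)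
  have tp: "sq_int (trig_poly F a)" for F a by (intro sq_int_continuous continuous_intros)
  have cont: "continuous_on UNIV (trig_poly F a)" for F a by (intro continuous_intros)
  define R where "R = trig_poly (H - \<Lambda>) b"
  have split: "trig_poly H b x = trig_poly (H \<inter> \<Lambda>) b x + R x" for x
    unfolding R_def trig_poly_def using sum.Int_Diff[OF H(1)] by blast
  have norm_H: "energy {0..<1} (trig_poly H b) \<le> (1 + \<eta>) * E + \<eta> * E"
  proof -
    have "energy {0..<1} (\<lambda>x. g0 x + - (g0 x - trig_poly H b x))
       \<le> (1 + \<eta>) * energy {0..<1} g0 + (1 + 1 / \<eta>) * energy {0..<1} (\<lambda>x. - (g0 x - trig_poly H b x))"
      using sq_int_diff[OF tp g0] by (intro energy_add_le_sq_int g0 \<eta>) auto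
    moreover have "energy {0..<1} (\<lambda>x. - (g0 x - trig_poly H b x)) = energy {0..<1} (\<lambda>x. g0 x - trig_poly H b x)"
      by (intro energy_cong) (rule norm_minus_cancel)
    ultimately show ?thesis using small g0E by (simp add: mult.commute)
  qed
  have R: "energy S R \<le> (1 - c) * energy {0..<1} (trig_poly H b)"
  proof -
    let ?X = "\<Sum>k\<in>H - \<Lambda>. (cmod (b k))\<^sup>2"
    have "{0..<1} = S \<union> ({0..<1} - S)" using S by auto
    then have "energy {0..<1} R = energy S R + energy ({0..<1} - S) R"
      using energy_Un[OF cont, of S "{0..<1} - S" "H - \<Lambda>" b] S bounded_subset_unit_interval
      by (auto simp: R_def)
    moreover have "energy {0..<1} R = ?X" using H(1) by (simp add: R_def parseval)
    moreover have "c * ?X \<le> energy ({0..<1} - S) R"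
      unfolding R_def using H(1) by (intro lower) auto
    ultimately have "energy S R \<le> (1 - c) * ?X" by (simp add: algebra_simps)
    also have "\<dots> \<le> (1 - c) * (\<Sum>k\<in>H. (cmod (b k))\<^sup>2)"
      using c H(1) by (intro mult_left_mono sum_mono2) auto
    finally show ?thesis using H(1) by (simp add: parseval)
  qed
  have "energy S (\<lambda>x. g x - trig_poly (H \<inter> \<Lambda>) b x) = energy S (\<lambda>x. R x + (g0 x - trig_poly H b x))"
    by (intro energy_cong) (simp add: split g0_def)
  also have "\<dots> \<le> (1 + \<eta>) * energy S R + (1 + 1 / \<eta>) * energy S (\<lambda>x. g0 x - trig_poly H b x)"
    using S \<eta> unfolding R_def by (intro energy_add_le_sq_int sq_int_diff g0 tp) auto
  also have "\<dots> \<le> (1 + \<eta>) * energy S R + E * \<eta>"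
  proof -
    have d: "sq_int (\<lambda>x. g0 x - trig_poly H b x)" by (intro sq_int_diff g0 tp)
    have "energy S (\<lambda>x. g0 x - trig_poly H b x) \<le> energy {0..<1} (\<lambda>x. g0 x - trig_poly H b x)"
      using d S set_integrable_subset[of lborel "{0..<1}" "\<lambda>x. (cmod (g0 x - trig_poly H b x))\<^sup>2" S]
      unfolding energy_def set_lebesgue_integral_def sq_int_def set_integrable_def
      by (intro integral_mono) (auto simp: indicator_def)
    then have "(1 + 1 / \<eta>) * energy S (\<lambda>x. g0 x - trig_poly H b x)
        \<le> (1 + 1 / \<eta>) * energy {0..<1} (\<lambda>x. g0 x - trig_poly H b x)"
      using \<eta> by (intro mult_left_mono) auto
    then show ?thesis using small by simp
  qed
  also have "\<dots> \<le> (1 + \<eta>) * ((1 - c) * ((1 + \<eta>) * E + \<eta> * E)) + E * \<eta>"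
    using R mult_left_mono[OF norm_H, of "1 - c"] c \<eta>
    by (intro add_right_mono mult_left_mono) auto
  also have "\<dots> = ((1 + \<eta>) * (1 - c) * (1 + 2 * \<eta>) + \<eta>) * E" by (simp add: algebra_simps)
  also have "\<dots> \<le> (1 - c / 4) * E"
  proof (intro mult_right_mono)
    have "(1 + \<eta>) * (1 - c) * (1 + 2 * \<eta>) + \<eta> = 1 - c / 2 - 11 * c ^ 2 / 32 - c ^ 3 / 32"
      by (simp add: \<eta>_def field_simps power2_eq_square power3_eq_cube)
    moreover have "0 \<le> c ^ 2" "0 \<le> c ^ 3" using c by auto
    ultimately show "(1 + \<eta>) * (1 - c) * (1 + 2 * \<eta>) + \<eta> \<le> 1 - c / 4" using c by linarith
  qed (use pos in \<open>simp add: E_def\<close>)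
  finally have "energy S (\<lambda>x. g x - trig_poly (H \<inter> \<Lambda>) b x) \<le> (1 - c / 4) * energy S g"
    by (simp add: E_def)
  moreover have "finite (H \<inter> \<Lambda>)" "H \<inter> \<Lambda> \<subseteq> \<Lambda>" using H(1) by auto
  ultimately show ?thesis by blast
qed

text \<open>Each remainder is again square integrable, so the contraction can be iterated with the
  same factor and the error decays geometrically.\<close>

lemma trig_poly_dense_from_dual_bound:
  assumes S: "S \<in> sets borel" "S \<subseteq> {0..<1}"
    and dual: "riesz_lower ({0..<1} - S) (- \<Lambda>)"
    and f: "sq_int f" and \<epsilon>: "\<epsilon> > 0"
  shows "\<exists>F a. finite F \<and> F \<subseteq> \<Lambda> \<and> energy S (\<lambda>x. f x - trig_poly F a x) < \<epsilon>"
proof -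
  obtain c0 where c0: "c0 > 0" "\<And>F a. finite F \<Longrightarrow> F \<subseteq> - \<Lambda> \<Longrightarrow>
      c0 * (\<Sum>k\<in>F. (cmod (a k))\<^sup>2) \<le> energy ({0..<1} - S) (trig_poly F a)"
    using dual unfolding riesz_lower_def by blast
  \<comment> \<open>The contraction multiplies energies by \<open>1 - c\<close>, which has to be
    nonnegative.\<close>
  define c where "c = min c0 1"
  have c: "0 < c" "c \<le> 1" using c0 by (auto simp: c_def)
  have lower: "c * (\<Sum>k\<in>F. (cmod (a k))\<^sup>2) \<le> energy ({0..<1} - S) (trig_poly F a)"
    if "finite F" "F \<subseteq> - \<Lambda>" for F a
  proof -
    have "c * (\<Sum>k\<in>F. (cmod (a k))\<^sup>2) \<le> c0 * (\<Sum>k\<in>F. (cmod (a k))\<^sup>2)"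
      by (intro mult_right_mono sum_nonneg) (auto simp: c_def)
    then show ?thesis using c0(2)[OF that, of a] by linarith
  qed
  define \<kappa> where "\<kappa> = 1 - c / 4"
  have \<kappa>: "0 \<le> \<kappa>" "\<kappa> < 1" using c by (auto simp: \<kappa>_def)
  have iter: "\<exists>F a. finite F \<and> F \<subseteq> \<Lambda> \<and> energy S (\<lambda>x. f x - trig_poly F a x) \<le> \<kappa> ^ n * energy S f" for n
  proof (induction n)
    case 0
    show ?case by (intro exI[of _ "{}"]) (simp add: trig_poly_def)
  next
    case (Suc n)
    then obtain F a where F: "finite F" "F \<subseteq> \<Lambda>" "energy S (\<lambda>x. f x - trig_poly F a x) \<le> \<kappa> ^ n * energy S f"
      by (elim exE conjE) (rule that)
    let ?g = "\<lambda>x. f x - trig_poly F a x"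
    show ?case
    proof (cases "energy S ?g > 0")
      case False
      then have "energy S ?g \<le> \<kappa> ^ Suc n * energy S f"
        using mult_nonneg_nonneg[OF zero_le_power[OF \<kappa>(1), of "Suc n"] energy_nonneg[of S f]] by linarith
      then show ?thesis using F by blast
    next
      case True
      have g: "sq_int ?g" by (intro sq_int_diff f sq_int_continuous continuous_intros)
      obtain G b where G: "finite G" "G \<subseteq> \<Lambda>" "energy S (\<lambda>x. ?g x - trig_poly G b x) \<le> \<kappa> * energy S ?g"
        using trig_approx_contraction[OF S c lower g True] unfolding \<kappa>_def by blast
      have "energy S (\<lambda>x. f x - trig_poly (F \<union> G)
          (\<lambda>k. (if k \<in> F then a k else 0) + (if k \<in> G then b k else 0)) x) = energy S (\<lambda>x. ?g x - trig_poly G b x)"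
        using trig_poly_add[OF F(1) G(1), of a _ b, symmetric] by (simp add: diff_diff_add)
      also have "\<dots> \<le> \<kappa> * (\<kappa> ^ n * energy S f)"
        using G(3) mult_left_mono[OF F(3) \<kappa>(1)] by linarith
      finally show ?thesis using F(1,2) G(1,2) by (intro exI[of _ "F \<union> G"] exI) (auto simp: mult.assoc)
    qed
  qed
  have "(\<lambda>n. \<kappa> ^ n * energy S f) \<longlonglongrightarrow> 0 * energy S f"
    using \<kappa> by (intro tendsto_mult tendsto_const LIMSEQ_power_zero) auto
  then have "eventually (\<lambda>n. \<kappa> ^ n * energy S f < \<epsilon>) sequentially"
    using \<epsilon> by (intro order_tendstoD(2)) auto
  then obtain n where "\<kappa> ^ n * energy S f < \<epsilon>" by (auto simp: eventually_sequentially)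
  then show ?thesis using iter[of n] by (meson le_less_trans)
qed

subsection \<open>From the circle to the line\<close>

lemma lebesgue_integral_eq_energy:
  assumes "S \<in> sets borel" "h \<in> borel_measurable borel"
  shows "(\<integral>x. (cmod (h x))\<^sup>2 \<partial>lebesgue_on S) = energy S h"
proof -
  have [measurable]: "S \<in> sets borel" "h \<in> borel_measurable borel" using assms by auto
  have "(\<integral>x. (cmod (h x))\<^sup>2 \<partial>lebesgue_on S) = (\<integral>x. indicator S x *\<^sub>R (cmod (h x))\<^sup>2 \<partial>lebesgue)"
    using assms by (intro integral_restrict_space) auto
  also have "\<dots> = energy S h"
    unfolding energy_def set_lebesgue_integral_def by (intro integral_completion) measurable
  finally show ?thesis .
qed

text \<open>Under the affine map the exponential of frequency \<open>k / R\<close> becomes the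
  integer exponential up to a constant phase, and all energies scale by \<open>R\<close>. The Riesz
  constants become \<open>R * c\<close> and \<open>R\<close>.\<close>

lemma riesz_basis_rescale:
  fixes S :: "real set"
  assumes R: "R > 0" and S': "{u. x0 + R * u \<in> S} \<in> sets borel" "{u. x0 + R * u \<in> S} \<subseteq> {0..<1}"
    and basis: "has_integer_basis {u. x0 + R * u \<in> S}"
  shows "\<exists>\<Lambda>. riesz_basis (lebesgue_on S) exponential \<Lambda>"
proof -
  let ?S' = "{u. x0 + R * u \<in> S}"
  obtain \<Lambda> where \<Lambda>: "riesz_lower ?S' \<Lambda>" "riesz_lower ({0..<1} - ?S') (- \<Lambda>)"
    using basis unfolding has_integer_basis_def by blast
  define \<phi> where "\<phi> = (\<lambda>k::int. of_int k / R)"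
  have inj: "inj \<phi>" using R by (auto simp: \<phi>_def inj_on_def)
  have S: "S \<in> sets borel"
  proof -
    have "(\<lambda>x. (x - x0) / R) -` ?S' \<inter> space borel \<in> sets borel"
      by (rule measurable_sets[OF _ S'(1)]) simp
    also have "(\<lambda>x. (x - x0) / R) -` ?S' \<inter> space borel = S" using R by auto
    finally show ?thesis .
  qed
  have bdd: "bounded S"
  proof -
    have "S \<subseteq> {x0..x0 + R}"
    proof
      fix x assume "x \<in> S"
      then have "(x - x0) / R \<in> ?S'" using R by simp
      then have "(x - x0) / R \<in> {0..<1}" using S'(2) by blast
      then show "x \<in> {x0..x0 + R}" using R by (auto simp: field_simps)
    qed
    then show ?thesis using bounded_closed_interval bounded_subset by blast
  qed
  have scale: "energy S h = R * energy ?S' (\<lambda>u. h (x0 + R * u))" for h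
    using energy_affine[of R S h x0] R by simp
  have exp_scale: "exponential (\<phi> k) (x0 + R * u) = exponential (\<phi> k) x0 * exponential (of_int k) u" for k u
  proof -
    have "exponential (\<phi> k) (R * u) = exponential (of_int k) u"
      using R by (simp add: \<phi>_def exponential_def mult_ac)
    then show ?thesis by (simp add: exponential_add_right)
  qed
  have "riesz_basis (lebesgue_on S) exponential (\<phi> ` \<Lambda>)"
    unfolding riesz_basis_def
  proof (intro conjI ballI)
    fix l assume "l \<in> \<phi> ` \<Lambda>"
    have m: "exponential l \<in> borel_measurable borel"
      by (intro borel_measurable_continuous_onI continuous_intros)
    have "exponential l \<in> borel_measurable (lebesgue_on S)"
      using m by (intro measurable_restrict_space1 measurable_completion) simp
    moreover have "integrable (lebesgue_on S) (\<lambda>x. 1 :: real)"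
    proof -
      have "S \<in> lmeasurable" using S bdd by (intro bounded_set_imp_lmeasurable) auto
      then show ?thesis by (intro finite_measure.integrable_const finite_measure_lebesgue_on)
    qed
    ultimately show "square_integrable (lebesgue_on S) (exponential l)"
      by (simp add: square_integrable_def)
  next
    show "complete_system (lebesgue_on S) exponential (\<phi> ` \<Lambda>)"
      unfolding complete_system_def
    proof (intro allI impI)
      fix f :: "real \<Rightarrow> complex" and \<epsilon> :: real assume f: "square_integrable (lebesgue_on S) f" and \<epsilon>: "0 < \<epsilon>"
      define g where "g = (\<lambda>x. if x \<in> S then f x else 0)"
      have Sl: "S \<in> sets lebesgue" using S by auto
      have g: "g \<in> borel_measurable lebesgue"
        using f Sl unfolding square_integrable_def g_def by (simp add: borel_measurable_if)
      have g_int: "integrable lebesgue (\<lambda>x. (cmod (g x))\<^sup>2)"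
      proof -
        have "integrable lebesgue (\<lambda>x. indicator S x *\<^sub>R (cmod (f x))\<^sup>2)"
          using f Sl integrable_restrict_space[of S lebesgue "\<lambda>x. (cmod (f x))\<^sup>2"]
          unfolding square_integrable_def by auto
        moreover have "indicator S x *\<^sub>R (cmod (f x))\<^sup>2 = (cmod (g x))\<^sup>2" for x by (simp add: g_def indicator_def)
        ultimately show ?thesis by simp
      qed
      \<comment> \<open>\<open>f\<close> is only Lebesgue measurable, while energies are integrals
        over \<open>lborel\<close>; real and imaginary part are replaced by Borel functions equal
        almost everywhere.\<close>
      obtain gr where gr: "gr \<in> borel_measurable lborel" "AE x in lborel. Re (g x) = gr x"
        using completion_ex_borel_measurable_real[of "\<lambda>x. Re (g x)" lborel] g by auto
      obtain gi where gi: "gi \<in> borel_measurable lborel" "AE x in lborel. Im (g x) = gi x"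
        using completion_ex_borel_measurable_real[of "\<lambda>x. Im (g x)" lborel] g by auto
      define g' where "g' = (\<lambda>x. Complex (gr x) (gi x))"
      have g'_eq: "g' = (\<lambda>x. of_real (gr x) + \<i> * of_real (gi x))"
        by (simp add: g'_def Complex_eq)
      have g'm[measurable]: "g' \<in> borel_measurable borel" unfolding g'_eq using gr gi by auto
      have AE: "AE x in lborel. g x = g' x"
        using gr(2) gi(2) by eventually_elim (simp add: g'_def complex_eq_iff)
      then have AE': "AE x in lebesgue. g x = g' x" by (rule AE_completion)
      have "integrable lebesgue (\<lambda>x. (cmod (g' x))\<^sup>2)"
        by (rule integrable_cong_AE_imp[OF g_int]) (use AE' in \<open>auto elim!: eventually_mono intro!: measurable_completion\<close>)
      then have g'_int: "integrable lborel (\<lambda>x. (cmod (g' x))\<^sup>2)"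
        by (subst (asm) integrable_completion) auto
      define h where "h = (\<lambda>u. g' (x0 + R * u))"
      have h: "sq_int h"
      proof -
        have [measurable]: "h \<in> borel_measurable borel" unfolding h_def by measurable
        have "integrable lborel (\<lambda>u. (cmod (h u))\<^sup>2)"
          unfolding h_def using lborel_integrable_real_affine[OF g'_int, of R x0] R by simp
        then have "set_integrable lborel {0..<1} (\<lambda>u. (cmod (h u))\<^sup>2)"
          unfolding set_integrable_def by (intro integrable_mult_indicator) auto
        then show ?thesis by (simp add: sq_int_def)
      qed
      have "\<epsilon>\<^sup>2 / R > 0" using \<epsilon> R by simp
      then obtain F a where F: "finite F" "F \<subseteq> \<Lambda>" "energy ?S' (\<lambda>u. h u - trig_poly F a u) < \<epsilon>\<^sup>2 / R"
        using trig_poly_dense_from_dual_bound[OF S' \<Lambda>(2) h] by blast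
      \<comment> \<open>The floor recovers \<open>k\<close> from \<open>l = k / R\<close>, and the
        exponential cancels the phase caused by the shift by \<open>x0\<close>.\<close>
      define b where "b = (\<lambda>l. a \<lfloor>l * R\<rfloor> * exponential (- l) x0)"
      define p where "p = (\<lambda>x. \<Sum>l\<in>\<phi> ` F. b l * exponential l x)"
      have p_cont: "continuous_on UNIV p" unfolding p_def by (intro continuous_intros)
      then have pm[measurable]: "p \<in> borel_measurable borel" by (rule borel_measurable_continuous_onI)
      have p: "p (x0 + R * u) = trig_poly F a u" for u
      proof -
        have "b (\<phi> k) * exponential (\<phi> k) (x0 + R * u) = a k * exponential (of_int k) u" for k
        proof -
          have "\<lfloor>\<phi> k * R\<rfloor> = k" using R by (simp add: \<phi>_def)
          moreover have "exponential (- \<phi> k) x0 * exponential (\<phi> k) x0 = 1"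
            by (simp flip: exponential_add)
          ultimately show ?thesis by (simp add: b_def exp_scale flip: mult.assoc)
        qed
        then show ?thesis
          unfolding p_def trig_poly_def by (subst sum.reindex) (auto intro: inj_on_subset[OF inj])
      qed
      have "(\<integral>x. (cmod (f x - p x))\<^sup>2 \<partial>lebesgue_on S) = (\<integral>x. indicator S x *\<^sub>R (cmod (f x - p x))\<^sup>2 \<partial>lebesgue)"
        using Sl by (intro integral_restrict_space) auto
      also have "\<dots> = (\<integral>x. indicator S x *\<^sub>R (cmod (g x - p x))\<^sup>2 \<partial>lebesgue)"
        by (intro Bochner_Integration.integral_cong) (auto simp: g_def indicator_def)
      also have "\<dots> = (\<integral>x. indicator S x *\<^sub>R (cmod (g' x - p x))\<^sup>2 \<partial>lebesgue)"
      proof (rule integral_cong_AE)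
        have [measurable]: "p \<in> borel_measurable lebesgue" "g' \<in> borel_measurable lebesgue" "S \<in> sets lebesgue"
          "g \<in> borel_measurable lebesgue"
          using Sl g by (auto intro: measurable_completion)
        show "(\<lambda>x. indicator S x *\<^sub>R (cmod (g x - p x))\<^sup>2) \<in> borel_measurable lebesgue" by measurable
        show "(\<lambda>x. indicator S x *\<^sub>R (cmod (g' x - p x))\<^sup>2) \<in> borel_measurable lebesgue" by measurable
        show "AE x in lebesgue. indicator S x *\<^sub>R (cmod (g x - p x))\<^sup>2 = indicator S x *\<^sub>R (cmod (g' x - p x))\<^sup>2"
          using AE' by eventually_elim simp
      qed
      also have "\<dots> = (\<integral>x. (cmod (g' x - p x))\<^sup>2 \<partial>lebesgue_on S)"
        using Sl by (intro integral_restrict_space[symmetric]) auto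
      also have "\<dots> = energy S (\<lambda>x. g' x - p x)"
        by (intro lebesgue_integral_eq_energy S borel_measurable_diff g'm pm)
      also have "\<dots> = R * energy ?S' (\<lambda>u. h u - trig_poly F a u)"
        by (simp add: scale h_def p)
      also have "\<dots> < \<epsilon>\<^sup>2" using F(3) R by (simp add: field_simps)
      finally have "L2_norm (lebesgue_on S) (\<lambda>x. f x - p x) < \<epsilon>"
        using \<epsilon> unfolding L2_norm_def by (intro real_less_lsqrt) (auto intro: integral_nonneg)
      then show "\<exists>F a. finite F \<and> F \<subseteq> \<phi> ` \<Lambda> \<and>
           L2_norm (lebesgue_on S) (\<lambda>x. f x - (\<Sum>i\<in>F. a i * exponential i x)) < \<epsilon>"
        using F(1,2) unfolding p_def by (intro exI[of _ "\<phi> ` F"] exI[of _ b]) auto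
    qed
  next
    obtain c where c': "c > 0 \<and> (\<forall>F a. finite F \<longrightarrow> F \<subseteq> \<Lambda> \<longrightarrow>
        c * (\<Sum>k\<in>F. (cmod (a k))\<^sup>2) \<le> energy ?S' (trig_poly F a))"
      using \<Lambda>(1) unfolding riesz_lower_def by (rule exE)
    note c = conjunct1[OF c'] conjunct2[OF c', rule_format]
    have bounds: "R * c * (\<Sum>i\<in>F. (cmod (a i))\<^sup>2) \<le> (L2_norm (lebesgue_on S) (\<lambda>x. \<Sum>i\<in>F. a i * exponential i x))\<^sup>2 \<and>
        (L2_norm (lebesgue_on S) (\<lambda>x. \<Sum>i\<in>F. a i * exponential i x))\<^sup>2 \<le> R * (\<Sum>i\<in>F. (cmod (a i))\<^sup>2)"
      if F: "finite F \<and> F \<subseteq> \<phi> ` \<Lambda>" for F and a :: "real \<Rightarrow> complex"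
    proof
      obtain G where G: "finite G" "G \<subseteq> \<Lambda>" "F = \<phi> ` G"
        using finite_subset_image[OF conjunct1[OF F] conjunct2[OF F]] by auto
      define b where "b = (\<lambda>k. a (\<phi> k) * exponential (\<phi> k) x0)"
      have injG: "inj_on \<phi> G" using inj by (rule inj_on_subset) simp
      define p where "p = (\<lambda>x. \<Sum>l\<in>F. a l * exponential l x)"
      have p: "p (x0 + R * u) = trig_poly G b u" for u
        unfolding p_def trig_poly_def G(3) sum.reindex[OF injG] by (simp add: b_def exp_scale mult.assoc)
      have sum: "(\<Sum>i\<in>F. (cmod (a i))\<^sup>2) = (\<Sum>k\<in>G. (cmod (b k))\<^sup>2)"
        unfolding G(3) sum.reindex[OF injG] by (simp add: b_def norm_mult)
      have "(L2_norm (lebesgue_on S) p)\<^sup>2 = energy S p"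
      proof -
        have "p \<in> borel_measurable borel"
          unfolding p_def by (intro borel_measurable_continuous_onI continuous_intros)
        then show ?thesis
          unfolding L2_norm_def lebesgue_integral_eq_energy[OF S \<open>p \<in> borel_measurable borel\<close>] by simp
      qed
      then have norm: "(L2_norm (lebesgue_on S) p)\<^sup>2 = R * energy ?S' (trig_poly G b)"
        unfolding scale p .
      have "c * (\<Sum>k\<in>G. (cmod (b k))\<^sup>2) \<le> energy ?S' (trig_poly G b)"
        by (rule c(2)[OF G(1,2)])
      from mult_left_mono[OF this, of R]
      show "R * c * (\<Sum>i\<in>F. (cmod (a i))\<^sup>2) \<le> (L2_norm (lebesgue_on S) (\<lambda>x. \<Sum>i\<in>F. a i * exponential i x))\<^sup>2"
        using norm R unfolding p_def sum by (simp add: mult.assoc)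
      have "energy ?S' (trig_poly G b) \<le> energy {0..<1} (trig_poly G b)"
        using S' by (intro energy_subset continuous_intros) auto
      also have "\<dots> = (\<Sum>k\<in>G. (cmod (b k))\<^sup>2)" by (rule parseval[OF G(1)])
      finally have "R * energy ?S' (trig_poly G b) \<le> R * (\<Sum>k\<in>G. (cmod (b k))\<^sup>2)"
        using R by (intro mult_left_mono) auto
      then show "(L2_norm (lebesgue_on S) (\<lambda>x. \<Sum>i\<in>F. a i * exponential i x))\<^sup>2 \<le> R * (\<Sum>i\<in>F. (cmod (a i))\<^sup>2)"
        using norm unfolding p_def sum by simp
    qed
    show "riesz_bounds (lebesgue_on S) exponential (\<phi> ` \<Lambda>)"
      unfolding riesz_bounds_def
    proof (rule exI[of _ "R * c"], rule conjI)
      show "R * c > 0" using R c by simp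
      show "\<exists>B>0. \<forall>F (a :: real \<Rightarrow> complex). finite F \<and> F \<subseteq> \<phi> ` \<Lambda> \<longrightarrow>
          R * c * (\<Sum>i\<in>F. (cmod (a i))\<^sup>2) \<le> (L2_norm (lebesgue_on S) (\<lambda>x. \<Sum>i\<in>F. a i * exponential i x))\<^sup>2 \<and>
          (L2_norm (lebesgue_on S) (\<lambda>x. \<Sum>i\<in>F. a i * exponential i x))\<^sup>2 \<le> B * (\<Sum>i\<in>F. (cmod (a i))\<^sup>2)"
        using R bounds by (intro exI[of _ R] conjI allI impI) auto
    qed
  qed
  then show ?thesis by blast
qed

section \<open>General intervals and the given combination\<close>

text \<open>Reduces open, closed, degenerate and empty intervals to half-open ones. Nothing is
  claimed at the endpoints, which later form a finite null set.\<close>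

lemma bounded_interval_endpoints:
  fixes I :: "real set"
  assumes "is_interval I" "I \<subseteq> {- M..M}" "M \<ge> 0"
  obtains s t where "- M \<le> s" "s \<le> t" "t \<le> M" "\<And>x. x \<noteq> s \<Longrightarrow> x \<noteq> t \<Longrightarrow> x \<in> I \<longleftrightarrow> s \<le> x \<and> x < t"
proof (cases "I = {}")
  case True
  then show ?thesis using that[of 0 0] assms(3) by auto
next
  case False
  have bdd: "bdd_below I" "bdd_above I"
    using assms(2) by (auto intro: bdd_below_mono[of "{- M..M}"] bdd_above_mono[of "{- M..M}"])
  show ?thesis
  proof (rule that[of "Inf I" "Sup I"])
    show "- M \<le> Inf I" using assms(2) False by (intro cInf_greatest) auto
    show "Inf I \<le> Sup I"
    proof -
      obtain x where "x \<in> I" using False by auto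
      then have "Inf I \<le> x" "x \<le> Sup I" using bdd by (auto intro: cInf_lower cSup_upper)
      then show ?thesis by linarith
    qed
    show "Sup I \<le> M" using assms(2) False by (intro cSup_least) auto
    fix x assume x: "x \<noteq> Inf I" "x \<noteq> Sup I"
    show "x \<in> I \<longleftrightarrow> Inf I \<le> x \<and> x < Sup I"
    proof
      assume "x \<in> I"
      then show "Inf I \<le> x \<and> x < Sup I" using bdd x by (metis cInf_lower cSup_upper less_le)
    next
      assume "Inf I \<le> x \<and> x < Sup I"
      then have lt: "Inf I < x" "x < Sup I" using x by auto
      obtain y where "y \<in> I" "y < x" using lt(1) False bdd by (auto simp: cInf_less_iff)
      moreover obtain z where "z \<in> I" "x < z" using lt(2) False bdd by (auto simp: less_cSup_iff)
      ultimately show "x \<in> I" using assms(1) unfolding is_interval_1 by (meson less_imp_le)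
    qed
  qed
qed

lemma energy_finite_difference:
  assumes P: "finite P" and S: "S \<in> sets borel" "T \<in> sets borel" and eq: "\<And>x. x \<notin> P \<Longrightarrow> x \<in> S \<longleftrightarrow> x \<in> T"
    and f: "continuous_on UNIV f"
  shows "energy S f = energy T f"
proof -
  have [measurable]: "S \<in> sets borel" "T \<in> sets borel" "f \<in> borel_measurable borel"
    using S borel_measurable_continuous_onI[OF f] by auto
  have "AE x in lborel. x \<notin> P"
    using P by (intro AE_not_in) (simp add: finite_imp_null_set_lborel)
  then have "AE x in lborel. indicat_real S x *\<^sub>R (cmod (f x))\<^sup>2 = indicat_real T x *\<^sub>R (cmod (f x))\<^sup>2"
    by eventually_elim (use eq in \<open>auto simp: indicator_def\<close>)
  then show ?thesis
    unfolding energy_def set_lebesgue_integral_def by (intro integral_cong_AE) auto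
qed

text \<open>Off the finitely many endpoints \<open>S\<close> agrees with a half-open step set
  \<open>T\<close>. Energies ignore finite sets, so \<open>S\<close> inherits the bounds of
  \<open>T\<close> with the same frequencies.\<close>

lemma has_integer_basis_combination:
  fixes c :: "'i \<Rightarrow> complex" and s t :: "'i \<Rightarrow> real"
  assumes A: "finite A" and st: "\<And>j. j \<in> A \<Longrightarrow> 0 \<le> s j \<and> s j \<le> t j \<and> t j < 1"
    and S: "S \<subseteq> {0..<1}"
    and comb: "\<And>x. x \<in> {0..<1} \<Longrightarrow> x \<notin> s ` A \<union> t ` A \<Longrightarrow>
      indicator S x = (\<Sum>j\<in>A. c j * indicator {s j..<t j} x)"
  shows "S \<in> sets borel" "has_integer_basis S"
proof -
  define P where "P = s ` A \<union> t ` A"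
  have st01: "0 \<le> s j" "s j < 1" "0 \<le> t j" "t j < 1" if "j \<in> A" for j
    using st[OF that] by linarith+
  have P: "finite P" "P \<subseteq> {0..<1}" using A st01 by (auto simp: P_def)
  define J where "J = (\<lambda>p. (\<Sum>j\<in>A. if s j = p then c j else 0) - (\<Sum>j\<in>A. if t j = p then c j else 0))"
  have sum_J: "(\<Sum>p\<in>{p\<in>P. Q p}. J p) = (\<Sum>j\<in>A. (if Q (s j) then c j else 0) - (if Q (t j) then c j else 0))" for Q
  proof -
    have "(\<Sum>p\<in>{p\<in>P. Q p}. \<Sum>j\<in>A. if e j = p then c j else 0) = (\<Sum>j\<in>A. if Q (e j) then c j else 0)"
      if "e ` A \<subseteq> P" for e
    proof (subst sum.swap, intro sum.cong refl)
      fix j assume "j \<in> A"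
      then have "e j \<in> P" using that by auto
      have "(\<Sum>p\<in>{p\<in>P. Q p}. if e j = p then c j else 0) = (if e j \<in> {p\<in>P. Q p} then c j else 0)"
        using P(1) by (intro sum.delta') simp
      then show "(\<Sum>p\<in>{p\<in>P. Q p}. if e j = p then c j else 0) = (if Q (e j) then c j else 0)"
        using \<open>e j \<in> P\<close> by simp
    qed
    from this[of s] this[of t] show ?thesis
      unfolding J_def sum_subtractf by (simp add: P_def)
  qed
  define T where "T = {x\<in>{0..<1}. step_fun 0 P J x = 1}"
  \<comment> \<open>The jumps \<open>J\<close> are complex; composing with \<open>h\<close> produces
    the integer jumps that a step set requires.\<close>
  define h where "h = (\<lambda>z::complex. if z = 1 then 1 else (0::int))"
  have T: "is_step_set (h 0) P (compose_jump h 0 P J) T"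
    unfolding is_step_set_def
  proof (intro conjI ballI)
    have "(\<Sum>p\<in>P. J p) = 0" using sum_J[of "\<lambda>_. True"] by simp
    then show "(\<Sum>p\<in>P. compose_jump h 0 P J p) = 0" by (rule sum_compose_jump_zero[OF P(1)])
    show "T \<subseteq> {0..<1}" by (auto simp: T_def)
    fix x :: real assume "x \<in> {0..<1}"
    then show "step_fun (h 0) P (compose_jump h 0 P J) x = (if x \<in> T then 1 else 0)"
      unfolding step_fun_compose[OF P(1), symmetric] by (simp add: h_def T_def)
  qed (use P in auto)
  have eq: "x \<in> S \<longleftrightarrow> x \<in> T" if "x \<notin> P" for x
  proof (cases "x \<in> {0..<1}")
    case True
    have "step_fun 0 P J x = (\<Sum>j\<in>A. c j * indicator {s j..<t j} x)"
      unfolding step_fun_def sum_J diff_0 sum_negf[symmetric]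
    proof (intro sum.cong refl)
      fix j assume "j \<in> A"
      then have "s j \<le> t j" using st by blast
      then show "- ((if x < s j then c j else 0) - (if x < t j then c j else 0)) = c j * indicator {s j..<t j} x"
        by (auto simp: indicator_def)
    qed
    also have "\<dots> = indicator S x" using comb[OF True] that by (simp add: P_def)
    finally show ?thesis using True by (simp add: T_def indicator_def)
  next
    case False
    then show ?thesis using S by (auto simp: T_def)
  qed
  have T_borel: "T \<in> sets borel" by (rule is_step_set_borel[OF T])
  \<comment> \<open>Nothing is assumed about measurability of \<open>S\<close>; it follows because
    \<open>S\<close> is \<open>T\<close> altered at finitely many points.\<close>
  have eqS: "(T - P) \<union> (S \<inter> P) = S" using eq by auto
  have "(T - P) \<union> (S \<inter> P) \<in> sets borel"
    using P(1) by (intro sets.Un sets.Diff T_borel borel_closed finite_imp_closed) auto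
  then show S_borel: "S \<in> sets borel" unfolding eqS .
  have energy: "energy S (trig_poly F b) = energy T (trig_poly F b)" for F b
    by (rule energy_finite_difference[OF P(1) S_borel T_borel eq]) (auto intro: continuous_intros)
  have energy': "energy ({0..<1} - S) (trig_poly F b) = energy ({0..<1} - T) (trig_poly F b)" for F b
    using S_borel T_borel eq
    by (intro energy_finite_difference[OF P(1)]) (auto intro: continuous_intros)
  show "has_integer_basis S"
    using has_integer_basis_step_set[OF T]
    unfolding has_integer_basis_def riesz_lower_cong[OF energy] riesz_lower_cong[OF energy'] .
qed

theorem theorem2:
  fixes \<alpha> \<beta> :: real and S :: "real set"
    and N :: nat and c :: "nat \<Rightarrow> complex" and I :: "nat \<Rightarrow> real set"
  assumes intervals: "\<And>j. j \<in> {1..N} \<Longrightarrow> is_interval (I j) \<and> bounded (I j)"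
    and combination: "\<And>x. indicator S x = (\<Sum>j=1..N. c j * indicator (I j) x)"
    and lengths: "\<And>j. j \<in> {1..N} \<Longrightarrow> measure lebesgue (I j) \<in> int_combinations \<alpha> \<beta>"
  shows "\<exists>\<Lambda> :: real set. riesz_basis (lebesgue_on S) exponential \<Lambda>"
proof -
  have "bounded (\<Union>j\<in>{1..N}. I j)" using intervals by (intro bounded_UN) auto
  then obtain B where B: "B > 0" "\<forall>x\<in>(\<Union>j\<in>{1..N}. I j). norm x \<le> B"
    using bounded_pos by metis
  \<comment> \<open>The margin keeps all rescaled right endpoints strictly below 1.\<close>
  define M where "M = B + 1"
  have M: "M > 0" "B < M" using B(1) by (simp_all add: M_def)
  have IB: "I j \<subseteq> {- B..B}" if "j \<in> {1..N}" for j
    using B(2) that by (force simp: abs_le_iff)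
  have "\<forall>j\<in>{1..N}. \<exists>st. - B \<le> fst st \<and> fst st \<le> snd st \<and> snd st \<le> B \<and>
      (\<forall>x. x \<noteq> fst st \<longrightarrow> x \<noteq> snd st \<longrightarrow> (x \<in> I j \<longleftrightarrow> fst st \<le> x \<and> x < snd st))"
  proof
    fix j assume j: "j \<in> {1..N}"
    obtain s t where "- B \<le> s" "s \<le> t" "t \<le> B" "\<And>x. x \<noteq> s \<Longrightarrow> x \<noteq> t \<Longrightarrow> x \<in> I j \<longleftrightarrow> s \<le> x \<and> x < t"
      using bounded_interval_endpoints[of "I j" B] intervals[OF j] IB[OF j] B(1) by (metis less_imp_le)
    then show "\<exists>st. - B \<le> fst st \<and> fst st \<le> snd st \<and> snd st \<le> B \<and>
      (\<forall>x. x \<noteq> fst st \<longrightarrow> x \<noteq> snd st \<longrightarrow> (x \<in> I j \<longleftrightarrow> fst st \<le> x \<and> x < snd st))"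
      by (intro exI[of _ "(s, t)"]) auto
  qed
  from bchoice[OF this] obtain st where st: "\<forall>j\<in>{1..N}. - B \<le> fst (st j) \<and> fst (st j) \<le> snd (st j) \<and>
      snd (st j) \<le> B \<and> (\<forall>x. x \<noteq> fst (st j) \<longrightarrow> x \<noteq> snd (st j) \<longrightarrow>
        (x \<in> I j \<longleftrightarrow> fst (st j) \<le> x \<and> x < snd (st j)))"
    by (rule exE)
  define u where "u = (\<lambda>x. (x + M) / (2 * M))"
  have u_less: "x < y \<longleftrightarrow> u x < u y" and u_le: "x \<le> y \<longleftrightarrow> u x \<le> u y" for x y
    using M by (simp_all add: u_def divide_less_cancel divide_le_cancel)
  have u_inv: "u (- M + 2 * M * v) = v" for v using M by (simp add: u_def field_simps)
  let ?S' = "{v. - M + 2 * M * v \<in> S}"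
  \<comment> \<open>Outside all the \<open>I j\<close> the combination vanishes, and with it the
    indicator of \<open>S\<close>; this is what makes \<open>S\<close> bounded.\<close>
  have S01: "?S' \<subseteq> {0..<1}"
  proof
    fix v assume "v \<in> ?S'"
    then have "(\<Sum>j=1..N. c j * indicator (I j) (- M + 2 * M * v)) \<noteq> 0"
      using combination[of "- M + 2 * M * v"] by simp
    then obtain j where "j \<in> {1..N}" "- M + 2 * M * v \<in> I j"
      by (metis (mono_tags, lifting) indicator_simps(2) mult_zero_right sum.neutral)
    then have "- M + 2 * M * v \<in> {- B..B}" using IB by blast
    then have "- B \<le> - M + 2 * M * v" "- M + 2 * M * v \<le> B" by simp_all
    then have "0 < 2 * M * v" "2 * M * v < 2 * M * 1" using M by linarith+
    then show "v \<in> {0..<1}" using M by (auto simp: zero_less_mult_iff)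
  qed
  have comb: "indicator ?S' v = (\<Sum>j\<in>{1..N}. c j * indicator {u (fst (st j))..<u (snd (st j))} v)"
    if v: "v \<notin> (\<lambda>j. u (fst (st j))) ` {1..N} \<union> (\<lambda>j. u (snd (st j))) ` {1..N}" for v
  proof -
    let ?x = "- M + 2 * M * v"
    have "indicator ?S' v = (\<Sum>j=1..N. c j * indicator (I j) ?x)"
      using combination[of ?x] by (simp add: indicator_def)
    also have "\<dots> = (\<Sum>j\<in>{1..N}. c j * indicator {u (fst (st j))..<u (snd (st j))} v)"
    proof (intro sum.cong refl)
      fix j assume j: "j \<in> {1..N}"
      have "v \<noteq> u (fst (st j))" "v \<noteq> u (snd (st j))" using v j by (auto simp: image_iff)
      then have "?x \<noteq> fst (st j)" "?x \<noteq> snd (st j)" by (metis u_inv)+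
      then have "?x \<in> I j \<longleftrightarrow> fst (st j) \<le> ?x \<and> ?x < snd (st j)" using st j by blast
      also have "\<dots> \<longleftrightarrow> v \<in> {u (fst (st j))..<u (snd (st j))}"
        using u_le[of "fst (st j)" ?x] u_less[of ?x "snd (st j)"] u_inv[of v] by simp
      finally show "c j * indicator (I j) ?x = c j * indicator {u (fst (st j))..<u (snd (st j))} v"
        by (simp add: indicator_def)
    qed
    finally show ?thesis .
  qed
  have ends: "0 \<le> u (fst (st j)) \<and> u (fst (st j)) \<le> u (snd (st j)) \<and> u (snd (st j)) < 1" if "j \<in> {1..N}" for j
  proof -
    have "- B \<le> fst (st j)" "fst (st j) \<le> snd (st j)" "snd (st j) \<le> B" using st that by auto
    then show ?thesis using M by (simp add: u_def divide_right_mono)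
  qed
  note basis = has_integer_basis_combination[of "{1..N}" "\<lambda>j. u (fst (st j))" "\<lambda>j. u (snd (st j))", OF _ ends S01 comb]
  show ?thesis
    using M basis by (intro riesz_basis_rescale[of "2 * M" "- M"] S01) auto
qed

end
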